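(* Let $N\ge 1$ be an integer and let $N<p<\infty$. Then, for every open set $\Omega\subseteq\mathbb{R}^N$ with finite inradius $r_\Omega$, we have \[ \lambda_p(\Omega)\ge\frac{\beta_{N,p}}{r_\Omega^p},\qquad\text{with }\ \beta_{N,p}=\max\left\{\frac{\Lambda_p(B_1\setminus\{0\})}{(\sqrt{N}+1)^p},\ \left(\frac{p-N}{p}\right)^p\right\}>0, \] and \[ \lambda_{p,\infty}(\Omega)\ge\frac{\Lambda_{p,\infty}(B_1\setminus\{0\})}{r_\Omega^{p-N}} . \] Moreover, for fixed $N$, the constants $\beta_{N,p}$ and $\Lambda_{p,\infty}(B_1\setminus\{0\})$ have the following asymptotic behaviours: \[ 0<\liminf_{p\searrow N}\frac{\beta_{N,p}}{(p-N)^{p-1}}\le\limsup_{p\searrow N}\frac{\beta_{N,p}}{(p-N)^{p-1}}<+\infty, \] \[ 0<\liminf_{p\searrow N}\frac{\Lambda_{p,\infty}(B_1\setminus\{0\})}{(p-N)^{p-1}}\le\limsup_{p\searrow N}\frac{\Lambda_{p,\infty}(B_1\setminus\{0\})}{(p-N)^{p-1}}<+\infty, \] and \[ \lim_{p\to\infty}\big(\beta_{N,p}\big)^{\frac1p}=\lim_{p\to\infty}\big(\Lambda_{p,\infty}(B_1\setminus\{0\})\big)^{\frac1p}=1 . \]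
   Context: $B_1\subseteq\mathbb{R}^N$ is the open unit ball centered at the origin. For an open set $\Omega\subseteq\mathbb{R}^N$, the inradius is $r_\Omega=\sup\{r>0 : \text{there exists a ball } B_r(x_0)\subseteq\Omega\}$, and \[ \lambda_{p,q}(\Omega)=\inf_{u\in C^\infty_0(\Omega)\setminus\{0\}}\frac{\|\nabla u\|_{L^p(\Omega)}^p}{\|u\|_{L^q(\Omega)}^p},\qquad \lambda_p(\Omega)=\lambda_{p,p}(\Omega). \] For $p>N$, an open bounded convex set $K\subseteq\mathbb{R}^N$ and $x_0\in\overline K$, the punctured Poincaré constants are \[ \Lambda_p(K\setminus\{x_0\})=\inf_{u\in\mathrm{Lip}(\overline K)}\left\{\int_K|\nabla u|^p\,dx : \|u\|_{L^p(K)}=1,\ u(x_0)=0\right\}, \] \[ \Lambda_{p,\infty}(K\setminus\{x_0\})=\inf_{u\in\mathrm{Lip}(\overline K)}\left\{\int_K|\nabla u|^p\,dx : \|u\|_{L^\infty(K)}=1,\ u(x_0)=0\right\}. \] *)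

theory Defs
  imports "HOL-Analysis.Analysis" "HOL-Probability.Essential_Supremum"
begin

text \<open>The space \<open>\<real>\<^sup>N\<close> is a type of class \<open>euclidean_space\<close>, with \<open>N = DIM('a)\<close>.
  Norms, energies and Poincare constants take values in \<open>[0, \<infinity>]\<close>, so that no integral and no
  infimum (in particular not the infimum over the empty set) is given a junk value.\<close>

text \<open>Powers in \<open>[0, \<infinity>]\<close>; only meant for exponents \<open>a > 0\<close>.\<close>

definition ennpowr :: "ennreal \<Rightarrow> real \<Rightarrow> ennreal" where
  "ennpowr x a = (if x = top then top else ennreal (enn2real x powr a))"

definition Lnorm :: "ennreal \<Rightarrow> 'a::euclidean_space set \<Rightarrow> ('a \<Rightarrow> 'b::real_normed_vector) \<Rightarrow> ennreal" where
  "Lnorm q \<Omega> f =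
    (if q = top then esssup (lebesgue_on \<Omega>) (\<lambda>x. ennreal (norm (f x)))
     else ennpowr (\<integral>\<^sup>+x. ennreal (norm (f x) powr enn2real q) \<partial>lebesgue_on \<Omega>) (1 / enn2real q))"

text \<open>The value is unspecified at points where \<open>u\<close> is not differentiable; for Lipschitz \<open>u\<close>
  these form a null set by Rademacher's theorem.\<close>

definition grad :: "('a::euclidean_space \<Rightarrow> real) \<Rightarrow> 'a \<Rightarrow> 'a" where
  "grad u x = (THE g. GDERIV u x :> g)"

primrec continuously_differentiable :: "nat \<Rightarrow> ('a::euclidean_space \<Rightarrow> real) \<Rightarrow> bool" where
  "continuously_differentiable 0 u \<longleftrightarrow> continuous_on UNIV u"
| "continuously_differentiable (Suc k) u \<longleftrightarrow>
    (\<forall>x. u differentiable (at x)) \<and>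
    (\<forall>v. continuously_differentiable k (\<lambda>x. frechet_derivative u (at x) v))"

text \<open>Elements of \<open>C\<^sub>0\<^sup>\<infinity>(\<Omega>)\<close> are extended by zero to the whole space.\<close>

definition test_functions :: "'a::euclidean_space set \<Rightarrow> ('a \<Rightarrow> real) set" where
  "test_functions \<Omega> = {u. (\<forall>k. continuously_differentiable k u) \<and>
    compact (closure {x. u x \<noteq> 0}) \<and> closure {x. u x \<noteq> 0} \<subseteq> \<Omega>}"

definition inradius :: "'a::euclidean_space set \<Rightarrow> ennreal" where
  "inradius \<Omega> = Sup {ennreal r | r. r > 0 \<and> (\<exists>x\<^sub>0. ball x\<^sub>0 r \<subseteq> \<Omega>)}"

definition poincare_const :: "real \<Rightarrow> ennreal \<Rightarrow> 'a::euclidean_space set \<Rightarrow> ennreal" where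
  "poincare_const p q \<Omega> =
    (INF u \<in> test_functions \<Omega> - {\<lambda>x. 0}.
      ennpowr (Lnorm (ennreal p) \<Omega> (grad u)) p / ennpowr (Lnorm q \<Omega> u) p)"

text \<open>\<open>\<Lambda>\<^bsub>p,q\<^esub>(K - {x\<^sub>0})\<close>, with \<open>K\<close> and \<open>x\<^sub>0\<close> as separate arguments; \<open>\<Lambda>\<^sub>p\<close> is the case \<open>q = p\<close>.
  A function in \<open>Lip(closure K)\<close> is represented by any function on the whole space that is
  Lipschitz on \<open>closure K\<close>; its values elsewhere do not matter since \<open>K\<close> is open.\<close>

definition punctured_const :: "real \<Rightarrow> ennreal \<Rightarrow> 'a::euclidean_space set \<Rightarrow> 'a \<Rightarrow> ennreal" where
  "punctured_const p q K x\<^sub>0 =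
    (INF u \<in> {u. (\<exists>L. L-lipschitz_on (closure K) u) \<and> Lnorm q K u = 1 \<and> u x\<^sub>0 = 0}.
      \<integral>\<^sup>+x. ennreal (norm (grad u x) powr p) \<partial>lebesgue_on K)"

definition beta_const :: "'a::euclidean_space itself \<Rightarrow> real \<Rightarrow> ennreal" where
  "beta_const _ p =
    max (punctured_const p (ennreal p) (ball (0::'a) 1) 0
           / ennreal ((sqrt (real DIM('a)) + 1) powr p))
        (ennreal (((p - real DIM('a)) / p) powr p))"

end

theory Submission
  imports Defs "HOL-Real_Asymp.Real_Asymp"
begin

text \<open>Everything is reduced to one inequality with the constant
  \<open>c\<^sub>p = p ((p - N) / (p - 1))\<^bsup>p-1\<^esup>\<close>: if \<open>K \<subseteq> B\<^sub>R(x\<^sub>0)\<close> is star-shaped with respect to \<open>x\<^sub>0\<close> and \<open>u\<close> is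
  Lipschitz, then \<open>c\<^sub>p \<integral>\<^sub>K |u - u(x\<^sub>0)|\<^bsup>p\<^esup> \<le> R\<^bsup>p\<^esup> \<integral>\<^sub>K |\<nabla>u|\<^bsup>p\<^esup>\<close>. It follows from Hoelder's inequality on the rays
  issuing from \<open>x\<^sub>0\<close>; that the classical gradient controls a Lipschitz function along almost every ray
  is Rademacher's theorem.

  On the unit ball this gives \<open>\<Lambda>\<^sub>p \<ge> c\<^sub>p\<close>, and applied also on \<open>B\<^sub>1 \<inter> B\<^sub>\<epsilon>(x)\<close> around a maximum point \<open>x\<close> it
  bounds \<open>\<Lambda>\<^bsub>p,\<infinity>\<^esub>\<close> from below. If \<open>u\<close> is a test function on \<open>\<Omega>\<close>, finitely many points outside \<open>\<Omega>\<close> come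
  within any \<open>\<rho> > r\<^sub>\<Omega>\<close> of each point of the support; their Voronoi cells, cut at radius \<open>\<rho>\<close>, are
  star-shaped around zeros of \<open>u\<close>, so \<open>\<lambda>\<^sub>p(\<Omega>) \<ge> c\<^sub>p / r\<^sub>\<Omega>\<^bsup>p\<^esup>\<close>. Regularisations of \<open>|x|\<^bsup>(p-N)/(p-1)\<^esup>\<close> show
  \<open>\<Lambda>\<^sub>p \<le> 2 c\<^sub>p \<le> (\<surd>N + 1)\<^bsup>p\<^esup> c\<^sub>p\<close>, hence \<open>\<beta>\<^bsub>N,p\<^esub> \<le> c\<^sub>p\<close>. For \<open>\<lambda>\<^bsub>p,\<infinity>\<^esub>\<close> it is enough to rescale the ball centred at
  the point outside \<open>\<Omega>\<close> nearest to a maximum point of \<open>|u|\<close>. All asymptotics are those of \<open>c\<^sub>p\<close>.\<close>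

section \<open>Differentiability of Lipschitz functions on the line\<close>

text \<open>The constant is one-dimensional. For \<open>\<alpha> = (p - N) / (p - 1)\<close> the
  weight \<open>t^(\<alpha>-1)\<close> is integrable at 0 because \<open>p > N\<close>, and
  Hoelder's inequality against it bounds \<open>|u(s) - u(0)|^p\<close> by
  \<open>s^(p-N) \<alpha>^(1-p)\<close> times the integral of \<open>|u'|^p t^(N-1)\<close> along
  the ray; integrating in \<open>s\<close> with the weight \<open>s^(N-1)\<close> adds
  \<open>R^p / p\<close>. Equality on a ray holds for \<open>t^\<alpha>\<close>, which is why powers
  of this kind serve as trial functions. The two entries of \<open>beta_const\<close> have different
  duties. Near \<open>N\<close> the entry \<open>((p-N)/p)^p\<close> is of smaller order than
  \<open>(p-N)^(p-1)\<close>, and the punctured constant carries the asymptotics. As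
  \<open>p\<close> grows, the p-th root of the first entry tends only to
  \<open>1 / (sqrt N + 1)\<close>, and the second one gives the limit 1. The obstacle is that
  \<open>grad\<close> is unspecified where a Lipschitz function is not differentiable.
  Differentiability on lines is obtained from Vitali coverings; the passage to several variables
  uses that almost no point of a closed set is a porous point of it.\<close>

lemma emeasure_interval_measure_add:
  fixes F H :: "real \<Rightarrow> real"
  assumes F: "mono F" "continuous_on UNIV F" and H: "mono H" "continuous_on UNIV H"
    and FH: "\<And>x. F x + H x = x" and A: "A \<in> sets borel"
  shows "emeasure (interval_measure F) A + emeasure (interval_measure H) A = emeasure lborel A"
proof -
  let ?m = "\<lambda>A. emeasure (interval_measure F) A + emeasure (interval_measure H) A"
  define M :: "real measure" where "M = measure_of UNIV (sets borel) ?m"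
  have ca: "countably_additive (sets borel) ?m"
  proof (rule countably_additiveI)
    fix A :: "nat \<Rightarrow> real set"
    assume A: "range A \<subseteq> sets borel" "disjoint_family A" "(\<Union>i. A i) \<in> sets borel"
    have "(\<Sum>i. ?m (A i)) = (\<Sum>i. emeasure (interval_measure F) (A i)) + (\<Sum>i. emeasure (interval_measure H) (A i))"
      by (intro suminf_add[symmetric]) auto
    also have "\<dots> = ?m (\<Union>i. A i)"
      using A by (subst (1 2) suminf_emeasure) auto
    finally show "(\<Sum>i. ?m (A i)) = ?m (\<Union>i. A i)" .
  qed
  have sM: "sets M = sets borel" unfolding M_def
    using sets.sigma_sets_eq[of "borel :: real measure"] by (subst sets_measure_of) auto
  have M: "emeasure M B = ?m B" if "B \<in> sets borel" for B
    unfolding M_def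
    by (rule emeasure_measure_of_sigma)
      (use ca that sets.sigma_algebra_axioms[of "borel :: real measure"] in \<open>auto simp: positive_def\<close>)
  have pt: "emeasure (interval_measure G) {l<..<u} = G u - G l"
    if G: "mono G" "continuous_on UNIV G" and lu: "l \<le> u" for G :: "real \<Rightarrow> real" and l u
  proof (cases "l < u")
    case True
    have m: "x \<le> y \<Longrightarrow> G x \<le> G y" for x y using G(1) by (auto dest: monoD)
    have "emeasure (interval_measure G) {l<..<u} = emeasure (interval_measure G) ({l..u} - {l} - {u})"
      by (rule arg_cong[where f="emeasure _"]) auto
    also have "\<dots> = emeasure (interval_measure G) {l..u} - 0 - 0"
      using emeasure_interval_measure_Icc[OF _ m G(2), of l l] emeasure_interval_measure_Icc[OF _ m G(2), of u u]
        emeasure_interval_measure_Icc[OF lu m G(2)] True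
      by (subst emeasure_Diff, auto, subst emeasure_Diff, auto)
    finally show ?thesis using emeasure_interval_measure_Icc[OF lu m G(2)] by simp
  qed (use lu in auto)
  \<comment> \<open>Lebesgue measure is determined by boxes. By continuity neither measure has
    atoms, so each gives an open interval the increment of its function (\<open>pt\<close>), and the
    increments of \<open>F\<close> and \<open>H\<close> add up to the length.\<close>
  have "lborel = M"
  proof (rule lborel_eqI)
    fix l u :: real assume lu: "\<And>b. b \<in> Basis \<Longrightarrow> l \<bullet> b \<le> u \<bullet> b"
    then have lu: "l \<le> u" by auto
    have "emeasure M (box l u) = ennreal (F u - F l) + ennreal (H u - H l)"
      using pt[OF F lu] pt[OF H lu] by (simp add: M)
    also have "\<dots> = ennreal (u - l)"
      using monoD[OF F(1) lu] monoD[OF H(1) lu] FH[of l] FH[of u]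
      by (simp add: ennreal_plus[symmetric] algebra_simps del: ennreal_plus)
    finally show "emeasure M (box l u) = (\<Prod>b\<in>Basis. (u - l) \<bullet> b)" by simp
  qed (simp add: sM)
  then show ?thesis using M[OF A] by simp
qed

text \<open>Vitali covering: the intervals in \<open>sl\<close> contain \<open>x\<close> at
  arbitrarily small scales, so countably many disjoint ones inside an open \<open>T\<close> slightly
  larger than \<open>E\<close> cover \<open>E\<close> up to a Lebesgue null set. By
  \<open>ac\<close> the rest is also null for the measure of \<open>F\<close>, and each chosen
  interval has measure at most \<open>a\<close> times its length. Applied below to \<open>F\<close>
  with slope \<open>a\<close> and to \<open>x - F x\<close> with slope \<open>1 - b\<close>.\<close>

lemma interval_measure_le_of_small_slopes:
  fixes F :: "real \<Rightarrow> real"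
  assumes F: "mono F" "continuous_on UNIV F"
    and ac: "\<And>A. A \<in> sets borel \<Longrightarrow> emeasure (interval_measure F) A \<le> emeasure lborel A"
    and E: "E \<in> sets borel" "emeasure lborel E < \<infinity>" and a: "0 \<le> a"
    and sl: "\<And>x d. x \<in> E \<Longrightarrow> 0 < d \<Longrightarrow> \<exists>c e. c < x \<and> x < e \<and> e - c < d \<and> F e - F c \<le> a * (e - c)"
  shows "emeasure (interval_measure F) E \<le> a * emeasure lborel E"
proof (rule ennreal_le_epsilon)
  fix \<eta> :: real assume "0 < \<eta>"
  \<comment> \<open>The denominator \<open>a + 1\<close> keeps the quotient meaningful at
    \<open>a = 0\<close>.\<close>
  define h where "h = \<eta> / (a + 1)"
  have h: "0 < h" "a * h \<le> \<eta>" using \<open>0 < \<eta>\<close> a by (auto simp: h_def field_simps)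
  obtain T where T: "open T" "E \<subseteq> T" "emeasure lebesgue (T - E) < ennreal h"
    using sets_lebesgue_outer_open[of E h] E(1) h(1) by (metis sets_completionI_sets sets_lborel)
  let ?\<mu> = "interval_measure F"
  \<comment> \<open>The covering theorem speaks of balls, so an interval is indexed by its midpoint
    \<open>m\<close> and half-length \<open>r\<close>.\<close>
  let ?K = "{(m, r). 0 < r \<and> {m - r<..<m + r} \<subseteq> T \<and> F (m + r) - F (m - r) \<le> a * (2 * r)}"
  have b: "ball m r = {m - r<..<m + r}" for m r :: real by (auto simp: dist_real_def)
  have "\<exists>i. i \<in> ?K \<and> x \<in> ball (fst i) (snd i) \<and> snd i < d" if x: "x \<in> E" "0 < d" for x d
  proof -
    obtain e where e: "0 < e" "ball x e \<subseteq> T" using T x open_contains_ball[of T] by blast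
    obtain c f where cf: "c < x" "x < f" "f - c < min d e" "F f - F c \<le> a * (f - c)"
      using sl[OF x(1), of "min d e"] e x by auto
    have "{c<..<f} \<subseteq> ball x e" using cf by (auto simp: dist_real_def)
    with e cf have "((c + f) / 2, (f - c) / 2) \<in> ?K \<and> x \<in> ball ((c + f) / 2) ((f - c) / 2) \<and> (f - c) / 2 < d"
      unfolding b by (auto simp: field_simps)
    then show ?thesis by (intro exI[of _ "((c + f) / 2, (f - c) / 2)"]) auto
  qed
  then obtain C where C: "countable C" "C \<subseteq> ?K"
    "pairwise (\<lambda>i j. disjnt (ball (fst i) (snd i)) (ball (fst j) (snd j))) C"
    "negligible (E - (\<Union>i\<in>C. ball (fst i) (snd i)))"
    by (rule Vitali_covering_theorem_balls) blast
  let ?U = "\<Union>i\<in>C. ball (fst i) (snd i)"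
  have U: "?U \<in> sets borel" by (intro borel_open) auto
  have dis: "disjoint_family_on (\<lambda>i. ball (fst i) (snd i)) C"
    using C(3) by (auto simp: disjoint_family_on_def pairwise_def disjnt_def)
  have "emeasure ?\<mu> (E - ?U) \<le> emeasure lborel (E - ?U)" by (intro ac) (use E U in auto)
  also have "\<dots> = emeasure lebesgue (E - ?U)" using E(1) U by simp
  also have "\<dots> = 0" using C(4) unfolding negligible_iff_null_sets by (rule null_setsD1)
  finally have z: "emeasure ?\<mu> (E - ?U) = 0" by simp
  have "emeasure ?\<mu> E \<le> emeasure ?\<mu> ((E - ?U) \<union> ?U)" by (intro emeasure_mono) (use E U in auto)
  also have "\<dots> \<le> emeasure ?\<mu> (E - ?U) + emeasure ?\<mu> ?U" by (intro emeasure_subadditive) (use E U in auto)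
  also have "\<dots> = (\<integral>\<^sup>+i. emeasure ?\<mu> (ball (fst i) (snd i)) \<partial>count_space C)"
    using z C(1) dis by (simp add: emeasure_UN_countable)
  also have "\<dots> \<le> (\<integral>\<^sup>+i. a * emeasure lborel (ball (fst i) (snd i)) \<partial>count_space C)"
  proof (rule nn_integral_mono)
    fix i assume "i \<in> space (count_space C)"
    then obtain m r where i: "i = (m, r)" and mr: "0 < r" "F (m + r) - F (m - r) \<le> a * (2 * r)" using C(2) by auto
    have "emeasure ?\<mu> (ball m r) \<le> emeasure ?\<mu> {m - r..m + r}" unfolding b by (intro emeasure_mono) auto
    also have "\<dots> = F (m + r) - F (m - r)"
      using emeasure_interval_measure_Icc[of "m - r" "m + r" F] monoD[OF F(1)] F(2) mr by auto
    also have "\<dots> \<le> a * (2 * r)" using mr by (intro ennreal_leI) auto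
    also have "\<dots> = a * emeasure lborel (ball m r)" unfolding b using a mr by (simp add: ennreal_mult)
    finally show "emeasure ?\<mu> (ball (fst i) (snd i)) \<le> a * emeasure lborel (ball (fst i) (snd i))" using i by simp
  qed
  also have "\<dots> = a * emeasure lborel ?U"
    using C(1) dis by (simp add: emeasure_UN_countable nn_integral_cmult)
  also have "\<dots> \<le> a * (emeasure lborel E + h)"
  proof (rule mult_left_mono)
    have "?U \<subseteq> T"
    proof (rule UN_least)
      fix i assume "i \<in> C"
      then have "i \<in> ?K" using C(2) by blast
      then show "ball (fst i) (snd i) \<subseteq> T" unfolding b by (cases i) auto
    qed
    then have "emeasure lborel ?U \<le> emeasure lborel (E \<union> (T - E))"
      by (intro emeasure_mono) (use E T in auto)
    also have "\<dots> \<le> emeasure lborel E + emeasure lborel (T - E)" by (intro emeasure_subadditive) (use E T in auto)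
    also have "emeasure lborel (T - E) \<le> h" using T(3) E(1) T(1) by (simp add: emeasure_completion)
    finally show "emeasure lborel ?U \<le> emeasure lborel E + h" by (simp add: add_left_mono)
  qed auto
  also have "\<dots> = a * emeasure lborel E + ennreal (a * h)" using a h by (simp add: distrib_left ennreal_mult)
  also have "\<dots> \<le> a * emeasure lborel E + ennreal \<eta>" using h by (intro add_left_mono ennreal_leI) auto
  finally show "emeasure ?\<mu> E \<le> a * emeasure lborel E + ennreal \<eta>" .
qed

text \<open>By \<open>dich\<close>, slopes below \<open>a\<close> and slopes above \<open>b\<close>
  cannot both occur over arbitrarily short intervals around \<open>x\<close>; hence the slopes over
  intervals straddling \<open>x\<close> converge. The limit is the derivative, since a slope with
  one endpoint at \<open>x\<close> is a limit of straddling slopes by continuity of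
  \<open>F\<close>.\<close>

lemma convergent_slopes_imp_differentiable:
  fixes F :: "real \<Rightarrow> real"
  assumes cont: "continuous_on UNIV F"
    and bd: "\<And>c e. c < e \<Longrightarrow> 0 \<le> F e - F c \<and> F e - F c \<le> e - c"
    and dich: "\<And>a b. a \<in> \<rat> \<Longrightarrow> b \<in> \<rat> \<Longrightarrow> a < b \<Longrightarrow>
      \<exists>d>0. (\<forall>c e. c < x \<and> x < e \<and> e - c < d \<longrightarrow> a * (e - c) < F e - F c) \<or>
            (\<forall>c e. c < x \<and> x < e \<and> e - c < d \<longrightarrow> F e - F c < b * (e - c))"
  shows "F differentiable (at x)"
proof -
  \<comment> \<open>\<open>D\<close> collects the eventual lower bounds of the slopes, so
    \<open>Sup D\<close> is their lower limit.\<close>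
  define D where "D = {a. \<exists>d>0. \<forall>c e. c < x \<and> x < e \<and> e - c < d \<longrightarrow> a * (e - c) \<le> F e - F c}"
  have D0: "0 \<in> D" using bd by (auto simp: D_def intro!: exI[of _ 1])
  have D2: "a \<le> 2" if aD: "a \<in> D" for a
  proof (rule ccontr)
    assume "\<not> a \<le> 2"
    obtain d where d: "0 < d" "\<forall>c e. c < x \<and> x < e \<and> e - c < d \<longrightarrow> a * (e - c) \<le> F e - F c"
      using aD unfolding D_def by blast
    have "a * (2 * (d / 3)) \<le> F (x + d/3) - F (x - d/3)" using d(2)[rule_format, of "x - d/3" "x + d/3"] d(1) by auto
    also have "\<dots> \<le> 2 * (d / 3)" using bd[of "x - d/3" "x + d/3"] d(1) by auto
    finally have "a * (2 * (d / 3)) \<le> 1 * (2 * (d / 3))" by simp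
    then show False using d(1) \<open>\<not> a \<le> 2\<close> by (subst (asm) mult_le_cancel_right) auto
  qed
  have bdd: "bdd_above D" using D2 by (rule bdd_aboveI)
  define l where "l = Sup D"
  have key: "\<exists>d>0. \<forall>c e. c < x \<and> x < e \<and> e - c < d \<longrightarrow> \<bar>F e - F c - l * (e - c)\<bar> \<le> \<epsilon> * (e - c)" if eps: "0 < \<epsilon>" for \<epsilon>
  proof -
    obtain a where a: "a \<in> D" "l - \<epsilon> < a"
      using less_cSup_iff[of D "l - \<epsilon>"] D0 bdd eps by (auto simp: l_def)
    \<comment> \<open>Two rationals in the gap above \<open>l\<close>: \<open>p\<close> exceeds
      \<open>Sup D\<close>, so the first alternative for \<open>p < q\<close> fails, and the second
      bounds the slopes by \<open>q < l + \<epsilon>\<close>.\<close>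
    obtain p where p: "p \<in> \<rat>" "l < p" "p < l + \<epsilon>" using Rats_dense_in_real[of l "l + \<epsilon>"] eps by auto
    obtain q where q: "q \<in> \<rat>" "p < q" "q < l + \<epsilon>" using Rats_dense_in_real[of p "l + \<epsilon>"] p by auto
    obtain d1 where d1: "d1 > 0" "\<And>c e. c < x \<Longrightarrow> x < e \<Longrightarrow> e - c < d1 \<Longrightarrow> a * (e - c) \<le> F e - F c"
      using a by (auto simp: D_def)
    have pD: "p \<notin> D" using p(2) cSup_upper[OF _ bdd, of p] unfolding l_def by linarith
    obtain d2 where d2: "d2 > 0" "(\<forall>c e. c < x \<and> x < e \<and> e - c < d2 \<longrightarrow> p * (e - c) < F e - F c) \<or>
            (\<forall>c e. c < x \<and> x < e \<and> e - c < d2 \<longrightarrow> F e - F c < q * (e - c))"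
      using dich[OF p(1) q(1,2)] by blast
    have d2': "F e - F c < q * (e - c)" if "c < x" "x < e" "e - c < d2" for c e
    proof -
      have "\<not> (\<forall>c e. c < x \<and> x < e \<and> e - c < d2 \<longrightarrow> p * (e - c) < F e - F c)"
        using pD d2(1) unfolding D_def by (blast intro: less_imp_le)
      then show ?thesis using d2(2) that by blast
    qed
    have "\<bar>F e - F c - l * (e - c)\<bar> \<le> \<epsilon> * (e - c)" if "c < x" "x < e" "e - c < min d1 d2" for c e
    proof -
      have "(l - \<epsilon>) * (e - c) \<le> a * (e - c)" "q * (e - c) \<le> (l + \<epsilon>) * (e - c)"
        using a q that by (intro mult_right_mono; simp)+
      then show ?thesis using d1(2)[of c e] d2'[of c e] that by (auto simp: algebra_simps abs_le_iff)
    qed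
    then show ?thesis using d1 d2 by (intro exI[of _ "min d1 d2"]) auto
  qed
  have "(F has_real_derivative l) (at x)"
    unfolding has_field_derivative_def has_derivative_at_alt
  proof (intro conjI allI impI)
    fix \<epsilon> :: real assume "0 < \<epsilon>"
    then obtain d where d: "d > 0" "\<And>c e. c < x \<Longrightarrow> x < e \<Longrightarrow> e - c < d \<Longrightarrow> \<bar>F e - F c - l * (e - c)\<bar> \<le> \<epsilon> * (e - c)"
      using key by blast
    have cF: "(F \<longlongrightarrow> F y) (at y within A)" for y A
    proof -
      have "(F \<longlongrightarrow> F y) (at y within UNIV)" using cont unfolding continuous_on_def by blast
      then show ?thesis by (rule tendsto_within_subset) simp
    qed
    \<comment> \<open>\<open>key\<close> needs \<open>c < x < e\<close> strictly; here
      \<open>c\<close> tends to \<open>x\<close> from the left and the inequality passes to the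
      limit.\<close>
    have right: "\<bar>F e - F x - l * (e - x)\<bar> \<le> \<epsilon> * (e - x)" if "x < e" "e - x < d" for e
    proof (rule tendsto_le)
      show "((\<lambda>c. \<bar>F e - F c - l * (e - c)\<bar>) \<longlongrightarrow> \<bar>F e - F x - l * (e - x)\<bar>) (at_left x)"
        by (intro tendsto_intros cF)
      show "((\<lambda>c. \<epsilon> * (e - c)) \<longlongrightarrow> \<epsilon> * (e - x)) (at_left x)" by (intro tendsto_intros)
      show "\<forall>\<^sub>F c in at_left x. \<bar>F e - F c - l * (e - c)\<bar> \<le> \<epsilon> * (e - c)"
        using eventually_at_left_real[of "e - d" x] that d(2) by (auto elim!: eventually_mono)
    qed auto
    have left: "\<bar>F x - F c - l * (x - c)\<bar> \<le> \<epsilon> * (x - c)" if "c < x" "x - c < d" for c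
    proof (rule tendsto_le)
      show "((\<lambda>e. \<bar>F e - F c - l * (e - c)\<bar>) \<longlongrightarrow> \<bar>F x - F c - l * (x - c)\<bar>) (at_right x)"
        by (intro tendsto_intros cF)
      show "((\<lambda>e. \<epsilon> * (e - c)) \<longlongrightarrow> \<epsilon> * (x - c)) (at_right x)" by (intro tendsto_intros)
      show "\<forall>\<^sub>F e in at_right x. \<bar>F e - F c - l * (e - c)\<bar> \<le> \<epsilon> * (e - c)"
        using eventually_at_right_real[of x "c + d"] that d(2) by (auto elim!: eventually_mono)
    qed auto
    show "\<exists>d>0. \<forall>y. norm (y - x) < d \<longrightarrow> norm (F y - F x - l * (y - x)) \<le> \<epsilon> * norm (y - x)"
    proof (intro exI[of _ d] conjI allI impI)
      fix y assume y: "norm (y - x) < d"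
      consider "y = x" | "x < y" | "y < x" by linarith
      then show "norm (F y - F x - l * (y - x)) \<le> \<epsilon> * norm (y - x)"
      proof cases
        case 2 then show ?thesis using right[of y] y by auto
      next
        case 3
        have "norm (F y - F x - l * (y - x)) = \<bar>F x - F y - l * (x - y)\<bar>" by (auto simp: algebra_simps)
        then show ?thesis using left[of y] y 3 by auto
      qed auto
    qed (use d in auto)
  qed (auto intro: bounded_linear_mult_right)
  then show ?thesis by (auto simp: real_differentiable_def)
qed

text \<open>\<open>E a b\<close> consists of the points with slopes \<open>\<le> a\<close> and
  slopes \<open>\<ge> b\<close> at every scale. On a bounded part of it, of Lebesgue measure
  \<open>m\<close>, the measure of \<open>F\<close> is at most \<open>a m\<close> and that of
  \<open>H = x - F\<close> at most \<open>(1 - b) m\<close>. The two add up to Lebesgue measure, so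
  \<open>m \<le> (1 - (b - a)) m\<close>, that is, \<open>m = 0\<close>.\<close>

lemma AE_differentiable_mono_slope_le_1:
  fixes F :: "real \<Rightarrow> real"
  assumes bd: "\<And>c e. c < e \<Longrightarrow> 0 \<le> F e - F c \<and> F e - F c \<le> e - c"
  shows "AE x in lborel. F differentiable (at x)"
proof -
  define H where "H x = x - F x" for x
  have lip: "1-lipschitz_on UNIV F"
  proof (rule lipschitz_onI)
    fix x y show "dist (F x) (F y) \<le> 1 * dist x y"
      using bd[of x y] bd[of y x] by (cases x y rule: linorder_cases) (auto simp: dist_real_def)
  qed simp
  have cF: "continuous_on UNIV F" using lip lipschitz_on_continuous_on by blast
  have cH: "continuous_on UNIV H" unfolding H_def by (intro continuous_intros cF)
  have mF: "mono F" using bd by (intro monoI) (metis diff_ge_0_iff_ge order_le_less)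
  have mH: "mono H" using bd unfolding H_def
    by (intro monoI) (smt (verit) order_le_less)
  have sum: "emeasure (interval_measure F) A + emeasure (interval_measure H) A = emeasure lborel A"
    if "A \<in> sets borel" for A
    by (rule emeasure_interval_measure_add[OF mF cF mH cH _ that]) (simp add: H_def)
  have leF: "emeasure (interval_measure F) A \<le> emeasure lborel A"
    and leH: "emeasure (interval_measure H) A \<le> emeasure lborel A" if "A \<in> sets borel" for A
    using sum[OF that] by (metis le_iff_add, metis le_iff_add add.commute)
  \<comment> \<open>Open as unions of open intervals, which makes \<open>E\<close> a Borel
    set.\<close>
  define U where "U a d = (\<Union>(c, e)\<in>{(c, e). e - c < d \<and> F e - F c \<le> a * (e - c)}. {c<..<e})" for a d
  define V where "V a d = (\<Union>(c, e)\<in>{(c, e). e - c < d \<and> a * (e - c) \<le> F e - F c}. {c<..<e})" for a d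
  define E where "E a b = (\<Inter>n. U a (1 / real (Suc n)) \<inter> V b (1 / real (Suc n)))" for a b
  have UV: "open (U a d)" "open (V a d)" for a d unfolding U_def V_def by (auto intro!: open_UN)
  then have EB: "E a b \<in> sets borel" for a b unfolding E_def by (intro sets.countable_INT'') auto
  have null: "AE x in lborel. x \<notin> E a b" if "a < b" "0 \<le> a" "b \<le> 1" for a b
  proof -
    have n: "E a b \<inter> {- real n..real n} \<in> null_sets lborel" for n :: nat
    proof -
      let ?E = "E a b \<inter> {- real n..real n}"
      have B: "?E \<in> sets borel" using EB by auto
      have fin: "emeasure lborel ?E < \<infinity>"
        by (rule le_less_trans[OF emeasure_mono[of _ "{- real n..real n}"]]) (auto simp: B)
      have n1: "\<exists>n. 1 / real (Suc n) < d" if "0 < d" for d :: real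
        using that nat_approx_posE by blast
      have 1: "emeasure (interval_measure F) ?E \<le> a * emeasure lborel ?E"
      proof (rule interval_measure_le_of_small_slopes[OF mF cF leF B fin])
        fix x d :: real assume x: "x \<in> ?E" "0 < d"
        obtain n where "1 / real (Suc n) < d" using n1 x by blast
        moreover have "x \<in> U a (1 / real (Suc n))" using x by (auto simp: E_def)
        ultimately show "\<exists>c e. c < x \<and> x < e \<and> e - c < d \<and> F e - F c \<le> a * (e - c)"
          unfolding U_def by auto (meson less_trans)
      qed (use that in auto)
      have 2: "emeasure (interval_measure H) ?E \<le> (1 - b) * emeasure lborel ?E"
      proof (rule interval_measure_le_of_small_slopes[OF mH cH leH B fin])
        fix x d :: real assume x: "x \<in> ?E" "0 < d"
        obtain n where "1 / real (Suc n) < d" using n1 x by blast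
        moreover have "x \<in> V b (1 / real (Suc n))" using x by (auto simp: E_def)
        ultimately obtain c e where "c < x \<and> x < e \<and> e - c < d \<and> b * (e - c) \<le> F e - F c"
          unfolding V_def by auto (meson less_trans)
        then show "\<exists>c e. c < x \<and> x < e \<and> e - c < d \<and> H e - H c \<le> (1 - b) * (e - c)"
          by (intro exI[of _ c] exI[of _ e]) (auto simp: H_def algebra_simps)
      qed (use that in auto)
      obtain m where m: "emeasure lborel ?E = ennreal m" "0 \<le> m"
        using fin by (cases "emeasure lborel ?E") auto
      have nn: "0 \<le> a * m" "0 \<le> (1 - b) * m" using m that by (simp_all add: mult_nonneg_nonneg)
      have "ennreal m \<le> ennreal (a * m) + ennreal ((1 - b) * m)"
        using sum[OF B] add_mono[OF 1 2] m that by (simp add: ennreal_mult)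
      also have "\<dots> = ennreal (a * m + (1 - b) * m)" by (rule ennreal_plus[OF nn, symmetric])
      finally have "m \<le> a * m + (1 - b) * m" using nn by (subst (asm) ennreal_le_iff) linarith+
      then have "(b - a) * m \<le> 0" by (simp add: algebra_simps)
      then have "m \<le> 0" using that by (simp add: mult_le_0_iff)
      then show ?thesis using m B by (auto intro!: null_setsI)
    qed
    have "(\<Union>n. E a b \<inter> {- real n..real n}) \<in> null_sets lborel" using n by (intro null_sets_UN) auto
    moreover have "E a b \<subseteq> (\<Union>n. E a b \<inter> {- real n..real n})"
    proof
      fix x assume "x \<in> E a b"
      moreover obtain n where "\<bar>x\<bar> \<le> real n" using real_arch_simple by blast
      ultimately show "x \<in> (\<Union>n. E a b \<inter> {- real n..real n})" by (auto intro!: exI[of _ n])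
    qed
    ultimately show ?thesis by (intro AE_I'[of "\<Union>n. E a b \<inter> {- real n..real n}"]) auto
  qed
  let ?Q = "{(a, b). a \<in> \<rat> \<and> b \<in> \<rat> \<and> a < b \<and> 0 \<le> a \<and> b \<le> (1::real)}"
  have "countable ?Q" by (rule countable_subset[of _ "\<rat> \<times> \<rat>"]) (auto simp: countable_rat)
  then have "AE x in lborel. \<forall>(a, b)\<in>?Q. x \<notin> E a b"
    using null by (subst AE_ball_countable) auto
  then show ?thesis
  proof (rule eventually_mono)
    fix x assume x: "\<forall>(a, b)\<in>?Q. x \<notin> E a b"
    show "F differentiable (at x)"
    proof (rule convergent_slopes_imp_differentiable[OF cF bd])
      fix a b :: real assume ab: "a \<in> \<rat>" "b \<in> \<rat>" "a < b"
      show "\<exists>d>0. (\<forall>c e. c < x \<and> x < e \<and> e - c < d \<longrightarrow> a * (e - c) < F e - F c) \<or>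
            (\<forall>c e. c < x \<and> x < e \<and> e - c < d \<longrightarrow> F e - F c < b * (e - c))"
      proof (cases "0 \<le> a \<and> b \<le> 1")
        case True
        then have "x \<notin> E a b" using x ab by auto
        then obtain n where n: "x \<notin> U a (1 / real (Suc n)) \<or> x \<notin> V b (1 / real (Suc n))" by (auto simp: E_def)
        have "a * (e - c) < F e - F c" if "x \<notin> U a d" "c < x" "x < e" "e - c < d" for c e d
          using that by (force simp: U_def)
        moreover have "F e - F c < b * (e - c)" if "x \<notin> V b d" "c < x" "x < e" "e - c < d" for c e d
          using that by (force simp: V_def)
        ultimately show ?thesis
          using n by (intro exI[of _ "1 / real (Suc n)"] conjI) (simp, blast)
      next
        \<comment> \<open>Pairs with \<open>a < 0\<close> or \<open>b > 1\<close> are decided by the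
          slopes lying in \<open>[0, 1]\<close>.\<close>
        case False
        have A: "a * (e - c) < F e - F c" if "c < e" "a < 0" for c e
          using bd[OF that(1)] mult_neg_pos[of a "e - c"] that by linarith
        have B: "F e - F c < b * (e - c)" if "c < e" "1 < b" for c e
        proof -
          have "1 * (e - c) < b * (e - c)" using that by (intro mult_strict_right_mono) auto
          then show ?thesis using bd[OF that(1)] by simp
        qed
        show ?thesis using False A B by (intro exI[of _ 1]) fastforce
      qed
    qed
  qed
qed

text \<open>\<open>F = (f + K x) / (2 K)\<close> moves slopes from \<open>[-K, K]\<close> to
  \<open>[0, 1]\<close>; the choice \<open>K = L + 1\<close> is positive even for
  \<open>L = 0\<close>.\<close>

lemma AE_differentiable_lipschitz_real:
  fixes f :: "real \<Rightarrow> real"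
  assumes f: "L-lipschitz_on UNIV f"
  shows "AE x in lborel. f differentiable (at x)"
proof -
  define K where "K = L + 1"
  have K: "0 < K" "L \<le> K" using lipschitz_on_nonneg[OF f] by (auto simp: K_def)
  have fK: "\<bar>f e - f c\<bar> \<le> K * (e - c)" if "c < e" for c e
  proof -
    have "\<bar>f e - f c\<bar> \<le> L * (e - c)" using lipschitz_onD[OF f, of e c] that by (simp add: dist_real_def)
    also have "\<dots> \<le> K * (e - c)" using that K(2) by (intro mult_right_mono) auto
    finally show ?thesis .
  qed
  define F where "F x = (f x + K * x) / (2 * K)" for x
  have "AE x in lborel. F differentiable (at x)"
  proof (rule AE_differentiable_mono_slope_le_1)
    fix c e :: real assume "c < e"
    have eq: "F e - F c = (f e - f c + K * (e - c)) / (2 * K)"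
      by (simp add: F_def diff_divide_distrib[symmetric] algebra_simps)
    have "\<bar>f e - f c\<bar> \<le> K * (e - c)" by (rule fK) fact
    then have "0 \<le> f e - f c + K * (e - c)" "f e - f c + K * (e - c) \<le> (e - c) * (2 * K)"
      by (auto simp: abs_le_iff algebra_simps)
    then show "0 \<le> F e - F c \<and> F e - F c \<le> e - c"
      unfolding eq using K(1) by (simp add: pos_divide_le_eq)
  qed
  then show ?thesis
  proof (rule eventually_mono)
    fix x assume "F differentiable (at x)"
    then have "(\<lambda>x. 2 * K * F x - K * x) differentiable (at x)"
      by (intro differentiable_diff differentiable_mult differentiable_const differentiable_ident)
    moreover have "(\<lambda>x. 2 * K * F x - K * x) = f" using K(1) by (auto simp: F_def fun_eq_iff)
    ultimately show "f differentiable (at x)" by simp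
  qed
qed

section \<open>Rademacher's theorem\<close>

text \<open>The consequence of Lebesgue density that Rademacher's theorem rests on. At the
  exceptional points, balls of radius \<open>2 r\<close> with \<open>r = dist x y\<close> form a
  Vitali cover; each contains a hole of \<open>A\<close> that takes up a fixed fraction of its
  volume, and the holes are disjoint subsets of \<open>G - S\<close>, whose measure is as small as
  desired.\<close>

lemma negligible_porous_points:
  fixes A :: "'a::euclidean_space set"
  assumes A: "closed A" and \<epsilon>: "0 < \<epsilon>" "\<epsilon> \<le> 1"
  shows "negligible {x \<in> A. \<forall>\<delta>>0. \<exists>y. y \<noteq> x \<and> dist x y < \<delta> \<and> ball y (\<epsilon> * dist x y) \<inter> A = {}}"
    (is "negligible ?P")
proof -
  have "negligible (?P \<inter> ball 0 (real M))" for M :: nat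
    unfolding negligible_outer_le
  proof (intro allI impI)
    fix e :: real assume "0 < e"
    \<comment> \<open>The volume ratio of a ball of radius \<open>2 r\<close> to a hole of radius
      \<open>\<epsilon> r\<close>.\<close>
    define c where "c = (2 / \<epsilon>) ^ DIM('a)"
    have c: "0 < c" using \<epsilon> by (simp add: c_def)
    let ?B = "ball 0 (real M) :: 'a set"
    define S where "S = A \<inter> ?B"
    have SB: "S \<in> sets borel" using A by (auto simp: S_def)
    obtain G where G: "open G" "S \<subseteq> G" "emeasure lebesgue (G - S) < ennreal (e / c)"
      using sets_lebesgue_outer_open[of S "e / c"] SB \<open>0 < e\<close> c by (metis divide_pos_pos sets_completionI_sets sets_lborel)
    let ?r = "\<lambda>i::'a \<times> 'a. dist (fst i) (snd i)"
    let ?K = "{(x, y). y \<noteq> x \<and> ball x (2 * dist x y) \<subseteq> G \<inter> ?B \<and> ball y (\<epsilon> * dist x y) \<inter> A = {}}"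
    have "\<exists>i. i \<in> ?K \<and> x \<in> ball (fst i) (2 * ?r i) \<and> 2 * ?r i < d" if x: "x \<in> ?P \<inter> ?B" "0 < d" for x d
    proof -
      have "x \<in> G \<inter> ?B" "open (G \<inter> ?B)" using x G by (auto simp: S_def)
      then obtain h where h: "0 < h" "ball x h \<subseteq> G \<inter> ?B" by (meson open_contains_ball)
      have "0 < min (d / 2) (h / 2)" using h x by auto
      then obtain y where y: "y \<noteq> x" "dist x y < min (d / 2) (h / 2)" "ball y (\<epsilon> * dist x y) \<inter> A = {}" using x by blast
      have "ball x (2 * dist x y) \<subseteq> ball x h" using y by (intro subset_ball) auto
      then have "(x, y) \<in> ?K" using y h by blast
      then show ?thesis using y by (intro exI[of _ "(x, y)"]) auto
    qed
    then obtain C where C: "countable C" "C \<subseteq> ?K"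
      "pairwise (\<lambda>i j. disjnt (ball (fst i) (2 * ?r i)) (ball (fst j) (2 * ?r j))) C"
      "negligible (?P \<inter> ?B - (\<Union>i\<in>C. ball (fst i) (2 * ?r i)))"
      by (rule Vitali_covering_theorem_balls) blast
    let ?U = "\<Union>i\<in>C. ball (fst i) (2 * ?r i)"
    \<comment> \<open>The factor 2 makes room for the hole: its centre is at distance
      \<open>r\<close> and its radius is at most \<open>r\<close>.\<close>
    have sub: "ball (snd i) (\<epsilon> * ?r i) \<subseteq> ball (fst i) (2 * ?r i)" for i
    proof
      fix z assume "z \<in> ball (snd i) (\<epsilon> * ?r i)"
      moreover have "\<epsilon> * ?r i \<le> 1 * ?r i" using \<epsilon> by (intro mult_right_mono) auto
      ultimately show "z \<in> ball (fst i) (2 * ?r i)"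
        using dist_triangle[of "fst i" z "snd i"] by auto
    qed
    have dis: "disjoint_family_on (\<lambda>i. ball (fst i) (2 * ?r i)) C"
      using C(3) by (auto simp: disjoint_family_on_def pairwise_def disjnt_def)
    have dis2: "disjoint_family_on (\<lambda>i. ball (snd i) (\<epsilon> * ?r i)) C"
      using dis sub unfolding disjoint_family_on_def by (smt (verit, ccfv_SIG) disjoint_iff subsetD)
    have "emeasure lborel ?U = (\<integral>\<^sup>+i. emeasure lborel (ball (fst i) (2 * ?r i)) \<partial>count_space C)"
      using C(1) dis by (simp add: emeasure_UN_countable)
    also have "\<dots> = (\<integral>\<^sup>+i. ennreal c * emeasure lborel (ball (snd i) (\<epsilon> * ?r i)) \<partial>count_space C)"
      using \<epsilon> unfolding emeasure_ball[OF mult_nonneg_nonneg]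
      by (intro nn_integral_cong)
         (simp add: emeasure_ball c_def ennreal_mult[symmetric] power_mult_distrib power_divide field_simps)
    also have "\<dots> = ennreal c * emeasure lborel (\<Union>i\<in>C. ball (snd i) (\<epsilon> * ?r i))"
      using C(1) dis2 by (simp add: emeasure_UN_countable nn_integral_cmult)
    also have "\<dots> \<le> ennreal c * emeasure lborel (G - S)"
    proof (intro mult_left_mono emeasure_mono UN_least)
      fix i assume "i \<in> C"
      then have "i \<in> ?K" using C(2) by blast
      then show "ball (snd i) (\<epsilon> * ?r i) \<subseteq> G - S" using sub[of i] by (cases i) (auto simp: S_def)
    qed (use G SB in auto)
    also have "\<dots> \<le> ennreal c * ennreal (e / c)"
      using G(1,3) SB by (intro mult_left_mono) auto
    also have "\<dots> = ennreal e" using c \<open>0 < e\<close> by (simp add: ennreal_mult[symmetric])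
    finally have le: "emeasure lborel ?U \<le> ennreal e" .
    have UB: "?U \<in> sets borel" by (intro borel_open) auto
    have Ul: "?U \<in> lmeasurable" using le UB by (auto simp: fmeasurable_def intro: le_less_trans)
    have mU: "measure lebesgue ?U \<le> e"
      using le UB \<open>0 < e\<close> by (simp add: measure_def enn2real_leI)
    let ?N = "?P \<inter> ?B - ?U"
    show "\<exists>T. ?P \<inter> ?B \<subseteq> T \<and> T \<in> lmeasurable \<and> measure lebesgue T \<le> e"
    proof (intro exI[of _ "?N \<union> ?U"] conjI)
      show "?N \<union> ?U \<in> lmeasurable" by (rule fmeasurable.Un[OF negligible_imp_measurable[OF C(4)] Ul])
      have "measure lebesgue (?N \<union> ?U) \<le> measure lebesgue ?N + measure lebesgue ?U"
        using negligible_imp_sets[OF C(4)] fmeasurableD[OF Ul] by (rule measure_Un_le)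
      then show "measure lebesgue (?N \<union> ?U) \<le> e" using mU C(4) by (simp add: negligible_imp_measure0)
    qed blast
  qed
  then have "negligible (\<Union>M. ?P \<inter> ball 0 (real M))" by (rule negligible_Union_nat)
  moreover have "?P \<subseteq> (\<Union>M. ?P \<inter> ball 0 (real M))"
  proof
    fix x assume "x \<in> ?P"
    moreover obtain M :: nat where "norm x < real M" using reals_Archimedean2 by blast
    ultimately show "x \<in> (\<Union>M. ?P \<inter> ball 0 (real M))" by auto
  qed
  ultimately show ?thesis by (rule negligible_subset)
qed

text \<open>Fubini exchanges the quantifiers: for some \<open>t\<close>, almost every
  \<open>x\<close> has \<open>x + t v\<close> in \<open>G\<close>. The shift by \<open>t v\<close>
  is then removed by translation invariance.\<close>

lemma AE_lborel_of_AE_lines: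
  fixes v :: "'a::euclidean_space"
  assumes G: "G \<in> sets borel" and lines: "\<And>x. AE t in lborel. x + t *\<^sub>R v \<in> G"
  shows "AE x in lborel. x \<in> G"
proof -
  have [measurable]: "G \<in> sets borel" by (rule G)
  have "{p \<in> space ((lborel :: 'a measure) \<Otimes>\<^sub>M (lborel :: real measure)). fst p + snd p *\<^sub>R v \<in> G}
      \<in> sets (lborel \<Otimes>\<^sub>M lborel)"
    by measurable
  from lborel_pair.AE_commute[OF this] have "AE t in lborel. AE x in lborel. x + t *\<^sub>R v \<in> G"
    using lines by simp
  moreover have ne: "ae_filter (lborel :: real measure) \<noteq> bot" by (simp add: ae_filter_eq_bot_iff)
  ultimately obtain t where "AE x in lborel. x + t *\<^sub>R v \<in> G" using eventually_happens'[OF ne] by auto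
  then have "AE x in distr lborel borel ((+) (t *\<^sub>R v)). x \<in> G"
    by (subst AE_distr_iff) (auto simp: add.commute)
  then show ?thesis unfolding lborel_distr_plus .
qed

text \<open>The approximate gradients for \<open>\<epsilon> = 1 / (n + 1)\<close> form a Cauchy
  sequence whose limit is the gradient. Two of them are compared by testing both approximations on a
  short \<open>h\<close> parallel to their difference.\<close>

lemma GDERIV_of_linear_approximations:
  fixes f :: "'a::euclidean_space \<Rightarrow> real"
  assumes "\<And>\<epsilon>. 0 < \<epsilon> \<Longrightarrow> \<exists>a \<delta>. 0 < \<delta> \<and> (\<forall>h. norm h < \<delta> \<longrightarrow> \<bar>f (x + h) - f x - h \<bullet> a\<bar> \<le> \<epsilon> * norm h)"
  shows "\<exists>g. GDERIV f x :> g"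
proof -
  have "\<forall>n. \<exists>a \<delta>. 0 < \<delta> \<and> (\<forall>h. norm h < \<delta> \<longrightarrow> \<bar>f (x + h) - f x - h \<bullet> a\<bar> \<le> 1 / real (Suc n) * norm h)"
    by (intro allI assms) simp
  then obtain a \<delta> where a: "\<And>n. 0 < \<delta> n"
    "\<And>n h. norm h < \<delta> n \<Longrightarrow> \<bar>f (x + h) - f x - h \<bullet> a n\<bar> \<le> 1 / real (Suc n) * norm h"
    by metis
  have close: "norm (a n - a m) \<le> 1 / real (Suc n) + 1 / real (Suc m)" for n m
  proof (cases "a n = a m")
    case False
    define h where "h = (min (\<delta> n) (\<delta> m) / 2 / norm (a n - a m)) *\<^sub>R (a n - a m)"
    have pos: "0 < min (\<delta> n) (\<delta> m) / 2" using a(1) by simp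
    have nh: "norm h = min (\<delta> n) (\<delta> m) / 2" using False pos by (simp add: h_def)
    have "h \<bullet> (a n - a m) = norm h * norm (a n - a m)"
      using False nh by (simp add: h_def power2_norm_eq_inner[symmetric] power2_eq_square)
    moreover have "h \<bullet> (a n - a m) \<le> (1 / real (Suc n) + 1 / real (Suc m)) * norm h"
    proof -
      have "norm h < \<delta> n" "norm h < \<delta> m" using nh a(1)[of n] a(1)[of m] by auto
      from a(2)[OF this(1)] a(2)[OF this(2)] show ?thesis
        unfolding inner_diff_right distrib_right by linarith
    qed
    ultimately have "norm h * norm (a n - a m) \<le> norm h * (1 / real (Suc n) + 1 / real (Suc m))"
      by (metis mult.commute)
    then show ?thesis using nh pos by (subst (asm) mult_le_cancel_left_pos) auto
  qed auto
  have "Cauchy a"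
  proof (rule metric_CauchyI)
    fix e :: real assume "0 < e"
    then obtain M where M: "1 / real (Suc M) < e / 2" using nat_approx_posE[of "e/2"] by auto
    have "dist (a m) (a n) < e" if "m \<ge> M" "n \<ge> M" for m n
    proof -
      have "1 / real (Suc m) \<le> 1 / real (Suc M)" "1 / real (Suc n) \<le> 1 / real (Suc M)"
        using that by (auto intro!: divide_left_mono)
      then show ?thesis using close[of m n] M by (simp add: dist_norm)
    qed
    then show "\<exists>M. \<forall>m\<ge>M. \<forall>n\<ge>M. dist (a m) (a n) < e" by blast
  qed
  then obtain g where g: "a \<longlonglongrightarrow> g" using Cauchy_convergent convergent_def by blast
  have ag: "norm (a n - g) \<le> 1 / real (Suc n)" for n
  proof (rule tendsto_le[OF _ _ _ always_eventually])
    show "(\<lambda>m. 1 / real (Suc n) + 1 / real (Suc m)) \<longlonglongrightarrow> 1 / real (Suc n)"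
      using tendsto_add[OF tendsto_const LIMSEQ_inverse_real_of_nat] by (simp add: inverse_eq_divide)
    show "(\<lambda>m. norm (a n - a m)) \<longlonglongrightarrow> norm (a n - g)" by (intro tendsto_intros g)
  qed (use close in auto)
  have "GDERIV f x :> g"
    unfolding gderiv_def has_derivative_at_alt
  proof (intro conjI allI impI)
    show "bounded_linear (\<lambda>h. h \<bullet> g)" by (rule bounded_linear_inner_left)
    fix e :: real assume "0 < e"
    then obtain n where n: "1 / real (Suc n) < e / 2" using nat_approx_posE[of "e/2"] by auto
    show "\<exists>d>0. \<forall>y. norm (y - x) < d \<longrightarrow> norm (f y - f x - (y - x) \<bullet> g) \<le> e * norm (y - x)"
    proof (intro exI[of _ "\<delta> n"] conjI allI impI a(1))
      fix y assume "norm (y - x) < \<delta> n"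
      then have "\<bar>f y - f x - (y - x) \<bullet> a n\<bar> \<le> 1 / real (Suc n) * norm (y - x)" using a(2)[of "y - x" n] by simp
      moreover have "\<bar>(y - x) \<bullet> (a n - g)\<bar> \<le> norm (y - x) * norm (a n - g)" by (rule Cauchy_Schwarz_ineq2)
      moreover have "norm (y - x) * norm (a n - g) \<le> norm (y - x) * (1 / real (Suc n))"
        by (intro mult_left_mono ag) auto
      moreover have "1 / real (Suc n) * norm (y - x) \<le> e / 2 * norm (y - x)"
        using n by (intro mult_right_mono) auto
      ultimately show "norm (f y - f x - (y - x) \<bullet> g) \<le> e * norm (y - x)"
        by (simp add: inner_diff_right algebra_simps)
    qed
  qed
  then show ?thesis by blast
qed

text \<open>A uniform version of having directional derivative near \<open>\<alpha>\<close>.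
  Quantifying over all \<open>t\<close> up to a fixed scale makes the set closed for continuous
  \<open>f\<close>, which gives measurability and lets \<open>negligible_porous_points\<close>
  apply; rational \<open>\<alpha>\<close> and reciprocals of integers for the other two parameters
  keep the family countable.\<close>

definition slope_set :: "('a::euclidean_space \<Rightarrow> real) \<Rightarrow> 'a \<Rightarrow> real \<Rightarrow> real \<Rightarrow> real \<Rightarrow> 'a set" where
  "slope_set f v \<alpha> \<epsilon> \<delta> = {x. \<forall>t. \<bar>t\<bar> < \<delta> \<longrightarrow> \<bar>f (x + t *\<^sub>R v) - f x - \<alpha> * t\<bar> \<le> \<epsilon> * \<bar>t\<bar>}"

lemma closed_slope_set:
  assumes "continuous_on UNIV f"
  shows "closed (slope_set f v \<alpha> \<epsilon> \<delta>)"
proof -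
  have "slope_set f v \<alpha> \<epsilon> \<delta> = (\<Inter>t\<in>{t. \<bar>t\<bar> < \<delta>}. {x. \<bar>f (x + t *\<^sub>R v) - f x - \<alpha> * t\<bar> \<le> \<epsilon> * \<bar>t\<bar>})"
    by (auto simp: slope_set_def)
  also have "closed \<dots>"
    by (intro closed_INT ballI closed_Collect_le continuous_intros continuous_on_compose2[OF assms] assms) auto
  finally show ?thesis .
qed

lemma AE_slope_set:
  fixes f :: "'a::euclidean_space \<Rightarrow> real"
  assumes f: "L-lipschitz_on UNIV f" and v: "norm v \<le> 1"
  shows "AE x in lborel. \<forall>n. \<exists>\<alpha>\<in>\<rat>. \<exists>k. x \<in> slope_set f v \<alpha> (1 / real (Suc n)) (1 / real (Suc k))"
proof -
  define G where "G = (\<Inter>n. \<Union>\<alpha>\<in>\<rat>. \<Union>k. slope_set f v \<alpha> (1 / real (Suc n)) (1 / real (Suc k)))"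
  have cf: "continuous_on UNIV f" using f lipschitz_on_continuous_on by blast
  have "G \<in> sets borel" unfolding G_def
    by (intro sets.countable_INT'' sets.countable_UN' sets.countable_UN image_subsetI borel_closed closed_slope_set cf countable_rat) auto
  moreover have "AE t in lborel. x + t *\<^sub>R v \<in> G" for x
  proof -
    have "L-lipschitz_on UNIV (\<lambda>t. f (x + t *\<^sub>R v))"
    proof (rule lipschitz_onI)
      fix s t :: real
      have "dist (f (x + s *\<^sub>R v)) (f (x + t *\<^sub>R v)) \<le> L * dist (x + s *\<^sub>R v) (x + t *\<^sub>R v)"
        by (rule lipschitz_onD[OF f]) auto
      also have "dist (x + s *\<^sub>R v) (x + t *\<^sub>R v) = dist s t * norm v"
        by (simp add: dist_norm scaleR_diff_left[symmetric])
      also have "L * (dist s t * norm v) \<le> L * (dist s t * 1)"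
        using v lipschitz_on_nonneg[OF f] by (intro mult_left_mono) auto
      finally show "dist (f (x + s *\<^sub>R v)) (f (x + t *\<^sub>R v)) \<le> L * dist s t" by simp
    qed (use lipschitz_on_nonneg[OF f] in auto)
    from AE_differentiable_lipschitz_real[OF this] show ?thesis
    proof (rule eventually_mono)
      fix s assume "(\<lambda>t. f (x + t *\<^sub>R v)) differentiable at s"
      then obtain D where D: "((\<lambda>t. f (x + t *\<^sub>R v)) has_real_derivative D) (at s)"
        by (auto simp: real_differentiable_def)
      show "x + s *\<^sub>R v \<in> G" unfolding G_def
      proof
        fix n
        let ?e = "1 / real (Suc n)"
        \<comment> \<open>Half of the tolerance pays for rounding \<open>D\<close> to a rational,
          the other half for the difference quotient.\<close>
        obtain \<alpha> where \<alpha>: "\<alpha> \<in> \<rat>" "D < \<alpha>" "\<alpha> < D + ?e / 2" using Rats_dense_in_real[of D "D + ?e / 2"] by auto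
        obtain d where d: "0 < d" "\<And>y. norm (y - s) < d \<Longrightarrow>
            norm (f (x + y *\<^sub>R v) - f (x + s *\<^sub>R v) - D * (y - s)) \<le> ?e / 2 * norm (y - s)"
          using D unfolding has_field_derivative_def has_derivative_at_alt by (metis of_nat_0_less_iff zero_less_Suc zero_less_divide_1_iff half_gt_zero)
        obtain k where k: "1 / real (Suc k) < d" using nat_approx_posE[OF d(1)] by auto
        have "x + s *\<^sub>R v \<in> slope_set f v \<alpha> ?e (1 / real (Suc k))"
          unfolding slope_set_def
        proof (intro CollectI allI impI)
          fix t assume "\<bar>t\<bar> < 1 / real (Suc k)"
          then have "\<bar>f (x + s *\<^sub>R v + t *\<^sub>R v) - f (x + s *\<^sub>R v) - D * t\<bar> \<le> ?e / 2 * \<bar>t\<bar>"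
            using d(2)[of "s + t"] k by (simp add: scaleR_add_left add.assoc)
          moreover have "\<bar>(\<alpha> - D) * t\<bar> \<le> ?e / 2 * \<bar>t\<bar>"
            unfolding abs_mult using \<alpha> by (intro mult_right_mono) auto
          moreover have "?e / 2 * \<bar>t\<bar> + ?e / 2 * \<bar>t\<bar> = ?e * \<bar>t\<bar>"
            by (simp only: distrib_right[symmetric] field_sum_of_halves)
          moreover have "f (x + s *\<^sub>R v + t *\<^sub>R v) - f (x + s *\<^sub>R v) - \<alpha> * t
              = (f (x + s *\<^sub>R v + t *\<^sub>R v) - f (x + s *\<^sub>R v) - D * t) - (\<alpha> - D) * t"
            by (simp add: algebra_simps)
          moreover have "\<bar>C\<bar> \<le> e" if "\<bar>A\<bar> \<le> h" "\<bar>B\<bar> \<le> h" "h + h = e" "C = A - B" for A B C h e :: real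
            using that by linarith
          ultimately show "\<bar>f (x + s *\<^sub>R v + t *\<^sub>R v) - f (x + s *\<^sub>R v) - \<alpha> * t\<bar> \<le> ?e * \<bar>t\<bar>"
            by blast
        qed
        then show "x + s *\<^sub>R v \<in> (\<Union>\<alpha>\<in>\<rat>. \<Union>k. slope_set f v \<alpha> ?e (1 / real (Suc k)))" using \<alpha>(1) by blast
      qed
    qed
  qed
  ultimately have "AE x in lborel. x \<in> G" by (rule AE_lborel_of_AE_lines)
  then show ?thesis by (rule eventually_mono) (auto simp: G_def)
qed

text \<open>Almost every \<open>x\<close> lies, for each basis vector \<open>i\<close> and each
  \<open>n\<close>, in some \<open>?A i \<alpha> n k\<close> of which it is not a porous point. The
  step from \<open>x\<close> to \<open>x + h\<close> is made one coordinate at a time. An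
  intermediate point \<open>y\<close> may miss the set, but some \<open>z\<close> in it is within a
  small multiple of \<open>norm h\<close> of \<open>y\<close>; the slope bound holds at
  \<open>z\<close> with the same \<open>k\<close>, and the Lipschitz property carries it back to
  \<open>y\<close>.\<close>

theorem AE_GDERIV_lipschitz:
  fixes f :: "'a::euclidean_space \<Rightarrow> real"
  assumes f: "L-lipschitz_on UNIV f"
  shows "AE x in lborel. \<exists>g. GDERIV f x :> g"
proof -
  have L: "0 \<le> L" using f by (rule lipschitz_on_nonneg)
  have cf: "continuous_on UNIV f" using f lipschitz_on_continuous_on by blast
  let ?A = "\<lambda>i \<alpha> n k. slope_set f i \<alpha> (1 / real (Suc n)) (1 / real (Suc k))"
  have "AE x in lborel. \<forall>i\<in>Basis. \<forall>n. \<exists>\<alpha>\<in>\<rat>. \<exists>k. x \<in> ?A i \<alpha> n k"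
    using AE_slope_set[OF f] by (subst AE_finite_all) auto
  moreover
  have "AE x in lborel. \<forall>i\<in>Basis. \<forall>\<alpha>\<in>\<rat>. \<forall>n k. \<not> (x \<in> ?A i \<alpha> n k \<and>
      (\<forall>\<delta>>0. \<exists>y. y \<noteq> x \<and> dist x y < \<delta> \<and> ball y (1 / real (Suc n) * dist x y) \<inter> ?A i \<alpha> n k = {}))"
  proof (subst AE_finite_all[OF finite_Basis], subst AE_ball_countable[OF countable_rat], intro ballI, unfold AE_all_countable, intro allI)
    fix i :: 'a and \<alpha> :: real and n k
    have "negligible {x \<in> ?A i \<alpha> n k. \<forall>\<delta>>0. \<exists>y. y \<noteq> x \<and> dist x y < \<delta> \<and>
        ball y (1 / real (Suc n) * dist x y) \<inter> ?A i \<alpha> n k = {}}"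
      by (rule negligible_porous_points) (auto intro!: closed_slope_set cf)
    then have "AE x in lebesgue. \<not> (x \<in> ?A i \<alpha> n k \<and> (\<forall>\<delta>>0. \<exists>y. y \<noteq> x \<and> dist x y < \<delta> \<and>
        ball y (1 / real (Suc n) * dist x y) \<inter> ?A i \<alpha> n k = {}))"
      unfolding negligible_iff_null_sets by (rule AE_I') auto
    then show "AE x in lborel. \<not> (x \<in> ?A i \<alpha> n k \<and> (\<forall>\<delta>>0. \<exists>y. y \<noteq> x \<and> dist x y < \<delta> \<and>
        ball y (1 / real (Suc n) * dist x y) \<inter> ?A i \<alpha> n k = {}))"
      by (simp only: AE_completion_iff)
  qed
  ultimately show ?thesis
  proof eventually_elim
    case (elim x)
    define N where "N = real DIM('a)"
    have N: "1 \<le> N" by (simp add: N_def)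
    show ?case
    proof (rule GDERIV_of_linear_approximations)
      fix \<epsilon> :: real assume "0 < \<epsilon>"
      \<comment> \<open>Each of the \<open>N\<close> coordinate steps costs
        \<open>(2 L N + 1) / (n + 1)\<close> times \<open>norm h\<close>: two times
        \<open>L dist y z\<close> for replacing \<open>y\<close> by \<open>z\<close> at both ends,
        and once the slope error.\<close>
      have "0 < \<epsilon> / (N * (2 * L * N + 1))" using \<open>0 < \<epsilon>\<close> N L by (auto intro!: divide_pos_pos mult_pos_pos add_nonneg_pos)
      then obtain n where n: "1 / real (Suc n) < \<epsilon> / (N * (2 * L * N + 1))" using nat_approx_posE by blast
      let ?e = "1 / real (Suc n)"
      have ne: "N * (2 * L * N + 1) * ?e \<le> \<epsilon>"
        using n N L by (subst (asm) pos_less_divide_eq) (auto intro!: mult_pos_pos add_nonneg_pos simp: mult.commute)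
      have "\<forall>i\<in>Basis. \<exists>\<alpha> k \<delta>. x \<in> ?A i \<alpha> n k \<and> 0 < \<delta> \<and>
          (\<forall>y. y \<noteq> x \<and> dist x y < \<delta> \<longrightarrow> ball y (?e * dist x y) \<inter> ?A i \<alpha> n k \<noteq> {})"
        using elim by meson
      then obtain \<alpha> k \<delta> where *: "\<And>i. i \<in> Basis \<Longrightarrow> x \<in> ?A i (\<alpha> i) n (k i)" "\<And>i. i \<in> Basis \<Longrightarrow> 0 < \<delta> i"
        "\<And>i y. i \<in> Basis \<Longrightarrow> y \<noteq> x \<Longrightarrow> dist x y < \<delta> i \<Longrightarrow> ball y (?e * dist x y) \<inter> ?A i (\<alpha> i) n (k i) \<noteq> {}"
        by metis
      \<comment> \<open>Partial sums of the coordinates of \<open>h\<close> have norm at most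
        \<open>N * norm h\<close>; dividing by \<open>N\<close> keeps them below every
        scale.\<close>
      define d where "d = Min ((\<lambda>i. min (\<delta> i) (1 / real (Suc (k i)))) ` (Basis :: 'a set)) / N"
      have d: "0 < d" using * N by (auto simp: d_def)
      have d': "N * d \<le> \<delta> i" "N * d \<le> 1 / real (Suc (k i))" if "i \<in> Basis" for i
      proof -
        have "N * d = Min ((\<lambda>i. min (\<delta> i) (1 / real (Suc (k i)))) ` (Basis :: 'a set))" using N by (simp add: d_def)
        also have "\<dots> \<le> min (\<delta> i) (1 / real (Suc (k i)))" using that by (intro Min_le) auto
        finally have "N * d \<le> min (\<delta> i) (1 / real (Suc (k i)))" .
        then show "N * d \<le> \<delta> i" "N * d \<le> 1 / real (Suc (k i))" by auto
      qed
      define a where "a = (\<Sum>i\<in>Basis. \<alpha> i *\<^sub>R i)"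
      have main: "\<bar>f (x + h) - f x - h \<bullet> a\<bar> \<le> \<epsilon> * norm h" if h: "norm h < d" for h
      proof -
        let ?h = "\<lambda>B. \<Sum>i\<in>B. (h \<bullet> i) *\<^sub>R i"
        have nB: "norm (?h B) \<le> N * norm h" if "B \<subseteq> Basis" for B
        proof -
          have "norm (?h B) \<le> (\<Sum>i\<in>B. norm h)"
            using that by (intro sum_norm_le) (auto simp: Basis_le_norm subset_iff)
          also have "\<dots> = real (card B) * norm h" by simp
          also have "\<dots> \<le> N * norm h"
            using card_mono[OF finite_Basis that] by (intro mult_right_mono) (auto simp: N_def)
          finally show ?thesis .
        qed
        have Nd: "N * norm h < N * d" using h N by (intro mult_strict_left_mono) auto
        have "\<bar>f (x + ?h B) - f x - (\<Sum>i\<in>B. \<alpha> i * (h \<bullet> i))\<bar> \<le> real (card B) * ((2 * L * N + 1) * ?e * norm h)"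
          if "finite B" "B \<subseteq> Basis" for B
          using that
        proof (induction B)
          case (insert i B)
          have i: "i \<in> Basis" and B: "B \<subseteq> Basis" using insert by auto
          define y where "y = x + ?h B"
          have yx: "dist x y \<le> N * norm h" using nB[OF B] by (simp add: y_def dist_norm)
          have "\<exists>z\<in>?A i (\<alpha> i) n (k i). dist y z \<le> ?e * (N * norm h)"
          proof (cases "y = x")
            case True
            then show ?thesis using *(1)[OF i] N by (intro bexI[of _ x]) auto
          next
            case False
            then obtain z where "z \<in> ball y (?e * dist x y) \<inter> ?A i (\<alpha> i) n (k i)"
              using *(3)[OF i False] yx Nd d'(1)[OF i] by force
            moreover have "?e * dist x y \<le> ?e * (N * norm h)" using yx by (intro mult_left_mono) auto
            ultimately show ?thesis by (intro bexI[of _ z]) auto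
          qed
          then obtain z where z: "z \<in> ?A i (\<alpha> i) n (k i)" "dist y z \<le> ?e * (N * norm h)" by blast
          let ?t = "h \<bullet> i"
          have ht: "\<bar>?t\<bar> \<le> norm h" by (rule Basis_le_norm[OF i])
          have "norm h \<le> N * norm h" using N by (simp add: mult_le_cancel_right1)
          then have "\<bar>?t\<bar> < 1 / real (Suc (k i))" using ht Nd d'(2)[OF i] by linarith
          then have 1: "\<bar>f (z + ?t *\<^sub>R i) - f z - \<alpha> i * ?t\<bar> \<le> ?e * \<bar>?t\<bar>" using z(1) by (simp add: slope_set_def)
          have 2: "?e * \<bar>?t\<bar> \<le> ?e * norm h" using ht by (intro mult_left_mono) auto
          have lz: "L * dist y z \<le> L * (?e * (N * norm h))" using z(2) L by (intro mult_left_mono)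
          have 3: "\<bar>f y - f z\<bar> \<le> L * (?e * (N * norm h))"
            using lipschitz_onD[OF f, of y z] lz by (auto simp: dist_real_def)
          have 4: "\<bar>f (y + ?t *\<^sub>R i) - f (z + ?t *\<^sub>R i)\<bar> \<le> L * (?e * (N * norm h))"
            using lipschitz_onD[OF f, of "y + ?t *\<^sub>R i" "z + ?t *\<^sub>R i"] lz by (auto simp: dist_real_def)
          have 5: "\<bar>f y - f x - (\<Sum>i\<in>B. \<alpha> i * (h \<bullet> i))\<bar> \<le> real (card B) * ((2 * L * N + 1) * ?e * norm h)"
            using insert.IH[OF B] by (simp add: y_def)
          have eq: "x + ?h (insert i B) = y + ?t *\<^sub>R i" using insert by (simp add: y_def algebra_simps)
          have "\<bar>f (y + ?t *\<^sub>R i) - f x - (\<alpha> i * ?t + (\<Sum>i\<in>B. \<alpha> i * (h \<bullet> i)))\<bar>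
              \<le> real (card B) * ((2 * L * N + 1) * ?e * norm h) + (2 * (L * (?e * (N * norm h))) + ?e * norm h)"
            using 1 2 3 4 5 by linarith
          also have "2 * (L * (?e * (N * norm h))) + ?e * norm h = (2 * L * N + 1) * ?e * norm h"
            by (simp only: algebra_simps)
          also have "real (card B) * X + X = real (card (insert i B)) * X" for X
            using insert by (simp add: distrib_right)
          also have "\<alpha> i * ?t + (\<Sum>i\<in>B. \<alpha> i * (h \<bullet> i)) = (\<Sum>i\<in>insert i B. \<alpha> i * (h \<bullet> i))"
            using insert by simp
          finally show ?case unfolding eq .
        qed auto
        from this[of Basis] have "\<bar>f (x + h) - f x - (\<Sum>i\<in>Basis. \<alpha> i * (h \<bullet> i))\<bar> \<le> N * ((2 * L * N + 1) * ?e * norm h)"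
          by (simp add: euclidean_representation N_def)
        also have "N * ((2 * L * N + 1) * ?e * norm h) = (N * (2 * L * N + 1) * ?e) * norm h" by (simp only: mult.assoc)
        also have "\<dots> \<le> \<epsilon> * norm h" using ne by (intro mult_right_mono) auto
        also have "(\<Sum>i\<in>Basis. \<alpha> i * (h \<bullet> i)) = h \<bullet> a" by (simp add: a_def inner_sum_right)
        finally show ?thesis .
      qed
      show "\<exists>a \<delta>. 0 < \<delta> \<and> (\<forall>h. norm h < \<delta> \<longrightarrow> \<bar>f (x + h) - f x - h \<bullet> a\<bar> \<le> \<epsilon> * norm h)"
        using d main by blast
    qed
  qed
qed

section \<open>Integration along rays\<close>

lemma nn_integral_lborel_scale:
  fixes f :: "'a::euclidean_space \<Rightarrow> ennreal"
  assumes f: "f \<in> borel_measurable borel" and c: "0 < c"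
  shows "(\<integral>\<^sup>+x. f x \<partial>lborel) = ennreal (c ^ DIM('a)) * (\<integral>\<^sup>+x. f (t + c *\<^sub>R x) \<partial>lborel)"
proof -
  have [measurable]: "f \<in> borel_measurable borel" by (rule f)
  have "(\<integral>\<^sup>+x. f x \<partial>lborel) = (\<integral>\<^sup>+x. f x \<partial>density (distr lborel borel (\<lambda>x. t + c *\<^sub>R x)) (\<lambda>_. ennreal (\<bar>c\<bar> ^ DIM('a))))"
    using lborel_affine[of c t] c by simp
  also have "\<dots> = ennreal (c ^ DIM('a)) * (\<integral>\<^sup>+x. f (t + c *\<^sub>R x) \<partial>lborel)"
    using c by (simp add: nn_integral_density nn_integral_distr nn_integral_cmult)
  finally show ?thesis .
qed

lemma nn_integral_powr_from_0:
  fixes a R :: real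
  assumes a: "0 < a" and R: "0 \<le> R"
  shows "(\<integral>\<^sup>+t. ennreal (t powr (a - 1)) * indicator {0<..R} t \<partial>lborel) = ennreal (R powr a / a)"
proof -
  have "((\<lambda>t. t powr (a - 1)) has_integral (R powr a / a)) {0..R}"
    using has_integral_powr_from_0[of "a - 1" R] a R by simp
  then have "(\<integral>\<^sup>+t. ennreal (t powr (a - 1)) * indicator {0..R} t \<partial>lborel) = ennreal (R powr a / a)"
    by (intro nn_integral_has_integral_lebesgue') auto
  moreover have "(\<integral>\<^sup>+t. ennreal (t powr (a - 1)) * indicator {0<..R} t \<partial>lborel)
      = (\<integral>\<^sup>+t. ennreal (t powr (a - 1)) * indicator {0..R} t \<partial>lborel)"
    using AE_lborel_singleton[of 0]
    by (intro nn_integral_cong_AE) (auto elim!: eventually_mono split: split_indicator)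
  ultimately show ?thesis by simp
qed

text \<open>Stands in for the unit sphere: directions are averaged over norms between 1 and 2, so
  that Lebesgue measure is the only measure involved.\<close>

abbreviation shell :: "'a::euclidean_space set" where
  "shell \<equiv> {x. 1 \<le> norm x \<and> norm x \<le> 2}"

text \<open>After Tonelli and the substitution \<open>y = t x\<close> the weight in \<open>t\<close>
  is \<open>1 / t\<close>. For fixed \<open>y\<close> of norm \<open>r\<close> the admissible
  \<open>t\<close> fill \<open>[r / 2, r]\<close>, over which \<open>1 / t\<close> integrates to
  \<open>ln 2\<close> whatever \<open>r\<close> is; hence the factor in front.\<close>

theorem nn_integral_polar:
  fixes f :: "'a::euclidean_space \<Rightarrow> ennreal"
  assumes f: "f \<in> borel_measurable borel"
  shows "(\<integral>\<^sup>+x. f x \<partial>lborel) = ennreal (1 / ln 2) *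
    (\<integral>\<^sup>+x. (\<integral>\<^sup>+t. f (x0 + t *\<^sub>R x) * ennreal (t ^ (DIM('a) - 1)) * indicator {0<..} t \<partial>lborel) * indicator shell x \<partial>lborel)"
proof -
  define g where "g y = f (x0 + y)" for y
  have [measurable]: "f \<in> borel_measurable borel" by (rule f)
  have [measurable]: "g \<in> borel_measurable borel" unfolding g_def by measurable
  have [measurable]: "shell \<in> sets borel" by measurable
  have "(\<integral>\<^sup>+x. (\<integral>\<^sup>+t. f (x0 + t *\<^sub>R x) * ennreal (t ^ (DIM('a) - 1)) * indicator {0<..} t \<partial>lborel) * indicator shell x \<partial>lborel)
    = (\<integral>\<^sup>+x. (\<integral>\<^sup>+t. g (t *\<^sub>R x) * ennreal (t ^ (DIM('a) - 1)) * indicator {0<..} t * indicator shell x \<partial>lborel) \<partial>lborel)"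
    unfolding g_def by (intro nn_integral_cong nn_integral_multc[symmetric]) measurable
  also have "\<dots> = (\<integral>\<^sup>+t. (\<integral>\<^sup>+x. g (t *\<^sub>R x) * ennreal (t ^ (DIM('a) - 1)) * indicator {0<..} t * indicator shell x \<partial>lborel) \<partial>lborel)"
    by (rule lborel_pair.Fubini'[symmetric]) measurable
  also have "\<dots> = (\<integral>\<^sup>+t. (\<integral>\<^sup>+y. g y * (ennreal (1 / t) * indicator {0<..} t * indicator shell ((1 / t) *\<^sub>R y)) \<partial>lborel) \<partial>lborel)"
  proof (rule nn_integral_cong)
    fix t :: real
    show "(\<integral>\<^sup>+x. g (t *\<^sub>R x) * ennreal (t ^ (DIM('a) - 1)) * indicator {0<..} t * indicator shell x \<partial>lborel)
      = (\<integral>\<^sup>+y. g y * (ennreal (1 / t) * indicator {0<..} t * indicator shell ((1 / t) *\<^sub>R y)) \<partial>lborel)"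
    proof (cases "0 < t")
      case True
      have "(\<integral>\<^sup>+y. g y * (ennreal (1 / t) * indicator {0<..} t * indicator shell ((1 / t) *\<^sub>R y)) \<partial>lborel)
        = ennreal (t ^ DIM('a)) * (\<integral>\<^sup>+x. g (0 + t *\<^sub>R x) * (ennreal (1 / t) * indicator {0<..} t * indicator shell ((1 / t) *\<^sub>R (0 + t *\<^sub>R x))) \<partial>lborel)"
        by (rule nn_integral_lborel_scale) (use True in auto)
      also have "\<dots> = (\<integral>\<^sup>+x. ennreal (t ^ DIM('a)) * (g (t *\<^sub>R x) * (ennreal (1 / t) * indicator shell x)) \<partial>lborel)"
        using True by (simp add: nn_integral_cmult)
      also have "\<dots> = (\<integral>\<^sup>+x. g (t *\<^sub>R x) * ennreal (t ^ (DIM('a) - 1)) * indicator {0<..} t * indicator shell x \<partial>lborel)"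
      proof (rule nn_integral_cong)
        fix x :: 'a
        have "t ^ DIM('a) * (1 / t) = t ^ (DIM('a) - 1)"
          using True power_minus_mult[of "DIM('a)" t] by (simp add: field_simps)
        then have "ennreal (t ^ DIM('a)) * ennreal (1 / t) = ennreal (t ^ (DIM('a) - 1))"
          using True by (simp only: ennreal_mult[symmetric] zero_le_power less_imp_le zero_le_divide_1_iff)
        moreover have "ennreal (t ^ DIM('a)) * (g (t *\<^sub>R x) * (ennreal (1 / t) * indicator shell x))
          = (ennreal (t ^ DIM('a)) * ennreal (1 / t)) * g (t *\<^sub>R x) * indicator shell x"
          by (simp only: mult_ac)
        ultimately show "ennreal (t ^ DIM('a)) * (g (t *\<^sub>R x) * (ennreal (1 / t) * indicator shell x))
          = g (t *\<^sub>R x) * ennreal (t ^ (DIM('a) - 1)) * indicator {0<..} t * indicator shell x"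
          using True by (simp add: mult.commute)
      qed
      finally show ?thesis by simp
    qed simp
  qed
  also have "\<dots> = (\<integral>\<^sup>+y. (\<integral>\<^sup>+t. g y * (ennreal (1 / t) * indicator {0<..} t * indicator shell ((1 / t) *\<^sub>R y)) \<partial>lborel) \<partial>lborel)"
    by (rule lborel_pair.Fubini') measurable
  also have "\<dots> = (\<integral>\<^sup>+y. g y * ennreal (ln 2) \<partial>lborel)"
  proof (rule nn_integral_cong_AE)
    show "AE y in lborel. (\<integral>\<^sup>+t. g y * (ennreal (1 / t) * indicator {0<..} t * indicator shell ((1 / t) *\<^sub>R y)) \<partial>lborel)
        = g y * ennreal (ln 2)"
      using AE_lborel_singleton[of "0::'a"]
    proof (rule eventually_mono)
      fix y :: 'a assume "y \<noteq> 0"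
      define r where "r = norm y"
      have r: "0 < r" using \<open>y \<noteq> 0\<close> by (simp add: r_def)
      have "(\<integral>\<^sup>+t. ennreal (1 / t) * indicator {0<..} t * indicator shell ((1 / t) *\<^sub>R y) \<partial>lborel)
        = (\<integral>\<^sup>+t. ennreal (1 / t) * indicator {r / 2..r} t \<partial>lborel)"
      proof (rule nn_integral_cong)
        fix t :: real
        show "ennreal (1 / t) * indicator {0<..} t * indicator shell ((1 / t) *\<^sub>R y) = ennreal (1 / t) * indicator {r / 2..r} t"
          using r by (cases "0 < t") (auto simp: r_def[symmetric] field_simps split: split_indicator)
      qed
      also have "\<dots> = ennreal (ln r - ln (r / 2))"
        using r by (intro nn_integral_FTC_Icc) (auto intro!: derivative_eq_intros)
      also have "ln r - ln (r / 2) = ln 2" using r by (simp add: ln_div)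
      finally show "(\<integral>\<^sup>+t. g y * (ennreal (1 / t) * indicator {0<..} t * indicator shell ((1 / t) *\<^sub>R y)) \<partial>lborel)
        = g y * ennreal (ln 2)"
        by (subst nn_integral_cmult) auto
    qed
  qed
  also have "\<dots> = ennreal (ln 2) * (\<integral>\<^sup>+y. g y \<partial>lborel)"
    by (simp add: nn_integral_multc mult.commute)
  also have "(\<integral>\<^sup>+y. g y \<partial>lborel) = (\<integral>\<^sup>+x. f x \<partial>lborel)"
    using nn_integral_lborel_scale[OF f, of 1 x0] by (simp add: g_def)
  finally show ?thesis
    by (simp add: mult.assoc[symmetric] ennreal_mult[symmetric])
qed

text \<open>Young's inequality integrated against \<open>w\<close>, with the constant \<open>H / A\<close>.\<close>

lemma nn_integral_jensen_powr:
  fixes k w :: "'b \<Rightarrow> real"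
  assumes [measurable]: "k \<in> borel_measurable M" "w \<in> borel_measurable M"
    and nn: "\<And>x. 0 \<le> k x" "\<And>x. 0 \<le> w x" and p: "1 < p"
    and A: "0 < A" "(\<integral>\<^sup>+x. ennreal (w x) \<partial>M) = ennreal A"
    and E: "0 \<le> E" "(\<integral>\<^sup>+x. ennreal (k x powr p * w x) \<partial>M) = ennreal E"
    and H: "ennreal H \<le> (\<integral>\<^sup>+x. ennreal (k x * w x) \<partial>M)" "0 \<le> H"
  shows "H powr p \<le> A powr (p - 1) * E"
proof (cases "H = 0")
  case True
  then show ?thesis using E p by simp
next
  case False
  then have H0: "0 < H" using H by simp
  define c where "c = H / A"
  have c: "0 < c" using H0 A by (simp add: c_def)
  \<comment> \<open>The graph of \<open>y powr p\<close> lies above its tangent at \<open>c\<close>;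
    equality is attained by the constant function \<open>k = c\<close>.\<close>
  have young: "p * c powr (p - 1) * y \<le> y powr p + (p - 1) * c powr p" if "0 \<le> y" for y
  proof -
    have "y * c powr (p - 1) \<le> y powr p / p + (c powr (p - 1)) powr (p / (p - 1)) / (p / (p - 1))"
      using that p c by (intro Youngs_inequality) (auto simp: field_simps)
    also have "(c powr (p - 1)) powr (p / (p - 1)) = c powr p" using p by (simp add: powr_powr)
    finally show ?thesis using p by (simp add: field_simps)
  qed
  have "ennreal (p * c powr (p - 1) * H) \<le> ennreal (p * c powr (p - 1)) * (\<integral>\<^sup>+x. ennreal (k x * w x) \<partial>M)"
    using H p by (simp add: ennreal_mult mult_left_mono)
  also have "\<dots> = (\<integral>\<^sup>+x. ennreal (p * c powr (p - 1) * k x * w x) \<partial>M)"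
    using nn p by (subst nn_integral_cmult[symmetric]) (auto simp: ennreal_mult[symmetric] mult_ac)
  also have "\<dots> \<le> (\<integral>\<^sup>+x. ennreal (k x powr p * w x) + ennreal ((p - 1) * c powr p) * ennreal (w x) \<partial>M)"
  proof (rule nn_integral_mono)
    fix x
    have "p * c powr (p - 1) * k x * w x \<le> (k x powr p + (p - 1) * c powr p) * w x"
      using young[OF nn(1)] nn(2) by (rule mult_right_mono)
    then show "ennreal (p * c powr (p - 1) * k x * w x) \<le> ennreal (k x powr p * w x) + ennreal ((p - 1) * c powr p) * ennreal (w x)"
      using nn[of x] p by (simp add: ennreal_mult[symmetric] ennreal_plus[symmetric] distrib_right del: ennreal_plus)
  qed
  also have "\<dots> = ennreal E + ennreal ((p - 1) * c powr p) * ennreal A"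
    using A E by (simp add: nn_integral_add nn_integral_cmult)
  also have "\<dots> = ennreal (E + (p - 1) * c powr p * A)"
    using A E p by (simp add: ennreal_mult[symmetric] ennreal_plus[symmetric] del: ennreal_plus)
  finally have "p * c powr (p - 1) * H \<le> E + (p - 1) * c powr p * A"
    using A E p by (subst (asm) ennreal_le_iff) auto
  moreover have "c powr (p - 1) * H = c powr p * A"
  proof -
    have "c powr (p - 1) * c = c powr p" using powr_mult_base[of c "p - 1"] c by (simp add: mult.commute)
    moreover have "H = c * A" using A by (simp add: c_def)
    ultimately show ?thesis by (simp add: mult.assoc[symmetric])
  qed
  moreover from this have "p * c powr (p - 1) * H = p * (c powr p * A)" by (simp add: mult.assoc)
  ultimately have "c powr p * A \<le> E" by (simp add: left_diff_distrib mult.assoc)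
  moreover have "H powr p = A powr (p - 1) * (c powr p * A)"
  proof -
    have "A * A powr (p - 1) = A powr p" using powr_mult_base[of A "p - 1"] A by simp
    moreover have "H powr p = c powr p * A powr p" using H0 A by (simp add: c_def powr_divide)
    ultimately show ?thesis by (simp add: mult_ac)
  qed
  ultimately show ?thesis by (simp add: mult_left_mono)
qed

text \<open>The difference quotients \<open>?D\<close> are continuous, so the fundamental theorem
  applies to the averages \<open>(G (t + c) - G t) / c\<close> of \<open>g\<close>, whose increments
  tend to that of \<open>g\<close>. The quotients are bounded by \<open>L\<close>, so the reverse
  Fatou lemma brings the upper limit under the integral, where it is almost everywhere the
  derivative.\<close>

lemma lipschitz_increment_le_nn_integral:
  fixes g h :: "real \<Rightarrow> real"
  assumes g: "L-lipschitz_on UNIV g" and s: "0 < s"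
    and d: "AE t in lborel. 0 < t \<longrightarrow> t < s \<longrightarrow> (\<exists>D. (g has_real_derivative D) (at t) \<and> \<bar>D\<bar> \<le> h t)"
  shows "ennreal \<bar>g s - g 0\<bar> \<le> (\<integral>\<^sup>+t. ennreal (h t) * indicator {0<..<s} t \<partial>lborel)"
proof -
  have L: "0 \<le> L" using g by (rule lipschitz_on_nonneg)
  have cg: "continuous_on A g" for A
    using lipschitz_on_continuous_on[OF g] continuous_on_subset by blast
  have [measurable]: "g \<in> borel_measurable borel" by (intro borel_measurable_continuous_onI cg)
  \<comment> \<open>The margin 1 on both sides leaves room for the shifts \<open>c n < 1\<close> and
    for two-sided derivatives.\<close>
  obtain G where G: "\<And>x. x \<in> {-1..s + 1} \<Longrightarrow> (G has_vector_derivative g x) (at x within {-1..s + 1})"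
    using antiderivative_continuous[OF cg] by blast
  have G': "(G has_real_derivative g x) (at x)" if "x \<in> {-1<..<s + 1}" for x
  proof -
    have "(G has_vector_derivative g x) (at x)"
      using G[of x] that at_within_interior[of x "{-1..s + 1}"] by simp
    then show ?thesis by (simp add: has_real_derivative_iff_has_vector_derivative)
  qed
  define c where "c n = 1 / real (Suc (Suc n))" for n
  have c: "0 < c n" "c n < 1" for n by (auto simp: c_def)
  have c0: "c \<longlonglongrightarrow> 0" unfolding c_def
    using LIMSEQ_Suc[OF LIMSEQ_inverse_real_of_nat] by (simp add: inverse_eq_divide)
  let ?D = "\<lambda>n t. (g (t + c n) - g t) / c n"
  have lim: "(\<lambda>n. (G (x + c n) - G x) / c n) \<longlonglongrightarrow> g x" if "x \<in> {-1<..<s + 1}" for x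
  proof -
    have "((\<lambda>h. (G (x + h) - G x) / h) \<longlongrightarrow> g x) (at 0)" using G'[OF that] by (simp add: DERIV_def)
    then show ?thesis
      by (rule filterlim_compose) (use c0 c in \<open>auto simp: filterlim_at intro!: always_eventually\<close>, metis less_irrefl)
  qed
  have 1: "ennreal \<bar>(G (s + c n) - G s) / c n - (G (0 + c n) - G 0) / c n\<bar>
      \<le> (\<integral>\<^sup>+t. ennreal \<bar>?D n t\<bar> * indicator {0<..<s} t \<partial>lborel)" for n
  proof -
    have hb: "has_bochner_integral lborel (\<lambda>t. indicator {0..s} t *\<^sub>R ?D n t)
        ((G (s + c n) - G s) / c n - (G (0 + c n) - G 0) / c n)"
    proof (rule has_bochner_integral_FTC_Icc[where F="\<lambda>t. (G (t + c n) - G t) / c n"])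
      show "continuous_on {0..s} (?D n)"
        using c(1)[of n] by (intro continuous_intros continuous_on_compose2[OF cg[of UNIV]] cg) auto
      fix t assume t: "0 \<le> t" "t \<le> s"
      have "((\<lambda>t. G (t + c n)) has_real_derivative g (t + c n)) (at t)"
        using G'[of "t + c n"] c[of n] t by (auto simp: DERIV_shift)
      then have "((\<lambda>t. (G (t + c n) - G t) / c n) has_real_derivative ?D n t) (at t)"
        by (intro DERIV_cdivide DERIV_diff G') (use t c[of n] in auto)
      then show "((\<lambda>t. (G (t + c n) - G t) / c n) has_vector_derivative ?D n t) (at t within {0..s})"
        by (simp add: has_real_derivative_iff_has_vector_derivative has_vector_derivative_at_within)
    qed (use s in auto)
    have "ennreal \<bar>(G (s + c n) - G s) / c n - (G (0 + c n) - G 0) / c n\<bar>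
      \<le> (\<integral>\<^sup>+t. ennreal (norm (indicator {0..s} t *\<^sub>R ?D n t)) \<partial>lborel)"
      using has_bochner_integral_norm_bound[OF hb] by simp
    also have "\<dots> = (\<integral>\<^sup>+t. ennreal \<bar>?D n t\<bar> * indicator {0<..<s} t \<partial>lborel)"
      using AE_lborel_singleton[of 0] AE_lborel_singleton[of s]
      by (intro nn_integral_cong_AE) (auto split: split_indicator)
    finally show ?thesis .
  qed
  have "(\<lambda>n. ennreal \<bar>(G (s + c n) - G s) / c n - (G (0 + c n) - G 0) / c n\<bar>) \<longlonglongrightarrow> ennreal \<bar>g s - g 0\<bar>"
    using s by (intro tendsto_intros tendsto_ennrealI lim) auto
  then have "ennreal \<bar>g s - g 0\<bar> = limsup (\<lambda>n. ennreal \<bar>(G (s + c n) - G s) / c n - (G (0 + c n) - G 0) / c n\<bar>)"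
    by (intro lim_imp_Limsup[symmetric]) auto
  also have "\<dots> \<le> limsup (\<lambda>n. \<integral>\<^sup>+t. ennreal \<bar>?D n t\<bar> * indicator {0<..<s} t \<partial>lborel)"
    using 1 by (intro Limsup_mono always_eventually) auto
  also have "\<dots> \<le> (\<integral>\<^sup>+t. limsup (\<lambda>n. ennreal \<bar>?D n t\<bar> * indicator {0<..<s} t) \<partial>lborel)"
  proof (rule nn_integral_limsup[where w="\<lambda>t. ennreal L * indicator {0<..<s} t"])
    have "\<bar>?D n t\<bar> \<le> L" for n t
      using lipschitz_onD[OF g, of "t + c n" t] c(1)[of n] by (simp add: dist_real_def abs_mult field_simps)
    then show "AE t in lborel. ennreal \<bar>?D n t\<bar> * indicator {0<..<s} t \<le> ennreal L * indicator {0<..<s} t" for n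
      by (auto intro!: mult_right_mono ennreal_leI)
    show "(\<integral>\<^sup>+t. ennreal L * indicator {0<..<s} t \<partial>lborel) < \<infinity>"
      using s L by (simp add: nn_integral_cmult ennreal_mult[symmetric])
  qed auto
  also have "\<dots> \<le> (\<integral>\<^sup>+t. ennreal (h t) * indicator {0<..<s} t \<partial>lborel)"
    using d
  proof (intro nn_integral_mono_AE, eventually_elim)
    case (elim t)
    show ?case
    proof (cases "t \<in> {0<..<s}")
      case True
      then obtain D where D: "(g has_real_derivative D) (at t)" "\<bar>D\<bar> \<le> h t" using elim by auto
      have "(\<lambda>n. ?D n t) \<longlonglongrightarrow> D"
        using D(1) unfolding DERIV_def
        by (rule filterlim_compose) (use c0 c in \<open>auto simp: filterlim_at intro!: always_eventually\<close>, metis less_irrefl)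
      then have "(\<lambda>n. ennreal \<bar>?D n t\<bar>) \<longlonglongrightarrow> ennreal \<bar>D\<bar>" by (intro tendsto_intros tendsto_ennrealI)
      then have "limsup (\<lambda>n. ennreal \<bar>?D n t\<bar>) = ennreal \<bar>D\<bar>" by (intro lim_imp_Limsup) auto
      then show ?thesis using True D(2) by (simp add: ennreal_leI)
    next
      case False
      then show ?thesis by (simp add: Limsup_const)
    qed
  qed
  finally show ?thesis .
qed

text \<open>The weight is chosen so that, for \<open>k = h / w\<close>, the product
  \<open>k powr p * w\<close> is exactly \<open>h powr p * t ^ (n - 1)\<close>, the integrand of
  polar coordinates. Its total mass \<open>s powr \<alpha> / \<alpha>\<close> is finite because
  \<open>n < p\<close>, and the power \<open>p - 1\<close> of this mass is the constant in
  front.\<close>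

lemma ray_increment_powr_le:
  fixes g h :: "real \<Rightarrow> real" and n :: nat
  assumes g: "L-lipschitz_on UNIV g" and s: "0 < s" and n: "0 < n" "real n < p"
    and [measurable]: "h \<in> borel_measurable borel" and h: "\<And>t. 0 \<le> h t"
    and d: "AE t in lborel. 0 < t \<longrightarrow> t < s \<longrightarrow> (\<exists>D. (g has_real_derivative D) (at t) \<and> \<bar>D\<bar> \<le> h t)"
  shows "ennreal (\<bar>g s - g 0\<bar> powr p) \<le> ennreal (s powr (p - real n) * ((p - 1) / (p - real n)) powr (p - 1)) *
    (\<integral>\<^sup>+t. ennreal (h t powr p) * ennreal (t ^ (n - 1)) * indicator {0<..<s} t \<partial>lborel)"
proof -
  define \<alpha> where "\<alpha> = (p - real n) / (p - 1)"
  have p: "1 < p" using n by linarith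
  have \<alpha>: "0 < \<alpha>" using n p by (simp add: \<alpha>_def)
  define A where "A = s powr \<alpha> / \<alpha>"
  have A: "0 < A" using s \<alpha> by (simp add: A_def)
  define w where "w t = t powr (\<alpha> - 1) * indicator {0<..<s} t" for t :: real
  define k where "k t = h t * t powr (1 - \<alpha>)" for t :: real
  have [measurable]: "w \<in> borel_measurable borel" "k \<in> borel_measurable borel" unfolding w_def k_def by measurable
  have Ap: "A powr (p - 1) = s powr (p - real n) * ((p - 1) / (p - real n)) powr (p - 1)"
  proof -
    have "A powr (p - 1) = (s powr \<alpha>) powr (p - 1) * (1 / \<alpha>) powr (p - 1)"
      using s \<alpha> by (simp add: A_def powr_mult[symmetric])
    also have "(s powr \<alpha>) powr (p - 1) = s powr (p - real n)" using p by (simp add: powr_powr \<alpha>_def)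
    also have "1 / \<alpha> = (p - 1) / (p - real n)" by (simp add: \<alpha>_def)
    finally show ?thesis .
  qed
  let ?E = "\<integral>\<^sup>+t. ennreal (h t powr p) * ennreal (t ^ (n - 1)) * indicator {0<..<s} t \<partial>lborel"
  show ?thesis
  proof (cases "?E = \<infinity>")
    case True
    then show ?thesis using s n p A unfolding Ap[symmetric] by (simp add: ennreal_mult_top)
  next
    case False
    then obtain E where E: "?E = ennreal E" "0 \<le> E" by (cases ?E) auto
    have "\<bar>g s - g 0\<bar> powr p \<le> A powr (p - 1) * E"
    proof (rule nn_integral_jensen_powr[of k lborel w])
      have "(\<integral>\<^sup>+t. ennreal (w t) \<partial>lborel) = (\<integral>\<^sup>+t. ennreal (t powr (\<alpha> - 1)) * indicator {0<..s} t \<partial>lborel)"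
        using AE_lborel_singleton[of s] unfolding w_def
        by (intro nn_integral_cong_AE) (auto split: split_indicator)
      also have "\<dots> = ennreal A" unfolding A_def using \<alpha> s by (intro nn_integral_powr_from_0) auto
      finally show "(\<integral>\<^sup>+t. ennreal (w t) \<partial>lborel) = ennreal A" .
      have e: "k t powr p * t powr (\<alpha> - 1) = h t powr p * t ^ (n - 1)" if "0 < t" for t
      proof -
        have "k t powr p * t powr (\<alpha> - 1) = h t powr p * (t powr ((1 - \<alpha>) * p) * t powr (\<alpha> - 1))"
          using h that by (simp add: k_def powr_mult powr_powr)
        also have "t powr ((1 - \<alpha>) * p) * t powr (\<alpha> - 1) = t powr ((1 - \<alpha>) * (p - 1))"
          by (simp add: powr_add[symmetric] algebra_simps)
        also have "(1 - \<alpha>) * (p - 1) = real (n - 1)"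
          using p n by (simp add: \<alpha>_def field_simps of_nat_diff)
        finally show ?thesis using that by (simp add: powr_realpow)
      qed
      show "(\<integral>\<^sup>+t. ennreal (k t powr p * w t) \<partial>lborel) = ennreal E"
        unfolding E(1)[symmetric]
      proof (intro nn_integral_cong)
        fix t
        show "ennreal (k t powr p * w t) = ennreal (h t powr p) * ennreal (t ^ (n - 1)) * indicator {0<..<s} t"
          using e[of t] by (auto simp: w_def ennreal_mult[symmetric] split: split_indicator)
      qed
      have "ennreal \<bar>g s - g 0\<bar> \<le> (\<integral>\<^sup>+t. ennreal (h t) * indicator {0<..<s} t \<partial>lborel)"
        by (rule lipschitz_increment_le_nn_integral[OF g s d])
      also have "\<dots> = (\<integral>\<^sup>+t. ennreal (k t * w t) \<partial>lborel)"
        by (intro nn_integral_cong) (auto simp: k_def w_def mult.assoc powr_add[symmetric] split: split_indicator)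
      finally show "ennreal \<bar>g s - g 0\<bar> \<le> (\<integral>\<^sup>+t. ennreal (k t * w t) \<partial>lborel)" .
    qed (use A E p h in \<open>auto simp: w_def k_def\<close>)
    then show ?thesis
      unfolding E(1) Ap[symmetric] using E(2) by (simp add: ennreal_mult[symmetric] ennreal_leI)
  qed
qed

section \<open>A Poincare inequality on star-shaped sets\<close>

lemma GDERIV_unique:
  assumes "GDERIV f x :> g" "GDERIV f x :> g'"
  shows "g = g'"
proof -
  have "(\<lambda>h. h \<bullet> g) = (\<lambda>h. h \<bullet> g')"
    using has_derivative_unique assms unfolding gderiv_def by blast
  then have "(g - g') \<bullet> g = (g - g') \<bullet> g'" by metis
  then have "(g - g') \<bullet> (g - g') = 0" by (simp add: inner_diff_right)
  then show ?thesis by simp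
qed

lemma grad_eq: "GDERIV f x :> g \<Longrightarrow> grad f x = g"
  unfolding grad_def by (rule the_equality) (auto intro: GDERIV_unique)

text \<open>Integration along rays needs a measurable gradient, while \<open>grad f\<close> is
  unspecified off the points of differentiability. \<open>G\<close> is 0 on a Borel null set
  containing the bad points and is a limit of difference quotients of a continuous function
  elsewhere.\<close>

lemma lipschitz_gradient:
  fixes f :: "'a::euclidean_space \<Rightarrow> real"
  assumes f: "L-lipschitz_on UNIV f"
  obtains G where "G \<in> borel_measurable borel" "AE x in lborel. GDERIV f x :> G x"
proof -
  obtain N where N: "N \<in> null_sets lborel" "{x. \<not> (\<exists>g. GDERIV f x :> g)} \<subseteq> N"
    using AE_GDERIV_lipschitz[OF f] by (auto simp: eventually_ae_filter)
  define G where "G x = (if x \<in> N then 0 else grad f x)" for x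
  have G: "GDERIV f x :> G x" if "x \<notin> N" for x
    using that N(2) grad_eq by (auto simp: G_def)
  have [measurable]: "f \<in> borel_measurable borel"
    using f lipschitz_on_continuous_on by (intro borel_measurable_continuous_onI) auto
  have [measurable]: "N \<in> sets borel" using N(1) by auto
  define c where "c n = 1 / real (Suc n)" for n
  have c: "0 < c n" for n by (auto simp: c_def)
  have c0: "c \<longlonglongrightarrow> 0" unfolding c_def
    using LIMSEQ_inverse_real_of_nat by (simp add: inverse_eq_divide)
  have "(\<lambda>x. G x \<bullet> i) \<in> borel_measurable borel" if "i \<in> Basis" for i
  proof (rule borel_measurable_LIMSEQ_real)
    fix x :: 'a
    show "(\<lambda>n. if x \<in> N then 0 else (f (x + c n *\<^sub>R i) - f x) / c n) \<longlonglongrightarrow> G x \<bullet> i"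
    proof (cases "x \<in> N")
      case False
      have "((\<lambda>t. f (x + t *\<^sub>R i)) has_derivative (\<lambda>t. (t *\<^sub>R i) \<bullet> G x)) (at 0)"
      proof (rule has_derivative_compose[of "\<lambda>t. x + t *\<^sub>R i" _ _ _ f, simplified])
        show "((\<lambda>t. x + t *\<^sub>R i) has_derivative (\<lambda>t. t *\<^sub>R i)) (at 0)" by (auto intro!: derivative_eq_intros)
        show "(f has_derivative (\<lambda>h. h \<bullet> G x)) (at (x + 0 *\<^sub>R i))" using G[OF False] by (simp add: gderiv_def)
      qed
      then have "((\<lambda>t. f (x + t *\<^sub>R i)) has_real_derivative (G x \<bullet> i)) (at 0)"
        by (simp add: has_field_derivative_def inner_commute mult_commute_abs)
      then have "((\<lambda>h. (f (x + h *\<^sub>R i) - f x) / h) \<longlongrightarrow> G x \<bullet> i) (at 0)" by (simp add: DERIV_def)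
      then have "(\<lambda>n. (f (x + c n *\<^sub>R i) - f x) / c n) \<longlonglongrightarrow> G x \<bullet> i"
        by (rule filterlim_compose) (use c0 c in \<open>auto simp: filterlim_at intro!: always_eventually\<close>, metis less_irrefl)
      then show ?thesis using False by simp
    qed (simp add: G_def)
  qed measurable
  then have "G \<in> borel_measurable borel" by (simp add: borel_measurable_euclidean_space[of G])
  moreover have "AE x in lborel. GDERIV f x :> G x"
    using N(1) G by (intro AE_I'[of N]) auto
  ultimately show thesis by (rule that)
qed

text \<open>The polar integral of the indicator of \<open>N\<close> vanishes and the weight
  \<open>t ^ (DIM('a) - 1)\<close> is positive for \<open>0 < t\<close>, so almost every inner
  integral forces the ray to avoid \<open>N\<close> almost everywhere.\<close>

lemma AE_polar:
  fixes x0 :: "'a::euclidean_space"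
  assumes N: "N \<in> null_sets lborel"
  shows "AE x in lborel. x \<in> shell \<longrightarrow> (AE t in lborel. 0 < t \<longrightarrow> x0 + t *\<^sub>R x \<notin> N)"
proof -
  have [measurable]: "N \<in> sets borel" "(shell :: 'a set) \<in> sets borel" using N by auto
  have "(\<integral>\<^sup>+x. indicator N x \<partial>lborel) = 0" using N by (simp add: nn_integral_indicator null_setsD1)
  moreover have "ennreal (1 / ln 2) \<noteq> 0" by simp
  ultimately have "(\<integral>\<^sup>+x. (\<integral>\<^sup>+t. indicator N (x0 + t *\<^sub>R x) * ennreal (t ^ (DIM('a) - 1)) * indicator {0<..} t \<partial>lborel) * indicator shell x \<partial>lborel) = 0"
    by (subst (asm) nn_integral_polar[of _ x0]) auto
  then have "AE x in lborel. (\<integral>\<^sup>+t. indicator N (x0 + t *\<^sub>R x) * ennreal (t ^ (DIM('a) - 1)) * indicator {0<..} t \<partial>lborel) * indicator shell x = 0"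
    by (subst (asm) nn_integral_0_iff_AE) measurable
  then show ?thesis
  proof (rule eventually_mono, intro impI)
    fix x :: 'a
    assume "(\<integral>\<^sup>+t. indicator N (x0 + t *\<^sub>R x) * ennreal (t ^ (DIM('a) - 1)) * indicator {0<..} t \<partial>lborel) * indicator shell x = 0" "x \<in> shell"
    then have "(\<integral>\<^sup>+t. indicator N (x0 + t *\<^sub>R x) * ennreal (t ^ (DIM('a) - 1)) * indicator {0<..} t \<partial>lborel) = 0" by simp
    then have "AE t in lborel. indicator N (x0 + t *\<^sub>R x) * ennreal (t ^ (DIM('a) - 1)) * indicator {0<..} t = 0"
      by (subst (asm) nn_integral_0_iff_AE) measurable
    then show "AE t in lborel. 0 < t \<longrightarrow> x0 + t *\<^sub>R x \<notin> N"
      by (rule eventually_mono)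
        (auto simp: indicator_def ennreal_eq_0_iff split: if_splits dest: zero_less_power[where n="DIM('a) - Suc 0"])
  qed
qed

text \<open>The constant \<open>c\<^sub>p\<close> in dimension \<open>n\<close>.\<close>

definition ray_const :: "real \<Rightarrow> real \<Rightarrow> real" where
  "ray_const n p = p * ((p - n) / (p - 1)) powr (p - 1)"

lemma ray_const_pos: "1 \<le> n \<Longrightarrow> n < p \<Longrightarrow> 0 < ray_const n p"
  by (simp add: ray_const_def)

theorem star_shaped_poincare:
  fixes f :: "'a::euclidean_space \<Rightarrow> real"
  assumes f: "L-lipschitz_on UNIV f" and K: "K \<in> sets borel"
    and star: "\<And>x t. x \<in> K \<Longrightarrow> 0 < t \<Longrightarrow> t \<le> 1 \<Longrightarrow> x0 + t *\<^sub>R (x - x0) \<in> K"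
    and KR: "K \<subseteq> cball x0 R" and R: "0 \<le> R" and p: "real DIM('a) < p"
  shows "(\<integral>\<^sup>+x. ennreal (\<bar>f x - f x0\<bar> powr p) * indicator K x \<partial>lborel)
    \<le> ennreal (R powr p / ray_const (real DIM('a)) p) * (\<integral>\<^sup>+x. ennreal (norm (grad f x) powr p) * indicator K x \<partial>lborel)"
proof -
  let ?n = "DIM('a)"
  have n: "0 < ?n" "real ?n < p" using p by auto
  have p1: "1 < p" using n DIM_positive[where 'a='a] by linarith
  obtain G where G[measurable]: "G \<in> borel_measurable borel" and GD: "AE x in lborel. GDERIV f x :> G x"
    using lipschitz_gradient[OF f] by blast
  obtain N where N: "N \<in> null_sets lborel" "{x. \<not> (GDERIV f x :> G x)} \<subseteq> N"
    using GD by (auto simp: eventually_ae_filter)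
  have [measurable]: "f \<in> borel_measurable borel"
    using f lipschitz_on_continuous_on by (intro borel_measurable_continuous_onI) auto
  have [measurable]: "K \<in> sets borel" "(shell :: 'a set) \<in> sets borel" using K by auto
  define F where "F x = ennreal (\<bar>f x - f x0\<bar> powr p) * indicator K x" for x
  define Q where "Q x = ennreal (norm (G x) powr p) * indicator K x" for x
  have [measurable]: "F \<in> borel_measurable borel" "Q \<in> borel_measurable borel" unfolding F_def Q_def by measurable
  define C1 where "C1 = ((p - 1) / (p - real ?n)) powr (p - 1)"
  have C1: "0 < C1" using p p1 by (simp add: C1_def)
  have C: "R powr p / ray_const (real ?n) p = C1 * R powr p / p"
    using p p1 by (simp add: ray_const_def C1_def powr_divide mult_ac)
  let ?C = "ennreal (C1 * R powr p / p)"
  let ?I = "\<lambda>H x. \<integral>\<^sup>+t. H (x0 + t *\<^sub>R x) * ennreal (t ^ (?n - 1)) * indicator {0<..} t \<partial>lborel"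
  have ray: "?I F x \<le> ?C * ?I Q x" if x: "x \<in> shell" "AE t in lborel. 0 < t \<longrightarrow> x0 + t *\<^sub>R x \<notin> N" for x
  proof -
    have nx: "0 < norm x" using x by auto
    have lip: "(L * norm x)-lipschitz_on UNIV (\<lambda>t. f (x0 + t *\<^sub>R x))"
    proof (rule lipschitz_onI)
      fix s t :: real
      have "dist (f (x0 + s *\<^sub>R x)) (f (x0 + t *\<^sub>R x)) \<le> L * dist (x0 + s *\<^sub>R x) (x0 + t *\<^sub>R x)"
        by (rule lipschitz_onD[OF f]) auto
      also have "dist (x0 + s *\<^sub>R x) (x0 + t *\<^sub>R x) = norm x * dist s t"
        by (simp add: dist_norm scaleR_diff_left[symmetric])
      finally show "dist (f (x0 + s *\<^sub>R x)) (f (x0 + t *\<^sub>R x)) \<le> L * norm x * dist s t" by simp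
    qed (use lipschitz_on_nonneg[OF f] in auto)
    \<comment> \<open>The bracket contains the integral over the whole ray instead of the segment up
      to \<open>s\<close>; being independent of \<open>s\<close>, it comes out of the
      integral.\<close>
    have pt: "F (x0 + s *\<^sub>R x) * ennreal (s ^ (?n - 1)) * indicator {0<..} s
       \<le> (ennreal (C1 * norm x powr p) * ?I Q x) * (ennreal (s powr (p - 1)) * indicator {0<..R / norm x} s)" for s
    proof (cases "0 < s \<and> x0 + s *\<^sub>R x \<in> K")
      case True
      then have s: "0 < s" and sK: "x0 + s *\<^sub>R x \<in> K" by auto
      have "norm (s *\<^sub>R x) \<le> R" using sK KR by (auto simp: dist_norm)
      then have sR: "s \<le> R / norm x" using s nx by (simp add: field_simps)
      have inK: "x0 + t *\<^sub>R x \<in> K" if "0 < t" "t < s" for t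
        using star[OF sK, of "t / s"] that s by simp
      have der: "AE t in lborel. 0 < t \<longrightarrow> t < s \<longrightarrow>
        (\<exists>D. ((\<lambda>t. f (x0 + t *\<^sub>R x)) has_real_derivative D) (at t) \<and> \<bar>D\<bar> \<le> norm (G (x0 + t *\<^sub>R x)) * norm x)"
        using x(2)
      proof (rule eventually_mono, intro impI)
        fix t assume "0 < t \<longrightarrow> x0 + t *\<^sub>R x \<notin> N" "0 < t" "t < s"
        then have gd: "GDERIV f (x0 + t *\<^sub>R x) :> G (x0 + t *\<^sub>R x)" using N(2) by blast
        have "((\<lambda>t. f (x0 + t *\<^sub>R x)) has_derivative (\<lambda>h. (h *\<^sub>R x) \<bullet> G (x0 + t *\<^sub>R x))) (at t)"
        proof (rule has_derivative_compose[of "\<lambda>t. x0 + t *\<^sub>R x" _ _ _ f, simplified])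
          show "((\<lambda>t. x0 + t *\<^sub>R x) has_derivative (\<lambda>t. t *\<^sub>R x)) (at t)" by (auto intro!: derivative_eq_intros)
          show "(f has_derivative (\<lambda>h. h \<bullet> G (x0 + t *\<^sub>R x))) (at (x0 + t *\<^sub>R x))" using gd by (simp add: gderiv_def)
        qed
        then have "((\<lambda>t. f (x0 + t *\<^sub>R x)) has_real_derivative (G (x0 + t *\<^sub>R x) \<bullet> x)) (at t)"
          by (simp add: has_field_derivative_def inner_commute mult_commute_abs)
        then show "\<exists>D. ((\<lambda>t. f (x0 + t *\<^sub>R x)) has_real_derivative D) (at t) \<and> \<bar>D\<bar> \<le> norm (G (x0 + t *\<^sub>R x)) * norm x"
          using Cauchy_Schwarz_ineq2 by blast
      qed
      have "ennreal (\<bar>f (x0 + s *\<^sub>R x) - f (x0 + 0 *\<^sub>R x)\<bar> powr p) \<le> ennreal (s powr (p - real ?n) * C1) *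
          (\<integral>\<^sup>+t. ennreal ((norm (G (x0 + t *\<^sub>R x)) * norm x) powr p) * ennreal (t ^ (?n - 1)) * indicator {0<..<s} t \<partial>lborel)"
        unfolding C1_def by (rule ray_increment_powr_le[OF lip s n _ _ der]) auto
      also have "\<dots> \<le> ennreal (s powr (p - real ?n) * C1) * (\<integral>\<^sup>+t. ennreal (norm x powr p) * (Q (x0 + t *\<^sub>R x) * ennreal (t ^ (?n - 1)) * indicator {0<..} t) \<partial>lborel)"
        using inK by (intro mult_left_mono nn_integral_mono)
          (auto simp: Q_def powr_mult ennreal_mult mult_ac split: split_indicator)
      also have "\<dots> = ennreal (s powr (p - real ?n) * C1) * (ennreal (norm x powr p) * ?I Q x)"
        by (subst nn_integral_cmult) auto
      finally have "ennreal (\<bar>f (x0 + s *\<^sub>R x) - f x0\<bar> powr p) * ennreal (s ^ (?n - 1))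
        \<le> ennreal (s powr (p - real ?n) * C1) * (ennreal (norm x powr p) * ?I Q x) * ennreal (s ^ (?n - 1))"
        by (intro mult_right_mono) auto
      also have "\<dots> = (ennreal (C1 * norm x powr p) * ?I Q x) * (ennreal (s powr (p - real ?n)) * ennreal (s ^ (?n - 1)))"
        using C1 by (simp add: ennreal_mult mult_ac)
      also have "ennreal (s powr (p - real ?n)) * ennreal (s ^ (?n - 1)) = ennreal (s powr (p - 1))"
        using s n by (simp add: ennreal_mult[symmetric] powr_realpow[symmetric] powr_add[symmetric] of_nat_diff)
      finally show ?thesis using True sR by (simp add: F_def)
    qed (auto simp: F_def)
    have "?I F x \<le> (\<integral>\<^sup>+s. (ennreal (C1 * norm x powr p) * ?I Q x) * (ennreal (s powr (p - 1)) * indicator {0<..R / norm x} s) \<partial>lborel)"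
      by (intro nn_integral_mono pt)
    also have "\<dots> = (ennreal (C1 * norm x powr p) * ?I Q x) * ennreal ((R / norm x) powr p / p)"
      using p1 R by (subst nn_integral_cmult) (auto simp: nn_integral_powr_from_0)
    also have "\<dots> = ennreal (C1 * norm x powr p * ((R / norm x) powr p / p)) * ?I Q x"
    proof -
      have e: "ennreal (C1 * norm x powr p * ((R / norm x) powr p / p))
          = ennreal (C1 * norm x powr p) * ennreal ((R / norm x) powr p / p)"
        using C1 p1 by (intro ennreal_mult) auto
      show ?thesis unfolding e by (simp only: mult_ac)
    qed
    also have "C1 * norm x powr p * ((R / norm x) powr p / p) = C1 * R powr p / p"
      using nx R by (simp add: powr_divide)
    finally show ?thesis .
  qed
  have "(\<integral>\<^sup>+x. F x \<partial>lborel) = ennreal (1 / ln 2) * (\<integral>\<^sup>+x. ?I F x * indicator shell x \<partial>lborel)"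
    by (rule nn_integral_polar) measurable
  also have "\<dots> \<le> ennreal (1 / ln 2) * (\<integral>\<^sup>+x. ?C * (?I Q x * indicator shell x) \<partial>lborel)"
  proof (intro mult_left_mono nn_integral_mono_AE)
    show "AE x in lborel. ?I F x * indicator shell x \<le> ?C * (?I Q x * indicator shell x)"
      using AE_polar[OF N(1), of x0]
    proof (rule eventually_mono)
      fix x assume "x \<in> shell \<longrightarrow> (AE t in lborel. 0 < t \<longrightarrow> x0 + t *\<^sub>R x \<notin> N)"
      then show "?I F x * indicator shell x \<le> ?C * (?I Q x * indicator shell x)"
        using ray[of x] by (cases "x \<in> shell") auto
    qed
  qed auto
  also have "\<dots> = ?C * (ennreal (1 / ln 2) * (\<integral>\<^sup>+x. ?I Q x * indicator shell x \<partial>lborel))"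
    by (subst nn_integral_cmult) (measurable, simp add: mult_ac)
  also have "ennreal (1 / ln 2) * (\<integral>\<^sup>+x. ?I Q x * indicator shell x \<partial>lborel) = (\<integral>\<^sup>+x. Q x \<partial>lborel)"
    by (rule nn_integral_polar[symmetric]) measurable
  also have "(\<integral>\<^sup>+x. Q x \<partial>lborel) = (\<integral>\<^sup>+x. ennreal (norm (grad f x) powr p) * indicator K x \<partial>lborel)"
    unfolding Q_def using GD by (intro nn_integral_cong_AE) (auto elim!: eventually_mono simp: grad_eq)
  finally show ?thesis unfolding C F_def .
qed

section \<open>Lower bounds for the punctured constants\<close>

lemma nn_integral_lebesgue_on_borel:
  "K \<in> sets borel \<Longrightarrow> (\<integral>\<^sup>+x. f x \<partial>lebesgue_on K) = (\<integral>\<^sup>+x. f x * indicator K x \<partial>lborel)"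
  by (simp add: nn_integral_restrict_space nn_integral_completion)

lemma ennpowr_ennreal: "0 \<le> x \<Longrightarrow> ennpowr (ennreal x) a = ennreal (x powr a)"
  by (simp add: ennpowr_def)

lemma ennpowr_ennpowr_inverse: "0 < p \<Longrightarrow> ennpowr (ennpowr x (1 / p)) p = x"
  by (cases x) (auto simp: ennpowr_def powr_powr)

lemma ennpowr_Lnorm:
  "0 < p \<Longrightarrow> ennpowr (Lnorm (ennreal p) K f) p = (\<integral>\<^sup>+x. ennreal (norm (f x) powr p) \<partial>lebesgue_on K)"
  by (simp add: Lnorm_def ennpowr_ennpowr_inverse)

lemma Lnorm_top_le:
  assumes "f \<in> borel_measurable (lebesgue_on K)" "\<And>x. x \<in> K \<Longrightarrow> norm (f x) \<le> M"
  shows "Lnorm top K f \<le> ennreal M"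
  unfolding Lnorm_def using assms by (auto intro!: esssup_I ennreal_leI AE_I2)

text \<open>If the essential bound were below some \<open>c < norm (f x)\<close>, continuity would
  keep \<open>norm (f y)\<close> above \<open>c\<close> on the nonempty open set
  \<open>K \<inter> ball x d\<close>, which is not negligible. Points of \<open>closure K\<close>
  are included because the suprema needed later are attained on the unit sphere.\<close>

lemma norm_le_Lnorm_top:
  fixes f :: "'a::euclidean_space \<Rightarrow> real"
  assumes K: "open K" and f: "continuous_on (closure K) f" and x: "x \<in> closure K"
  shows "ennreal (norm (f x)) \<le> Lnorm top K f"
proof (rule ccontr)
  assume "\<not> ennreal (norm (f x)) \<le> Lnorm top K f"
  then have less: "Lnorm top K f < ennreal (norm (f x))" by simp
  then obtain c where c: "Lnorm top K f = ennreal c" "0 \<le> c" "c < norm (f x)"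
    by (cases "Lnorm top K f") (auto simp: ennreal_less_iff)
  have "((\<lambda>y. norm (f y)) \<longlongrightarrow> norm (f x)) (at x within closure K)"
    using f x by (intro tendsto_intros) (auto simp: continuous_on_def)
  then have "\<forall>\<^sub>F y in at x within closure K. c < norm (f y)"
    using c(3) by (rule order_tendstoD)
  then obtain d where d: "0 < d" "\<And>y. y \<in> closure K \<Longrightarrow> y \<noteq> x \<Longrightarrow> dist y x < d \<Longrightarrow> c < norm (f y)"
    by (auto simp: eventually_at)
  have op: "open (K \<inter> ball x d)" using K by auto
  have "K \<inter> ball x d \<noteq> {}" using x d(1) by (metis Int_commute centre_in_ball closure_iff_nhds_not_empty disjoint_iff open_ball open_Int_closure_eq_empty)
  then have "\<not> negligible (K \<inter> ball x d)" using open_not_negligible[OF op] by blast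
  moreover have "AE y in lebesgue_on K. ennreal (norm (f y)) \<le> ennreal c"
    using esssup_AE[of "\<lambda>x. ennreal (norm (f x))" "lebesgue_on K"] c(1) by (simp add: Lnorm_def)
  then have "AE y in lebesgue. y \<in> K \<longrightarrow> norm (f y) \<le> c"
    using K c(2) by (subst (asm) AE_restrict_space_iff) auto
  then obtain N where N: "N \<in> null_sets lebesgue" "{y. \<not> (y \<in> K \<longrightarrow> norm (f y) \<le> c)} \<subseteq> N"
    by (auto simp: eventually_ae_filter)
  have "K \<inter> ball x d \<subseteq> N"
  proof
    fix y assume y: "y \<in> K \<inter> ball x d"
    have "c < norm (f y)" using d(2)[of y] y c(3) closure_subset[of K] by (cases "y = x") (auto simp: dist_commute)
    then show "y \<in> N" using y N(2) by auto
  qed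
  then have "negligible (K \<inter> ball x d)" using N(1) negligible_iff_null_sets negligible_subset by blast
  ultimately show False by blast
qed

lemma Lnorm_cmult:
  fixes f :: "'a::euclidean_space \<Rightarrow> real"
  assumes c: "0 < c" and q: "q = top \<or> 0 < enn2real q"
    and f: "f \<in> borel_measurable (lebesgue_on K)"
  shows "Lnorm q K (\<lambda>x. c * f x) = ennreal c * Lnorm q K f"
proof (cases "q = top")
  case True
  have [measurable]: "f \<in> borel_measurable (lebesgue_on K)" by (rule f)
  have le: "esssup (lebesgue_on K) (\<lambda>x. ennreal (norm (a * g x))) \<le> ennreal a * esssup (lebesgue_on K) (\<lambda>x. ennreal (norm (g x)))"
    if [measurable]: "g \<in> borel_measurable (lebesgue_on K)" and "0 < a" for a and g :: "'a \<Rightarrow> real"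
  proof (rule esssup_I)
    show "AE x in lebesgue_on K. ennreal (norm (a * g x)) \<le> ennreal a * esssup (lebesgue_on K) (\<lambda>x. ennreal (norm (g x)))"
      using esssup_AE[of "\<lambda>x. ennreal (norm (g x))" "lebesgue_on K"]
      by (rule eventually_mono) (use \<open>0 < a\<close> in \<open>auto simp: abs_mult ennreal_mult intro!: mult_left_mono\<close>)
  qed measurable
  \<comment> \<open>The reverse inequality is \<open>le\<close> for the function \<open>c f\<close>
    and the factor \<open>1 / c\<close>.\<close>
  have "ennreal c * esssup (lebesgue_on K) (\<lambda>x. ennreal (norm (f x)))
      = ennreal c * esssup (lebesgue_on K) (\<lambda>x. ennreal (norm ((1 / c) * (c * f x))))" using c by simp
  also have "\<dots> \<le> ennreal c * (ennreal (1 / c) * esssup (lebesgue_on K) (\<lambda>x. ennreal (norm (c * f x))))"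
    using c by (intro mult_left_mono le) auto
  also have "\<dots> = esssup (lebesgue_on K) (\<lambda>x. ennreal (norm (c * f x)))"
    using c by (simp add: mult.assoc[symmetric] ennreal_mult[symmetric])
  finally show ?thesis using le[OF f c] True by (simp add: Lnorm_def)
next
  case False
  then have q0: "0 < enn2real q" using q by simp
  have [measurable]: "f \<in> borel_measurable (lebesgue_on K)" by (rule f)
  let ?r = "enn2real q"
  have "(\<integral>\<^sup>+x. ennreal (norm (c * f x) powr ?r) \<partial>lebesgue_on K) = ennreal (c powr ?r) * (\<integral>\<^sup>+x. ennreal (norm (f x) powr ?r) \<partial>lebesgue_on K)"
    using c by (subst nn_integral_cmult[symmetric]) (auto simp: abs_mult powr_mult ennreal_mult)
  moreover have "ennpowr (ennreal (c powr ?r) * I) (1 / ?r) = ennreal c * ennpowr I (1 / ?r)" for I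
    using c q0 by (cases I) (auto simp: ennpowr_def ennreal_mult[symmetric] powr_mult powr_powr ennreal_mult_top)
  ultimately show ?thesis using False by (simp add: Lnorm_def)
qed

text \<open>The nearest point projection onto the closed ball is 1-Lipschitz, so composing with it
  keeps \<open>L\<close>; on the open ball nothing changes, the gradient included. This supplies the
  globally Lipschitz function for \<open>star_shaped_poincare\<close>.\<close>

lemma lipschitz_extend_unit_ball:
  fixes u :: "'a::euclidean_space \<Rightarrow> real"
  assumes u: "L-lipschitz_on (closure (ball 0 1)) u"
  obtains U where "L-lipschitz_on UNIV U" "\<And>x. x \<in> cball 0 1 \<Longrightarrow> U x = u x"
    "\<And>x. x \<in> ball 0 1 \<Longrightarrow> grad u x = grad U x"
proof -
  let ?c = "closest_point (cball 0 1 :: 'a set)"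
  define U where "U = u \<circ> ?c"
  have in_c: "?c x \<in> cball 0 1" for x by (rule closest_point_in_set) auto
  have "L-lipschitz_on UNIV U"
  proof (rule lipschitz_onI)
    fix x y :: 'a
    have "dist (U x) (U y) \<le> L * dist (?c x) (?c y)"
      unfolding U_def comp_def using in_c by (intro lipschitz_onD[OF u]) auto
    also have "\<dots> \<le> L * dist x y"
      using lipschitz_on_nonneg[OF u] by (intro mult_left_mono closest_point_lipschitz) auto
    finally show "dist (U x) (U y) \<le> L * dist x y" .
  qed (rule lipschitz_on_nonneg[OF u])
  moreover have eq: "U x = u x" if "x \<in> cball 0 1" for x
    using that by (simp add: U_def closest_point_self)
  moreover have "grad u x = grad U x" if "x \<in> ball 0 1" for x
  proof -
    have "GDERIV u x :> g \<longleftrightarrow> GDERIV U x :> g" for g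
      unfolding gderiv_def using that eq
      by (intro iffI; elim has_derivative_transform_within_open[where s="ball 0 1"]) auto
    then show ?thesis by (simp add: grad_def)
  qed
  ultimately show thesis by (rule that)
qed

text \<open>The zeros match the hypothesis \<open>star\<close> of
  \<open>star_shaped_poincare\<close> at \<open>x0 = 0\<close>.\<close>

lemma unit_ball_star: "x \<in> ball (0::'a::euclidean_space) 1 \<Longrightarrow> 0 < t \<Longrightarrow> t \<le> 1 \<Longrightarrow> 0 + t *\<^sub>R (x - 0) \<in> ball 0 1"
  using mult_left_le_one_le[of "norm x" t] by auto

lemma ray_const_le_punctured_const:
  assumes p: "real DIM('a::euclidean_space) < p"
  shows "ennreal (ray_const (real DIM('a)) p) \<le> punctured_const p (ennreal p) (ball (0::'a) 1) 0"
  unfolding punctured_const_def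
proof (rule INF_greatest, safe)
  fix u :: "'a \<Rightarrow> real" and L
  assume u: "L-lipschitz_on (closure (ball 0 1)) u" "Lnorm (ennreal p) (ball 0 1) u = 1" "u 0 = 0"
  have n1: "1 \<le> real DIM('a)" using DIM_positive[where 'a='a] by linarith
  have p1: "0 < p" using p n1 by linarith
  let ?c = "ray_const (real DIM('a)) p"
  have c: "0 < ?c" using n1 p by (rule ray_const_pos)
  obtain U where U: "L-lipschitz_on UNIV U" "\<And>x. x \<in> cball 0 1 \<Longrightarrow> U x = u x"
    "\<And>x. x \<in> ball 0 1 \<Longrightarrow> grad u x = grad U x" by (rule lipschitz_extend_unit_ball[OF u(1)]) blast
  have "1 = ennpowr (Lnorm (ennreal p) (ball 0 1) u) p" using u(2) by (simp add: ennpowr_def)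
  also have "\<dots> = (\<integral>\<^sup>+x. ennreal (norm (u x) powr p) * indicator (ball 0 1) x \<partial>lborel)"
    using p1 by (simp add: ennpowr_Lnorm nn_integral_lebesgue_on_borel)
  also have "\<dots> = (\<integral>\<^sup>+x. ennreal (\<bar>U x - U 0\<bar> powr p) * indicator (ball 0 1) x \<partial>lborel)"
    using U(2) u(3) by (intro nn_integral_cong) (auto split: split_indicator)
  also have "\<dots> \<le> ennreal (1 powr p / ?c) * (\<integral>\<^sup>+x. ennreal (norm (grad U x) powr p) * indicator (ball 0 1) x \<partial>lborel)"
  by (rule star_shaped_poincare[OF U(1) _ unit_ball_star _ _ p]) auto
  also have "(\<integral>\<^sup>+x. ennreal (norm (grad U x) powr p) * indicator (ball 0 1) x \<partial>lborel)
      = (\<integral>\<^sup>+x. ennreal (norm (grad u x) powr p) \<partial>lebesgue_on (ball 0 1))"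
    using U(3) by (auto simp: nn_integral_lebesgue_on_borel intro!: nn_integral_cong split: split_indicator)
  finally have "ennreal ?c * 1 \<le> ennreal ?c * (ennreal (1 / ?c) * (\<integral>\<^sup>+x. ennreal (norm (grad u x) powr p) \<partial>lebesgue_on (ball 0 1)))"
    by (intro mult_left_mono) auto
  then show "ennreal ?c \<le> (\<integral>\<^sup>+x. ennreal (norm (grad u x) powr p) \<partial>lebesgue_on (ball 0 1))"
    using c by (simp add: mult.assoc[symmetric] ennreal_mult[symmetric])
qed

text \<open>Convexity of the power applied to \<open>a + b = (1 - t) (1 + \<epsilon>) a + t (1 +
  \<epsilon>) b / \<epsilon>\<close> with \<open>t = \<epsilon> / (1 + \<epsilon>)\<close>. The
  factor \<open>(1 + \<epsilon>) powr (p - 1)\<close>, in place of the usual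
  \<open>2 powr (p - 1)\<close>, has a p-th root as close to 1 as desired, which the limit as
  \<open>p\<close> tends to infinity requires.\<close>

lemma powr_add_le:
  fixes a b \<epsilon> p :: real
  assumes "0 \<le> a" "0 \<le> b" "0 < \<epsilon>" "1 \<le> p"
  shows "(a + b) powr p \<le> (1 + \<epsilon>) powr (p - 1) * (a powr p + \<epsilon> powr (1 - p) * b powr p)"
proof -
  have 1: "1 \<le> (1 + \<epsilon>) powr (p - 1)" using assms by (simp add: ge_one_powr_ge_zero)
  have 2: "1 \<le> (1 + \<epsilon>) powr (p - 1) * \<epsilon> powr (1 - p)"
  proof -
    have "(1 + \<epsilon>) powr (p - 1) * \<epsilon> powr (1 - p) = ((1 + \<epsilon>) / \<epsilon>) powr (p - 1)"
      using assms by (simp add: powr_divide powr_minus_divide[of \<epsilon> "p - 1", simplified])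
    then show ?thesis using assms by (simp add: ge_one_powr_ge_zero)
  qed
  consider "a = 0" | "b = 0" | "0 < a" "0 < b" using assms by linarith
  then show ?thesis
  proof cases
    case 1
    then show ?thesis using assms 2 mult_right_mono[OF 2, of "b powr p"] by (simp add: mult.assoc)
  next
    case 2
    then show ?thesis using assms 1 mult_right_mono[OF 1, of "a powr p"] by simp
  next
    case 3
    let ?t = "\<epsilon> / (1 + \<epsilon>)"
    have t: "1 - ?t = 1 / (1 + \<epsilon>)" using assms by (simp add: field_simps)
    have e: "(1 - ?t) *\<^sub>R ((1 + \<epsilon>) * a) + ?t *\<^sub>R ((1 + \<epsilon>) * b / \<epsilon>) = a + b"
      unfolding t using assms by simp
    have "((1 - ?t) *\<^sub>R ((1 + \<epsilon>) * a) + ?t *\<^sub>R ((1 + \<epsilon>) * b / \<epsilon>)) powr p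
        \<le> (1 - ?t) * ((1 + \<epsilon>) * a) powr p + ?t * ((1 + \<epsilon>) * b / \<epsilon>) powr p"
      by (rule convex_onD[OF powr_convex]) (use assms 3 in auto)
    also have "\<dots> = (1 / (1 + \<epsilon>)) * ((1 + \<epsilon>) powr p * a powr p) + ?t * ((1 + \<epsilon>) powr p * b powr p / \<epsilon> powr p)"
      unfolding t using assms 3 by (simp add: powr_mult powr_divide)
    also have "\<dots> = (1 + \<epsilon>) powr (p - 1) * (a powr p + \<epsilon> powr (1 - p) * b powr p)"
      using assms by (simp add: powr_diff distrib_left)
    finally show ?thesis unfolding e .
  qed
qed

text \<open>At a maximum point \<open>x\<close>, \<open>1 \<le> |U y - U 0| + |U y - U x|\<close>;
  the p-th power is split by \<open>powr_add_le\<close> and integrated over \<open>B\<close>. In the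
  second term the radius \<open>\<epsilon>\<close> of \<open>B\<close> about \<open>x\<close>
  contributes \<open>\<epsilon> powr p\<close> against the factor
  \<open>\<epsilon> powr (1 - p)\<close>, leaving \<open>\<epsilon>\<close>, so the two terms add up
  to \<open>(1 + \<epsilon>) powr p / ?c\<close> times the energy.\<close>

lemma punctured_const_top_lower:
  fixes \<epsilon> p :: real
  assumes p: "real DIM('a::euclidean_space) < p" and \<epsilon>: "0 < \<epsilon>" "\<epsilon> \<le> 1"
  shows "ennreal (measure lborel (ball (0::'a) (\<epsilon> / 2)) * ray_const (real DIM('a)) p / (1 + \<epsilon>) powr p)
    \<le> punctured_const p top (ball (0::'a) 1) 0"
  unfolding punctured_const_def
proof (rule INF_greatest, safe)
  fix u :: "'a \<Rightarrow> real" and L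
  assume u: "L-lipschitz_on (closure (ball 0 1)) u" "Lnorm top (ball 0 1) u = 1" "u 0 = 0"
  have n1: "1 \<le> real DIM('a)" using DIM_positive[where 'a='a] by linarith
  have p1: "1 < p" using p n1 by linarith
  let ?c = "ray_const (real DIM('a)) p"
  have c: "0 < ?c" using n1 p by (rule ray_const_pos)
  obtain U where U: "L-lipschitz_on UNIV U" "\<And>x. x \<in> cball 0 1 \<Longrightarrow> U x = u x"
    "\<And>x. x \<in> ball 0 1 \<Longrightarrow> grad u x = grad U x" by (rule lipschitz_extend_unit_ball[OF u(1)]) blast
  have cU: "continuous_on A U" for A using lipschitz_on_continuous_on[OF U(1)] continuous_on_subset by blast
  have cu: "continuous_on (cball 0 1) u" using lipschitz_on_continuous_on[OF u(1)] by simp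
  have [measurable]: "U \<in> borel_measurable borel" by (intro borel_measurable_continuous_onI cU)
  obtain x where x: "x \<in> cball 0 1" "\<And>y. y \<in> cball 0 1 \<Longrightarrow> norm (u y) \<le> norm (u x)"
  proof -
    have "continuous_on (cball 0 1) (\<lambda>x. norm (u x))" by (intro continuous_intros cu)
    then have "\<exists>x\<in>cball 0 1. \<forall>y\<in>cball 0 1. norm (u y) \<le> norm (u x)"
      by (intro continuous_attains_sup) auto
    then show thesis using that by blast
  qed
  have "1 \<le> norm (u x)"
  proof -
    have "u \<in> borel_measurable (lebesgue_on (ball 0 1))"
      using cu by (intro continuous_imp_measurable_on_sets_lebesgue continuous_on_subset[OF cu]) auto
    then have "Lnorm top (ball 0 1) u \<le> ennreal (norm (u x))" using x(2) by (intro Lnorm_top_le) auto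
    then show ?thesis using u(2) by simp
  qed
  then have Ux: "1 \<le> \<bar>U x\<bar>" using U(2)[OF x(1)] by simp
  have U0: "U 0 = 0" using U(2)[of 0] u(3) by simp
  define B where "B = ball 0 1 \<inter> ball x \<epsilon>"
  have BB: "B \<in> sets borel" by (simp add: B_def)
  let ?E = "\<integral>\<^sup>+x. ennreal (norm (grad U x) powr p) * indicator (ball 0 1) x \<partial>lborel"
  \<comment> \<open>The centre is pulled from \<open>x\<close> towards the origin by at most
    \<open>\<epsilon> / 2\<close>, so a ball of radius \<open>\<epsilon> / 2\<close> fits into
    \<open>B\<close> even when \<open>x\<close> is on the sphere; the volume bound is independent of
    \<open>x\<close>.\<close>
  have "ball ((1 - \<epsilon> / 2) *\<^sub>R x) (\<epsilon> / 2) \<subseteq> B"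
  proof
    fix z assume "z \<in> ball ((1 - \<epsilon> / 2) *\<^sub>R x) (\<epsilon> / 2)"
    then have z: "norm ((1 - \<epsilon> / 2) *\<^sub>R x - z) < \<epsilon> / 2" by (simp add: dist_norm)
    have nx: "norm x \<le> 1" using x(1) by simp
    have "norm z \<le> norm ((1 - \<epsilon> / 2) *\<^sub>R x) + norm ((1 - \<epsilon> / 2) *\<^sub>R x - z)"
      using norm_triangle_ineq4[of "(1 - \<epsilon> / 2) *\<^sub>R x" "(1 - \<epsilon> / 2) *\<^sub>R x - z"] by simp
    moreover have "norm ((1 - \<epsilon> / 2) *\<^sub>R x) \<le> 1 - \<epsilon> / 2" using nx \<epsilon> by (simp add: mult_left_le)
    moreover have "norm (x - z) \<le> norm ((\<epsilon> / 2) *\<^sub>R x) + norm ((1 - \<epsilon> / 2) *\<^sub>R x - z)"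
      using norm_triangle_ineq[of "(\<epsilon> / 2) *\<^sub>R x" "(1 - \<epsilon> / 2) *\<^sub>R x - z"] by (simp add: algebra_simps)
    moreover have "norm ((\<epsilon> / 2) *\<^sub>R x) \<le> \<epsilon> / 2" using nx \<epsilon> by (simp add: mult_left_le)
    ultimately show "z \<in> B" using z by (simp add: B_def dist_norm)
  qed
  then have "emeasure lborel (ball ((1 - \<epsilon> / 2) *\<^sub>R x) (\<epsilon> / 2)) \<le> emeasure lborel B"
    using BB by (intro emeasure_mono) auto
  moreover have "emeasure lborel (ball ((1 - \<epsilon> / 2) *\<^sub>R x) (\<epsilon> / 2)) = ennreal (measure lborel (ball (0::'a) (\<epsilon> / 2)))"
    using \<epsilon> by (simp add: emeasure_ball content_ball)
  ultimately have "ennreal (measure lborel (ball (0::'a) (\<epsilon> / 2))) \<le> (\<integral>\<^sup>+y. indicator B y \<partial>lborel)"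
    using BB by simp
  also have "\<dots> \<le> (\<integral>\<^sup>+y. ennreal ((1 + \<epsilon>) powr (p - 1)) * (ennreal (\<bar>U y - U 0\<bar> powr p) * indicator (ball 0 1) y)
      + ennreal ((1 + \<epsilon>) powr (p - 1) * \<epsilon> powr (1 - p)) * (ennreal (\<bar>U y - U x\<bar> powr p) * indicator B y) \<partial>lborel)"
  proof (rule nn_integral_mono)
    fix y
    have "1 \<le> \<bar>U x\<bar> powr p" using Ux p1 by (simp add: ge_one_powr_ge_zero)
    also have "\<dots> \<le> (\<bar>U y - U 0\<bar> + \<bar>U y - U x\<bar>) powr p" using U0 p1 by (intro powr_mono2) auto
    also have "\<dots> \<le> (1 + \<epsilon>) powr (p - 1) * (\<bar>U y - U 0\<bar> powr p + \<epsilon> powr (1 - p) * \<bar>U y - U x\<bar> powr p)"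
      using \<epsilon> p1 by (intro powr_add_le) auto
    finally have "1 \<le> (1 + \<epsilon>) powr (p - 1) * \<bar>U y - U 0\<bar> powr p + ((1 + \<epsilon>) powr (p - 1) * \<epsilon> powr (1 - p)) * \<bar>U y - U x\<bar> powr p"
      by (simp add: algebra_simps)
    then have "ennreal 1 \<le> ennreal ((1 + \<epsilon>) powr (p - 1) * \<bar>U y - U 0\<bar> powr p + ((1 + \<epsilon>) powr (p - 1) * \<epsilon> powr (1 - p)) * \<bar>U y - U x\<bar> powr p)"
      by (rule ennreal_leI)
    also have "\<dots> = ennreal ((1 + \<epsilon>) powr (p - 1)) * ennreal (\<bar>U y - U 0\<bar> powr p) + ennreal ((1 + \<epsilon>) powr (p - 1) * \<epsilon> powr (1 - p)) * ennreal (\<bar>U y - U x\<bar> powr p)"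
      by (subst ennreal_plus) (auto simp only: ennreal_mult powr_ge_zero mult_nonneg_nonneg)
    finally have "1 \<le> ennreal ((1 + \<epsilon>) powr (p - 1)) * ennreal (\<bar>U y - U 0\<bar> powr p) + ennreal ((1 + \<epsilon>) powr (p - 1) * \<epsilon> powr (1 - p)) * ennreal (\<bar>U y - U x\<bar> powr p)"
      by simp
    then show "indicator B y \<le> ennreal ((1 + \<epsilon>) powr (p - 1)) * (ennreal (\<bar>U y - U 0\<bar> powr p) * indicator (ball 0 1) y)
      + ennreal ((1 + \<epsilon>) powr (p - 1) * \<epsilon> powr (1 - p)) * (ennreal (\<bar>U y - U x\<bar> powr p) * indicator B y)"
      by (cases "y \<in> B") (auto simp: B_def)
  qed
  also have "\<dots> = ennreal ((1 + \<epsilon>) powr (p - 1)) * (\<integral>\<^sup>+y. ennreal (\<bar>U y - U 0\<bar> powr p) * indicator (ball 0 1) y \<partial>lborel)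
      + ennreal ((1 + \<epsilon>) powr (p - 1) * \<epsilon> powr (1 - p)) * (\<integral>\<^sup>+y. ennreal (\<bar>U y - U x\<bar> powr p) * indicator B y \<partial>lborel)"
  proof -
    have [measurable]: "B \<in> sets borel" "ball (0 :: 'a) 1 \<in> sets borel" by (auto simp: BB)
    have add: "(\<integral>\<^sup>+y. ennreal a * f y + ennreal b * g y \<partial>lborel) = ennreal a * (\<integral>\<^sup>+y. f y \<partial>lborel) + ennreal b * (\<integral>\<^sup>+y. g y \<partial>lborel)"
      if [measurable]: "f \<in> borel_measurable borel" "g \<in> borel_measurable borel" for a b and f g :: "'a \<Rightarrow> ennreal"
      by (simp add: nn_integral_add nn_integral_cmult)
    show ?thesis by (rule add; measurable)
  qed
  also have "\<dots> \<le> ennreal ((1 + \<epsilon>) powr (p - 1)) * (ennreal (1 powr p / ?c) * ?E)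
      + ennreal ((1 + \<epsilon>) powr (p - 1) * \<epsilon> powr (1 - p)) * (ennreal (\<epsilon> powr p / ?c) * ?E)"
  proof (intro add_mono mult_left_mono)
    show "(\<integral>\<^sup>+y. ennreal (\<bar>U y - U 0\<bar> powr p) * indicator (ball 0 1) y \<partial>lborel) \<le> ennreal (1 powr p / ?c) * ?E"
    by (rule star_shaped_poincare[OF U(1) _ unit_ball_star _ _ p]) auto
    have "(\<integral>\<^sup>+y. ennreal (\<bar>U y - U x\<bar> powr p) * indicator B y \<partial>lborel)
        \<le> ennreal (\<epsilon> powr p / ?c) * (\<integral>\<^sup>+x. ennreal (norm (grad U x) powr p) * indicator B x \<partial>lborel)"
    proof (rule star_shaped_poincare[OF U(1) BB _ _ _ p])
      fix y and t :: real assume y: "y \<in> B" and t: "0 < t" "t \<le> 1"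
      have "norm (x + t *\<^sub>R (y - x)) = norm ((1 - t) *\<^sub>R x + t *\<^sub>R y)" by (simp add: algebra_simps)
      also have "\<dots> \<le> (1 - t) * norm x + t * norm y" using t norm_triangle_ineq[of "(1 - t) *\<^sub>R x" "t *\<^sub>R y"] by simp
      also have "\<dots> < (1 - t) * 1 + t * 1"
        using t y x(1) by (intro add_le_less_mono mult_left_mono mult_strict_left_mono) (auto simp: B_def)
      finally have "norm (x + t *\<^sub>R (y - x)) < 1" by simp
      moreover have "t * norm (y - x) < \<epsilon>"
        using t y mult_left_le_one_le[of "norm (y - x)" t] by (auto simp: B_def dist_norm norm_minus_commute)
      moreover have "dist x (x + t *\<^sub>R (y - x)) = t * norm (y - x)" using t by (simp add: dist_norm)
      ultimately show "x + t *\<^sub>R (y - x) \<in> B" by (simp add: B_def)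
    qed (use \<epsilon> in \<open>auto simp: B_def\<close>)
    also have "\<dots> \<le> ennreal (\<epsilon> powr p / ?c) * ?E"
      by (intro mult_left_mono nn_integral_mono) (auto simp: B_def split: split_indicator)
    finally show "(\<integral>\<^sup>+y. ennreal (\<bar>U y - U x\<bar> powr p) * indicator B y \<partial>lborel) \<le> ennreal (\<epsilon> powr p / ?c) * ?E" .
  qed auto
  also have "\<dots> = ennreal ((1 + \<epsilon>) powr p / ?c) * ?E"
  proof -
    have e1: "(1 + \<epsilon>) powr (p - 1) * (1 powr p / ?c) + (1 + \<epsilon>) powr (p - 1) * \<epsilon> powr (1 - p) * (\<epsilon> powr p / ?c) = (1 + \<epsilon>) powr p / ?c"
    proof -
      have "\<epsilon> powr (1 - p) * \<epsilon> powr p = \<epsilon>" using \<epsilon> by (simp add: powr_add[symmetric])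
      moreover have "X * Y * (Z / ?c) = X * (Y * Z) / ?c" for X Y Z by simp
      ultimately have "(1 + \<epsilon>) powr (p - 1) * \<epsilon> powr (1 - p) * (\<epsilon> powr p / ?c) = (1 + \<epsilon>) powr (p - 1) * \<epsilon> / ?c"
        by (simp only:)
      moreover have "X * (1 powr p / ?c) + X * \<epsilon> / ?c = X * (1 + \<epsilon>) / ?c" for X
        by (simp add: add_divide_distrib[symmetric] distrib_left)
      moreover have "(1 + \<epsilon>) powr (p - 1) * (1 + \<epsilon>) = (1 + \<epsilon>) powr p"
        using powr_mult_base[of "1 + \<epsilon>" "p - 1"] \<epsilon> by (simp add: mult.commute)
      ultimately show ?thesis by (simp only:)
    qed
    have comb: "ennreal a * (ennreal a' * E) + ennreal b * (ennreal b' * E) = ennreal (a * a' + b * b') * E"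
      if "0 \<le> a" "0 \<le> a'" "0 \<le> b" "0 \<le> b'" for a a' b b' :: real and E :: ennreal
    proof -
      have "ennreal (a * a' + b * b') = ennreal a * ennreal a' + ennreal b * ennreal b'"
        using that by (simp add: ennreal_mult)
      then show ?thesis by (simp only: distrib_right mult.assoc)
    qed
    show ?thesis
      unfolding e1[symmetric] using c by (intro comb) auto
  qed
  also have "?E = (\<integral>\<^sup>+x. ennreal (norm (grad u x) powr p) \<partial>lebesgue_on (ball 0 1))"
    using U(3) by (auto simp: nn_integral_lebesgue_on_borel intro!: nn_integral_cong split: split_indicator)
  finally have "ennreal (?c / (1 + \<epsilon>) powr p) * ennreal (measure lborel (ball (0::'a) (\<epsilon> / 2)))
    \<le> ennreal (?c / (1 + \<epsilon>) powr p) * (ennreal ((1 + \<epsilon>) powr p / ?c) * (\<integral>\<^sup>+x. ennreal (norm (grad u x) powr p) \<partial>lebesgue_on (ball 0 1)))"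
    by (intro mult_left_mono) auto
  also have "\<dots> = (\<integral>\<^sup>+x. ennreal (norm (grad u x) powr p) \<partial>lebesgue_on (ball 0 1))"
    using c \<epsilon> by (simp add: mult.assoc[symmetric] ennreal_mult[symmetric])
  finally show "ennreal (measure lborel (ball (0::'a) (\<epsilon> / 2)) * ?c / (1 + \<epsilon>) powr p)
      \<le> (\<integral>\<^sup>+x. ennreal (norm (grad u x) powr p) \<partial>lebesgue_on (ball 0 1))"
    using c by (simp add: ennreal_mult[symmetric] mult.commute)
qed

section \<open>Upper bounds for the punctured constants\<close>

text \<open>The competitor is \<open>v / m\<close>. That \<open>grad\<close> scales along is known
  only where \<open>v\<close> is differentiable, hence \<open>diff\<close>; the origin is a null set
  and is exempted because radial trial functions have a conical point there.\<close>

lemma punctured_const_mult_le: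
  fixes v :: "'a::euclidean_space \<Rightarrow> real"
  assumes lip: "L-lipschitz_on (closure (ball 0 1)) v" and v0: "v 0 = 0"
    and diff: "\<And>x. x \<in> ball 0 1 \<Longrightarrow> x \<noteq> 0 \<Longrightarrow> \<exists>g. GDERIV v x :> g"
    and q: "q = top \<or> 0 < enn2real q" and m: "Lnorm q (ball 0 1) v = ennreal m" "0 < m"
  shows "punctured_const p q (ball (0::'a) 1) 0 * ennreal (m powr p)
    \<le> (\<integral>\<^sup>+x. ennreal (norm (grad v x) powr p) * indicator (ball 0 1) x \<partial>lborel)"
proof -
  define u where "u x = (1 / m) * v x" for x
  have "(\<bar>1 / m\<bar> * L)-lipschitz_on (closure (ball 0 1)) u"
    unfolding u_def by (rule lipschitz_on_cmult_real[OF lip])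
  moreover have "v \<in> borel_measurable (lebesgue_on (ball 0 1))"
    using lipschitz_on_continuous_on[OF lip]
    by (intro continuous_imp_measurable_on_sets_lebesgue) (auto intro: continuous_on_subset)
  then have "Lnorm q (ball 0 1) u = 1"
    unfolding u_def using m q by (subst Lnorm_cmult) (auto simp: ennreal_mult[symmetric])
  ultimately have "punctured_const p q (ball (0::'a) 1) 0
      \<le> (\<integral>\<^sup>+x. ennreal (norm (grad u x) powr p) \<partial>lebesgue_on (ball 0 1))"
    unfolding punctured_const_def by (intro INF_lower) (auto simp: u_def v0)
  also have "\<dots> = (\<integral>\<^sup>+x. ennreal ((1 / m) powr p) * (ennreal (norm (grad v x) powr p) * indicator (ball 0 1) x) \<partial>lborel)"
    unfolding nn_integral_lebesgue_on_borel[OF borel_open[OF open_ball]]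
  proof (rule nn_integral_cong_AE, rule eventually_mono[OF AE_lborel_singleton[of 0]])
    fix x :: 'a assume "x \<noteq> 0"
    have "norm (grad u x) powr p = (1 / m) powr p * norm (grad v x) powr p" if x: "x \<in> ball 0 1"
    proof -
      obtain g where g: "GDERIV v x :> g" using diff[OF x \<open>x \<noteq> 0\<close>] by blast
      have "GDERIV u x :> (1 / m) *\<^sub>R g"
        using GDERIV_mult[OF GDERIV_const[of "1 / m" x] g] by (simp add: u_def[abs_def])
      then have "grad u x = (1 / m) *\<^sub>R grad v x" using grad_eq g by metis
      then show ?thesis using m(2) by (simp add: powr_mult powr_divide)
    qed
    then show "ennreal (norm (grad u x) powr p) * indicator (ball 0 1) x
        = ennreal ((1 / m) powr p) * (ennreal (norm (grad v x) powr p) * indicator (ball 0 1) x)"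
      by (auto simp: ennreal_mult split: split_indicator)
  qed
  finally have le: "punctured_const p q (ball (0::'a) 1) 0
    \<le> (\<integral>\<^sup>+x. ennreal ((1 / m) powr p) * (ennreal (norm (grad v x) powr p) * indicator (ball 0 1) x) \<partial>lborel)" .
  \<comment> \<open>A Borel gradient of an extension replaces \<open>grad v\<close>, so that the
    constant can be taken out of the integral.\<close>
  obtain V where V: "L-lipschitz_on UNIV V" "\<And>x. x \<in> ball 0 1 \<Longrightarrow> grad v x = grad V x"
    using lipschitz_extend_unit_ball[OF lip] by metis
  obtain G where G[measurable]: "G \<in> borel_measurable borel" and GD: "AE x in lborel. GDERIV V x :> G x"
    using lipschitz_gradient[OF V(1)] by blast
  let ?G = "\<lambda>x. ennreal (norm (G x) powr p) * indicator (ball 0 1) x"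
  have vG: "AE x in lborel. ennreal (norm (grad v x) powr p) * indicator (ball 0 1) x = ?G x"
    using GD by (rule eventually_mono) (auto simp: V(2) grad_eq split: split_indicator)
  have [measurable]: "ball (0 :: 'a) 1 \<in> sets borel" by auto
  have "(\<integral>\<^sup>+x. ennreal ((1 / m) powr p) * (ennreal (norm (grad v x) powr p) * indicator (ball 0 1) x) \<partial>lborel)
      = (\<integral>\<^sup>+x. ennreal ((1 / m) powr p) * ?G x \<partial>lborel)"
    using vG by (intro nn_integral_cong_AE) (auto elim!: eventually_mono)
  also have "\<dots> = ennreal ((1 / m) powr p) * (\<integral>\<^sup>+x. ?G x \<partial>lborel)"
    by (rule nn_integral_cmult) measurable
  also have "(\<integral>\<^sup>+x. ?G x \<partial>lborel) = (\<integral>\<^sup>+x. ennreal (norm (grad v x) powr p) * indicator (ball 0 1) x \<partial>lborel)"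
    using vG by (intro nn_integral_cong_AE) (auto elim!: eventually_mono)
  finally have "punctured_const p q (ball (0::'a) 1) 0 * ennreal (m powr p)
    \<le> (ennreal ((1 / m) powr p) * (\<integral>\<^sup>+x. ennreal (norm (grad v x) powr p) * indicator (ball 0 1) x \<partial>lborel)) * ennreal (m powr p)"
    using le by (intro mult_right_mono) auto
  also have "\<dots> = (ennreal ((1 / m) powr p) * ennreal (m powr p)) * (\<integral>\<^sup>+x. ennreal (norm (grad v x) powr p) * indicator (ball 0 1) x \<partial>lborel)"
    by (simp only: mult_ac)
  also have "ennreal ((1 / m) powr p) * ennreal (m powr p) = 1"
    using m(2) by (simp add: ennreal_mult[symmetric] powr_mult[symmetric])
  finally show ?thesis by simp
qed

text \<open>In polar coordinates the integral is \<open>W / a\<close> with \<open>W\<close>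
  independent of \<open>a\<close>. For \<open>a = N\<close> the integrand is 1 almost everywhere,
  which identifies \<open>W\<close> as \<open>N\<close> times the volume of the ball, the area of
  the unit sphere.\<close>

lemma nn_integral_norm_powr_unit_ball:
  fixes a :: real
  assumes a: "0 < a"
  shows "(\<integral>\<^sup>+x. ennreal (norm x powr (a - real DIM('a))) * indicator (ball (0::'a::euclidean_space) 1) x \<partial>lborel)
    = ennreal (real DIM('a) * measure lborel (ball (0::'a) 1) / a)"
proof -
  let ?n = "DIM('a)"
  have [measurable]: "ball (0::'a) 1 \<in> sets borel" "(shell :: 'a set) \<in> sets borel" by auto
  define W where "W = ennreal (1 / ln 2) * (\<integral>\<^sup>+x. ennreal (norm x powr - real ?n) * indicator (shell :: 'a set) x \<partial>lborel)"
  have main: "(\<integral>\<^sup>+x. ennreal (norm x powr (a - real ?n)) * indicator (ball (0::'a) 1) x \<partial>lborel) = ennreal (1 / a) * W"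
    if a: "0 < a" for a
  proof -
    have inner: "(\<integral>\<^sup>+t. ennreal (norm (0 + t *\<^sub>R x) powr (a - real ?n)) * indicator (ball 0 1) (0 + t *\<^sub>R x) * ennreal (t ^ (?n - 1)) * indicator {0<..} t \<partial>lborel)
        = ennreal (1 / a) * ennreal (norm x powr - real ?n)" if x: "x \<in> shell" for x :: 'a
    proof -
      have nx: "0 < norm x" using x by auto
      have "(\<integral>\<^sup>+t. ennreal (norm (0 + t *\<^sub>R x) powr (a - real ?n)) * indicator (ball 0 1) (0 + t *\<^sub>R x) * ennreal (t ^ (?n - 1)) * indicator {0<..} t \<partial>lborel)
        = (\<integral>\<^sup>+t. ennreal (norm x powr (a - real ?n)) * (ennreal (t powr (a - 1)) * indicator {0<..1 / norm x} t) \<partial>lborel)"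
      proof (rule nn_integral_cong_AE, rule eventually_mono[OF AE_lborel_singleton[of "1 / norm x"]])
        fix t :: real assume t: "t \<noteq> 1 / norm x"
        show "ennreal (norm (0 + t *\<^sub>R x) powr (a - real ?n)) * indicator (ball 0 1) (0 + t *\<^sub>R x) * ennreal (t ^ (?n - 1)) * indicator {0<..} t
            = ennreal (norm x powr (a - real ?n)) * (ennreal (t powr (a - 1)) * indicator {0<..1 / norm x} t)"
        proof (cases "0 < t")
          case True
          have "t powr (a - real ?n) * t ^ (?n - 1) = t powr (a - 1)"
            using True by (simp add: powr_realpow[symmetric] powr_add[symmetric] of_nat_diff)
          then have "norm (t *\<^sub>R x) powr (a - real ?n) * t ^ (?n - 1) = norm x powr (a - real ?n) * t powr (a - 1)"
            using True nx by (simp add: powr_mult mult_ac)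
          moreover have "t *\<^sub>R x \<in> ball 0 1 \<longleftrightarrow> t \<in> {0<..1 / norm x}"
            using True nx t by (auto simp: field_simps)
          ultimately show ?thesis using True by (auto simp: ennreal_mult[symmetric] split: split_indicator)
        qed auto
      qed
      also have "\<dots> = ennreal (norm x powr (a - real ?n)) * ennreal ((1 / norm x) powr a / a)"
        using a by (subst nn_integral_cmult) (auto simp: nn_integral_powr_from_0)
      also have "\<dots> = ennreal (1 / a) * ennreal (norm x powr - real ?n)"
      proof -
        have "norm x powr (a - real ?n) * ((1 / norm x) powr a / a) = 1 / a * norm x powr - real ?n"
          using nx by (simp add: powr_diff powr_divide powr_minus_divide)
        then show ?thesis using a by (simp add: ennreal_mult[symmetric])
      qed
      finally show ?thesis .
    qed
    have "(\<integral>\<^sup>+x. ennreal (norm x powr (a - real ?n)) * indicator (ball (0::'a) 1) x \<partial>lborel)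
      = ennreal (1 / ln 2) * (\<integral>\<^sup>+x. (\<integral>\<^sup>+t. ennreal (norm (0 + t *\<^sub>R x) powr (a - real ?n)) * indicator (ball 0 1) (0 + t *\<^sub>R x) * ennreal (t ^ (?n - 1)) * indicator {0<..} t \<partial>lborel) * indicator (shell :: 'a set) x \<partial>lborel)"
      by (rule nn_integral_polar) measurable
    also have "\<dots> = ennreal (1 / ln 2) * (\<integral>\<^sup>+x. ennreal (1 / a) * (ennreal (norm x powr - real ?n) * indicator (shell :: 'a set) x) \<partial>lborel)"
      by (intro arg_cong[where f="\<lambda>z. ennreal (1 / ln 2) * z"] nn_integral_cong)
         (metis (no_types, lifting) inner indicator_simps mult.assoc mult_zero_right)
    also have "\<dots> = ennreal (1 / ln 2) * (ennreal (1 / a) * (\<integral>\<^sup>+x. ennreal (norm x powr - real ?n) * indicator (shell :: 'a set) x \<partial>lborel))"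
      by (intro arg_cong[where f="\<lambda>z. ennreal (1 / ln 2) * z"] nn_integral_cmult) measurable
    also have "\<dots> = ennreal (1 / a) * W" unfolding W_def by (simp only: mult_ac)
    finally show ?thesis .
  qed
  have n: "0 < real ?n" by simp
  have vol: "emeasure lborel (ball (0::'a) 1) = ennreal (measure lborel (ball (0::'a) 1))"
    by (simp add: emeasure_ball content_ball)
  have "ennreal (measure lborel (ball (0::'a) 1)) = (\<integral>\<^sup>+x. ennreal (norm x powr (real ?n - real ?n)) * indicator (ball (0::'a) 1) x \<partial>lborel)"
  proof -
    have "(\<integral>\<^sup>+x. ennreal (norm x powr (real ?n - real ?n)) * indicator (ball (0::'a) 1) x \<partial>lborel) = (\<integral>\<^sup>+x. indicator (ball (0::'a) 1) x \<partial>lborel)"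
      by (intro nn_integral_cong_AE eventually_mono[OF AE_lborel_singleton[of 0]]) (auto split: split_indicator)
    then show ?thesis using vol by simp
  qed
  also have "\<dots> = ennreal (1 / real ?n) * W" by (rule main[OF n])
  finally have "ennreal (real ?n) * ennreal (measure lborel (ball (0::'a) 1)) = (ennreal (real ?n) * ennreal (1 / real ?n)) * W"
    by (simp only: mult.assoc)
  then have W: "W = ennreal (real ?n * measure lborel (ball (0::'a) 1))"
    using n by (simp add: ennreal_mult[symmetric] del: ennreal_of_nat_eq_real_of_nat)
  show ?thesis unfolding main[OF a] W using a by (simp add: ennreal_mult[symmetric])
qed

text \<open>The shift by \<open>\<delta>\<close> removes the infinite slope of
  \<open>norm x powr \<alpha>\<close> at 0 for \<open>\<alpha> < 1\<close>, and the subtracted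
  constant restores the value 0 there. For \<open>\<alpha> = (p - N) / (p - 1)\<close> the unshifted
  power is, up to a factor, the fundamental solution of the p-Laplacian.\<close>

definition trial :: "real \<Rightarrow> real \<Rightarrow> 'a::euclidean_space \<Rightarrow> real" where
  "trial \<alpha> \<delta> x = (norm x + \<delta>) powr \<alpha> - \<delta> powr \<alpha>"

lemma trial_nonneg: "0 < \<delta> \<Longrightarrow> 0 < \<alpha> \<Longrightarrow> 0 \<le> trial \<alpha> \<delta> x"
  by (simp add: trial_def powr_mono2)

lemma trial_GDERIV:
  assumes "0 < \<delta>" "x \<noteq> 0"
  shows "GDERIV (trial \<alpha> \<delta>) x :> (\<alpha> * (norm x + \<delta>) powr (\<alpha> - 1)) *\<^sub>R sgn x"
proof -
  have "((\<lambda>r. (r + \<delta>) powr \<alpha> - \<delta> powr \<alpha>) has_real_derivative \<alpha> * (norm x + \<delta>) powr (\<alpha> - 1)) (at (norm x))"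
    using assms by (auto intro!: derivative_eq_intros simp: add_nonneg_pos)
  from GDERIV_DERIV_compose[OF GDERIV_norm[OF assms(2)] this] show ?thesis
    by (simp add: trial_def[abs_def])
qed

lemma trial_lipschitz:
  assumes \<delta>: "0 < \<delta>" and \<alpha>: "0 < \<alpha>" "\<alpha> \<le> 1"
  shows "(\<alpha> * \<delta> powr (\<alpha> - 1))-lipschitz_on A (trial \<alpha> \<delta> :: 'a::euclidean_space \<Rightarrow> real)"
proof (rule lipschitz_onI)
  fix x y :: 'a
  let ?g = "\<lambda>r. (r + \<delta>) powr \<alpha> - \<delta> powr \<alpha>"
  have "norm (?g (norm x) - ?g (norm y)) \<le> (\<alpha> * \<delta> powr (\<alpha> - 1)) * norm (norm x - norm y)"
  proof (rule field_differentiable_bound[where S="{0..}" and f'="\<lambda>r. \<alpha> * (r + \<delta>) powr (\<alpha> - 1)"])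
    fix r :: real assume "r \<in> {0..}"
    then show "(?g has_real_derivative \<alpha> * (r + \<delta>) powr (\<alpha> - 1)) (at r within {0..})"
      using \<delta> by (auto intro!: derivative_eq_intros simp: add_nonneg_pos)
    show "norm (\<alpha> * (r + \<delta>) powr (\<alpha> - 1)) \<le> \<alpha> * \<delta> powr (\<alpha> - 1)"
      using \<open>r \<in> {0..}\<close> \<delta> \<alpha> by (auto simp: abs_mult intro!: powr_mono2')
  qed auto
  also have "\<dots> \<le> (\<alpha> * \<delta> powr (\<alpha> - 1)) * dist x y"
    using \<alpha> norm_triangle_ineq3[of x y] by (intro mult_left_mono) (auto simp: dist_norm)
  finally show "dist (trial \<alpha> \<delta> x) (trial \<alpha> \<delta> y) \<le> \<alpha> * \<delta> powr (\<alpha> - 1) * dist x y"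
    by (simp add: trial_def dist_real_def)
qed (use \<alpha> in auto)

lemma ray_exponent_bounds:
  fixes n p :: real
  assumes "1 \<le> n" "n < p"
  shows "0 < (p - n) / (p - 1)" "(p - n) / (p - 1) \<le> 1"
  using assms by auto

text \<open>Since \<open>\<alpha> - 1 \<le> 0\<close>, dropping \<open>\<delta>\<close> only
  enlarges the gradient, and the bound is uniform in \<open>\<delta>\<close>. For this
  \<open>\<alpha>\<close>, \<open>(\<alpha> - 1) * p = \<alpha> - N\<close>, so the remaining
  integral is that of \<open>nn_integral_norm_powr_unit_ball\<close> with
  \<open>a = \<alpha>\<close>.\<close>

lemma trial_energy:
  assumes p: "real DIM('a::euclidean_space) < p" and \<delta>: "0 < \<delta>"
    and \<alpha>: "\<alpha> = (p - real DIM('a)) / (p - 1)"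
  shows "(\<integral>\<^sup>+x. ennreal (norm (grad (trial \<alpha> \<delta>) x) powr p) * indicator (ball (0::'a) 1) x \<partial>lborel)
    \<le> ennreal (real DIM('a) * measure lborel (ball (0::'a) 1) * \<alpha> powr (p - 1))"
proof -
  let ?n = "real DIM('a)"
  have n1: "1 \<le> ?n" using DIM_positive[where 'a='a] by linarith
  have p1: "1 < p" using p n1 by linarith
  have a: "0 < \<alpha>" "\<alpha> \<le> 1" unfolding \<alpha> by (rule ray_exponent_bounds[OF n1 p])+
  have e: "(\<alpha> - 1) * p = \<alpha> - ?n" using p1 by (simp add: \<alpha> field_simps)
  have [measurable]: "ball (0::'a) 1 \<in> sets borel" by auto
  have "(\<integral>\<^sup>+x. ennreal (norm (grad (trial \<alpha> \<delta>) x) powr p) * indicator (ball (0::'a) 1) x \<partial>lborel)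
    \<le> (\<integral>\<^sup>+x. ennreal (\<alpha> powr p) * (ennreal (norm x powr (\<alpha> - ?n)) * indicator (ball (0::'a) 1) x) \<partial>lborel)"
  proof (rule nn_integral_mono_AE, rule eventually_mono[OF AE_lborel_singleton[of 0]])
    fix x :: 'a assume x: "x \<noteq> 0"
    have "norm (grad (trial \<alpha> \<delta>) x) = \<alpha> * (norm x + \<delta>) powr (\<alpha> - 1)"
      using grad_eq[OF trial_GDERIV[OF \<delta> x]] x a by (simp add: norm_sgn)
    also have "\<dots> \<le> \<alpha> * norm x powr (\<alpha> - 1)" using a x \<delta> by (intro mult_left_mono powr_mono2') auto
    finally have "norm (grad (trial \<alpha> \<delta>) x) powr p \<le> (\<alpha> * norm x powr (\<alpha> - 1)) powr p"
      using p1 by (intro powr_mono2) auto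
    also have "\<dots> = \<alpha> powr p * norm x powr (\<alpha> - ?n)" using a by (simp add: powr_mult powr_powr e)
    finally show "ennreal (norm (grad (trial \<alpha> \<delta>) x) powr p) * indicator (ball (0::'a) 1) x
       \<le> ennreal (\<alpha> powr p) * (ennreal (norm x powr (\<alpha> - ?n)) * indicator (ball (0::'a) 1) x)"
      by (auto simp: ennreal_mult[symmetric] ennreal_leI split: split_indicator)
  qed
  also have "\<dots> = ennreal (\<alpha> powr p) * ennreal (?n * measure lborel (ball (0::'a) 1) / \<alpha>)"
    using nn_integral_norm_powr_unit_ball[OF a(1), where 'a='a] by (subst nn_integral_cmult) auto
  also have "\<dots> = ennreal (?n * measure lborel (ball (0::'a) 1) * \<alpha> powr (p - 1))"
    using a n1 by (simp add: ennreal_mult[symmetric] powr_diff)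
  finally show ?thesis .
qed

text \<open>With \<open>c\<close> the area of the sphere, the trial energy is at most
  \<open>c \<alpha>^(p-1)\<close>, while by Fatou the p-th powers have lower limit at least
  \<open>c / (\<alpha> p + N)\<close>. As \<open>\<alpha> \<le> 1\<close> and \<open>N < p\<close>,
  this strictly exceeds \<open>c / (2 p)\<close>, so a single \<open>k\<close> already beats that
  value; the quotient of the two bounds is \<open>2 p \<alpha>^(p-1)\<close>.\<close>

lemma punctured_const_le_ray_const:
  assumes p: "real DIM('a::euclidean_space) < p"
  shows "punctured_const p (ennreal p) (ball (0::'a) 1) 0 \<le> ennreal (2 * ray_const (real DIM('a)) p)"
proof -
  let ?n = "real DIM('a)"
  let ?\<Lambda> = "punctured_const p (ennreal p) (ball (0::'a) 1) 0"
  define \<alpha> where "\<alpha> = (p - ?n) / (p - 1)"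
  define c where "c = ?n * measure lborel (ball (0::'a) 1)"
  have n1: "1 \<le> ?n" using DIM_positive[where 'a='a] by linarith
  have p1: "1 < p" using p n1 by linarith
  have a: "0 < \<alpha>" "\<alpha> \<le> 1" unfolding \<alpha>_def by (rule ray_exponent_bounds[OF n1 p])+
  have c: "0 < c" using n1 content_ball_pos[of 1 "0::'a"] by (simp add: c_def)
  have [measurable]: "ball (0::'a) 1 \<in> sets borel" by auto
  define d where "d k = 1 / real (Suc k)" for k
  have d: "0 < d k" for k by (simp add: d_def)
  have d0: "d \<longlonglongrightarrow> 0" unfolding d_def using LIMSEQ_inverse_real_of_nat by (simp add: inverse_eq_divide)
  have [measurable]: "(trial \<alpha> (d k) :: 'a \<Rightarrow> real) \<in> borel_measurable borel" for k
    unfolding trial_def by measurable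
  let ?I = "\<lambda>k. \<integral>\<^sup>+x. ennreal (trial \<alpha> (d k) x powr p) * indicator (ball (0::'a) 1) x \<partial>lborel"
  have "ennreal (c / (\<alpha> * p + ?n)) = (\<integral>\<^sup>+x. ennreal (norm x powr (\<alpha> * p + ?n - ?n)) * indicator (ball (0::'a) 1) x \<partial>lborel)"
    unfolding c_def using a p1 by (subst nn_integral_norm_powr_unit_ball) (auto intro: add_pos_nonneg)
  also have "\<dots> = (\<integral>\<^sup>+x. liminf (\<lambda>k. ennreal (trial \<alpha> (d k) x powr p) * indicator (ball (0::'a) 1) x) \<partial>lborel)"
  proof (rule nn_integral_cong)
    fix x :: 'a
    have "(\<lambda>k. trial \<alpha> (d k) x) \<longlonglongrightarrow> (norm x + 0) powr \<alpha> - 0 powr \<alpha>"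
      unfolding trial_def using a d by (intro tendsto_intros tendsto_powr' d0) (auto intro!: always_eventually less_imp_le)
    then have "(\<lambda>k. trial \<alpha> (d k) x powr p) \<longlonglongrightarrow> (norm x powr \<alpha>) powr p"
      using p1 a d trial_nonneg[OF d a(1)] by (intro tendsto_powr') (auto intro!: always_eventually)
    then have "(\<lambda>k. ennreal (trial \<alpha> (d k) x powr p) * indicator (ball (0::'a) 1) x) \<longlonglongrightarrow> ennreal (norm x powr (\<alpha> * p + ?n - ?n)) * indicator (ball (0::'a) 1) x"
      by (cases "x \<in> ball 0 1") (auto simp: powr_powr intro: tendsto_ennrealI)
    then show "ennreal (norm x powr (\<alpha> * p + ?n - ?n)) * indicator (ball (0::'a) 1) x = liminf (\<lambda>k. ennreal (trial \<alpha> (d k) x powr p) * indicator (ball (0::'a) 1) x)"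
      by (intro lim_imp_Liminf[symmetric]) auto
  qed
  also have "\<dots> \<le> liminf ?I" by (rule nn_integral_liminf) measurable
  finally have le: "ennreal (c / (\<alpha> * p + ?n)) \<le> liminf ?I" .
  have "ennreal (c / (2 * p)) < ennreal (c / (\<alpha> * p + ?n))"
  proof -
    have "\<alpha> * p \<le> 1 * p" using a p1 by (intro mult_right_mono) auto
    then have "\<alpha> * p + ?n < 2 * p" using p by linarith
    moreover have "0 < \<alpha> * p + ?n" using a p1 n1 by (intro add_pos_nonneg) auto
    ultimately show ?thesis using c p1 by (intro ennreal_lessI divide_strict_left_mono) auto
  qed
  then have "ennreal (c / (2 * p)) < liminf ?I" using le by (rule less_le_trans)
  then have "\<forall>\<^sub>F k in sequentially. ennreal (c / (2 * p)) < ?I k" by (rule less_LiminfD)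
  then obtain k where k: "ennreal (c / (2 * p)) < ?I k" by (auto simp: eventually_sequentially)
  have fin: "?I k < top"
  proof -
    have "?I k \<le> (\<integral>\<^sup>+x. ennreal (((1 + d k) powr \<alpha>) powr p) * indicator (ball (0::'a) 1) x \<partial>lborel)"
    proof (intro nn_integral_mono)
      fix x :: 'a
      have "trial \<alpha> (d k) x powr p \<le> ((1 + d k) powr \<alpha>) powr p" if "x \<in> ball 0 1"
      proof (rule powr_mono2)
        have "(norm x + d k) powr \<alpha> \<le> (1 + d k) powr \<alpha>" using that a d[of k] by (intro powr_mono2) auto
        then show "trial \<alpha> (d k) x \<le> (1 + d k) powr \<alpha>" unfolding trial_def by (smt (verit) powr_ge_zero)
      qed (use p1 trial_nonneg[OF d a(1)] in auto)
      then show "ennreal (trial \<alpha> (d k) x powr p) * indicator (ball (0::'a) 1) x \<le> ennreal (((1 + d k) powr \<alpha>) powr p) * indicator (ball (0::'a) 1) x"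
        by (auto intro: ennreal_leI split: split_indicator)
    qed
    also have "\<dots> < top"
      by (subst nn_integral_cmult) (auto simp: emeasure_ball ennreal_mult_less_top)
    finally show ?thesis .
  qed
  then obtain I where I: "?I k = ennreal I" "0 \<le> I" by (cases "?I k") auto
  have I0: "c / (2 * p) < I" using k unfolding I(1) using c p1 I(2) by (simp add: ennreal_less_iff)
  have I1: "0 < I" using I0 c p1 by (smt (verit) divide_pos_pos)
  have "Lnorm (ennreal p) (ball 0 1) (trial \<alpha> (d k) :: 'a \<Rightarrow> real) = ennreal (I powr (1 / p))"
  proof -
    have "(\<integral>\<^sup>+x. ennreal (norm (trial \<alpha> (d k) x) powr p) \<partial>lebesgue_on (ball (0::'a) 1)) = ennreal I"
      unfolding I(1)[symmetric] nn_integral_lebesgue_on_borel[OF borel_open[OF open_ball]]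
      by (intro nn_integral_cong) (simp add: abs_of_nonneg[OF trial_nonneg[OF d a(1)]])
    then show ?thesis using p1 I1 by (simp add: Lnorm_def ennpowr_ennreal)
  qed
  then have "?\<Lambda> * ennreal ((I powr (1 / p)) powr p) \<le> (\<integral>\<^sup>+x. ennreal (norm (grad (trial \<alpha> (d k)) x) powr p) * indicator (ball (0::'a) 1) x \<partial>lborel)"
    using trial_GDERIV[OF d] p1 I1 by (intro punctured_const_mult_le[OF trial_lipschitz[OF d a]]) (auto simp: trial_def)
  also have "\<dots> \<le> ennreal (c * \<alpha> powr (p - 1))" unfolding c_def by (rule trial_energy[OF p d \<alpha>_def])
  finally have "?\<Lambda> * ennreal I \<le> ennreal (c * \<alpha> powr (p - 1))" using p1 I1 by (simp add: powr_powr)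
  then have "?\<Lambda> * ennreal (c / (2 * p)) \<le> ennreal (c * \<alpha> powr (p - 1))"
    using I0 by (meson ennreal_leI less_imp_le mult_left_mono order_trans zero_le)
  then have "(?\<Lambda> * ennreal (c / (2 * p))) * ennreal (2 * p / c) \<le> ennreal (c * \<alpha> powr (p - 1)) * ennreal (2 * p / c)"
    by (rule mult_right_mono) auto
  then show ?thesis
    using c p1 by (simp add: mult_ac ennreal_mult[symmetric] ray_const_def \<alpha>_def)
qed

text \<open>Trial functions increase with \<open>norm x\<close>, so their supremum is the value
  \<open>(1 + \<delta>)^\<alpha> - \<delta>^\<alpha>\<close> on the unit sphere. It tends to 1 with
  \<open>\<delta>\<close> tending to 0, while the energy bound is free of
  \<open>\<delta>\<close>.\<close>

lemma punctured_const_top_upper: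
  assumes p: "real DIM('a::euclidean_space) < p"
  shows "punctured_const p top (ball (0::'a) 1) 0
    \<le> ennreal (real DIM('a) * measure lborel (ball (0::'a) 1) * ((p - real DIM('a)) / (p - 1)) powr (p - 1))"
proof -
  let ?n = "real DIM('a)"
  let ?\<Lambda> = "punctured_const p top (ball (0::'a) 1) 0"
  define \<alpha> where "\<alpha> = (p - ?n) / (p - 1)"
  define c where "c = ?n * measure lborel (ball (0::'a) 1) * \<alpha> powr (p - 1)"
  have n1: "1 \<le> ?n" using DIM_positive[where 'a='a] by linarith
  have p1: "1 < p" using p n1 by linarith
  have a: "0 < \<alpha>" "\<alpha> \<le> 1" unfolding \<alpha>_def by (rule ray_exponent_bounds[OF n1 p])+
  have c: "0 \<le> c" using n1 by (simp add: c_def)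
  define d where "d k = 1 / real (Suc k)" for k
  have d: "0 < d k" for k by (simp add: d_def)
  have d0: "d \<longlonglongrightarrow> 0" unfolding d_def using LIMSEQ_inverse_real_of_nat by (simp add: inverse_eq_divide)
  define m where "m k = (1 + d k) powr \<alpha> - d k powr \<alpha>" for k
  have m0: "0 < m k" for k using a d[of k] by (simp add: m_def powr_less_mono2)
  obtain b :: 'a where b: "b \<in> Basis" using nonempty_Basis by blast
  have Ln: "Lnorm top (ball 0 1) (trial \<alpha> (d k) :: 'a \<Rightarrow> real) = ennreal (m k)" for k
  proof (rule antisym)
    show "Lnorm top (ball 0 1) (trial \<alpha> (d k) :: 'a \<Rightarrow> real) \<le> ennreal (m k)"
    proof (rule Lnorm_top_le)
      show "(trial \<alpha> (d k) :: 'a \<Rightarrow> real) \<in> borel_measurable (lebesgue_on (ball 0 1))"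
        using lipschitz_on_continuous_on[OF trial_lipschitz[OF d a]]
        by (intro continuous_imp_measurable_on_sets_lebesgue) auto
      fix x :: 'a assume "x \<in> ball 0 1"
      then have "(norm x + d k) powr \<alpha> \<le> (1 + d k) powr \<alpha>" using a d[of k] by (intro powr_mono2) auto
      then show "norm (trial \<alpha> (d k) x) \<le> m k"
        using trial_nonneg[OF d a(1), of k x] by (simp add: trial_def m_def)
    qed
    have "ennreal (norm (trial \<alpha> (d k) b)) \<le> Lnorm top (ball 0 1) (trial \<alpha> (d k) :: 'a \<Rightarrow> real)"
      using lipschitz_on_continuous_on[OF trial_lipschitz[OF d a]] b by (intro norm_le_Lnorm_top) auto
    moreover have "norm (trial \<alpha> (d k) b) = m k"
      using b m0[of k] by (simp add: trial_def m_def)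
    ultimately show "ennreal (m k) \<le> Lnorm top (ball 0 1) (trial \<alpha> (d k) :: 'a \<Rightarrow> real)" by simp
  qed
  have le: "?\<Lambda> * ennreal (m k powr p) \<le> ennreal c" for k
  proof -
    have "?\<Lambda> * ennreal (m k powr p) \<le> (\<integral>\<^sup>+x. ennreal (norm (grad (trial \<alpha> (d k)) x) powr p) * indicator (ball (0::'a) 1) x \<partial>lborel)"
      using trial_GDERIV[OF d] Ln m0 by (intro punctured_const_mult_le[OF trial_lipschitz[OF d a]]) (auto simp: trial_def)
    also have "\<dots> \<le> ennreal c" unfolding c_def by (rule trial_energy[OF p d \<alpha>_def])
    finally show ?thesis .
  qed
  \<comment> \<open>One \<open>k\<close> shows that the constant is finite; the limit in
    \<open>k\<close> is then taken in the reals.\<close>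
  have "?\<Lambda> \<noteq> top" using le[of 0] m0[of 0] by (auto simp: ennreal_top_mult top_unique)
  then obtain l where l: "?\<Lambda> = ennreal l" "0 \<le> l" by (cases ?\<Lambda>) auto
  have "l * m k powr p \<le> c" for k
    using le[of k] l c by (simp add: ennreal_mult[symmetric])
  moreover have "(\<lambda>k. l * m k powr p) \<longlonglongrightarrow> l * 1 powr p"
  proof (intro tendsto_intros tendsto_powr)
    have "m \<longlonglongrightarrow> (1 + 0) powr \<alpha> - 0 powr \<alpha>"
      unfolding m_def using a d by (intro tendsto_intros tendsto_powr' d0) (auto intro!: always_eventually less_imp_le)
    then show "m \<longlonglongrightarrow> 1" by simp
  qed auto
  ultimately have "l * 1 powr p \<le> c" by (intro LIMSEQ_le_const2) auto
  then show ?thesis using l by (simp add: c_def \<alpha>_def ennreal_leI)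
qed

section \<open>Voronoi cells and the inradius\<close>

lemma GDERIV_outside_support:
  fixes u :: "'a::euclidean_space \<Rightarrow> real"
  assumes "x \<notin> closure {x. u x \<noteq> 0}"
  shows "GDERIV u x :> 0"
proof -
  have "((\<lambda>x. 0) has_derivative (\<lambda>h. 0)) (at x)" by (rule has_derivative_const)
  then have "(u has_derivative (\<lambda>h. 0)) (at x)"
    by (rule has_derivative_transform_within_open[where s="- closure {x. u x \<noteq> 0}"])
       (use assms closure_subset[of "{x. u x \<noteq> 0}"] in auto)
  then show ?thesis by (simp add: gderiv_def)
qed

text \<open>The gradient is assembled from the partial derivatives, hence continuous; it vanishes
  off the compact support, so it is bounded and \<open>u\<close> is Lipschitz on the whole
  space.\<close>

lemma test_functions_gradient:
  fixes u :: "'a::euclidean_space \<Rightarrow> real"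
  assumes u: "u \<in> test_functions \<Omega>"
  shows "\<And>x. GDERIV u x :> grad u x" "continuous_on UNIV u" "continuous_on UNIV (grad u)"
    "\<exists>L. L-lipschitz_on UNIV u"
proof -
  have cd: "continuously_differentiable k u" for k using u by (simp add: test_functions_def)
  have diff: "u differentiable (at x)" for x using cd[of "Suc 0"] by simp
  have cont: "continuous_on UNIV (\<lambda>x. frechet_derivative u (at x) v)" for v using cd[of "Suc 0"] by simp
  define G where "G x = (\<Sum>i\<in>Basis. frechet_derivative u (at x) i *\<^sub>R i)" for x
  have G: "GDERIV u x :> G x" for x
  proof -
    have d: "(u has_derivative frechet_derivative u (at x)) (at x)" using diff frechet_derivative_works by blast
    then have lin: "linear (frechet_derivative u (at x))" by (rule has_derivative_linear)
    have "frechet_derivative u (at x) h = h \<bullet> G x" for h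
    proof -
      have "frechet_derivative u (at x) h = frechet_derivative u (at x) (\<Sum>i\<in>Basis. (h \<bullet> i) *\<^sub>R i)"
        by (simp add: euclidean_representation)
      also have "\<dots> = (\<Sum>i\<in>Basis. (h \<bullet> i) * frechet_derivative u (at x) i)"
        using lin by (simp add: linear_sum linear_cmul)
      finally show ?thesis by (simp add: G_def inner_sum_right mult.commute)
    qed
    then have "frechet_derivative u (at x) = (\<lambda>h. h \<bullet> G x)" by blast
    then show ?thesis using d by (simp add: gderiv_def)
  qed
  have eq: "grad u x = G x" for x using G by (rule grad_eq)
  then show "\<And>x. GDERIV u x :> grad u x" using G by simp
  have "continuous_on UNIV G" unfolding G_def by (intro continuous_intros cont)
  moreover have "grad u = G" using eq by blast
  ultimately show cg: "continuous_on UNIV (grad u)" by simp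
  show "continuous_on UNIV u"
    using diff by (simp add: continuous_at_imp_continuous_on differentiable_imp_continuous_within)
  let ?S = "closure {x. u x \<noteq> 0}"
  have S: "compact ?S" using u by (simp add: test_functions_def)
  have "compact (grad u ` ?S)" by (intro compact_continuous_image continuous_on_subset[OF cg] S) auto
  then obtain C where C: "0 < C" "\<And>x. x \<in> ?S \<Longrightarrow> norm (grad u x) \<le> C"
    using compact_imp_bounded bounded_pos by (metis imageI)
  have "norm (grad u x) \<le> C" for x
  proof (cases "x \<in> ?S")
    case False
    then show ?thesis using C(1) grad_eq[OF GDERIV_outside_support[OF False]] by simp
  qed (use C in auto)
  then have "norm (h \<bullet> grad u x) \<le> C * norm h" for x h
    using Cauchy_Schwarz_ineq2[of h "grad u x"] mult_left_mono[of "norm (grad u x)" C "norm h"]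
    by (auto simp: mult.commute intro: order_trans)
  then have "C-lipschitz_on UNIV u"
    using G eq C(1)
    by (intro bounded_derivative_imp_lipschitz[where f'="\<lambda>x h. h \<bullet> grad u x"] onorm_le) (auto simp: gderiv_def)
  then show "\<exists>L. L-lipschitz_on UNIV u" by blast
qed

text \<open>The open ball around \<open>x\<close> up to the nearest point of the complement lies in
  \<open>\<Omega>\<close>, so its radius is at most the inradius. The complement is nonempty, as
  otherwise radius \<open>r + 1\<close> would be admissible.\<close>

lemma nearest_outside_le_inradius:
  fixes \<Omega> :: "'a::euclidean_space set"
  assumes "open \<Omega>" "inradius \<Omega> = ennreal r" "0 \<le> r" "x \<in> \<Omega>"
  obtains y where "y \<notin> \<Omega>" "0 < dist x y" "dist x y \<le> r"
proof -
  have in_le: "s \<le> r" if "0 < s" "ball x s \<subseteq> \<Omega>" for s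
  proof -
    have "ennreal s \<le> inradius \<Omega>" unfolding inradius_def using that by (intro Sup_upper) auto
    then show ?thesis using assms(2,3) that by simp
  qed
  have "\<Omega> \<noteq> UNIV"
  proof
    assume "\<Omega> = UNIV"
    then have "r + 1 \<le> r" using assms(3) by (intro in_le) auto
    then show False by simp
  qed
  then have "closed (- \<Omega>)" "- \<Omega> \<noteq> {}" using assms(1) by auto
  then obtain y where y: "y \<in> - \<Omega>" "\<And>z. z \<in> - \<Omega> \<Longrightarrow> dist x y \<le> dist x z"
    using distance_attains_inf by metis
  have "0 < dist x y" using y(1) assms(4) by auto
  moreover have "dist x y \<le> r"
  proof (rule in_le)
    show "ball x (dist x y) \<subseteq> \<Omega>" using y(2) by (force simp: not_less[symmetric])
  qed fact
  ultimately show thesis using y(1) that by blast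
qed

text \<open>Ties between nearest points are broken by the injection \<open>idx\<close>, so that the cells are disjoint.\<close>

definition voronoi_cell :: "('a::metric_space \<Rightarrow> nat) \<Rightarrow> 'a set \<Rightarrow> 'a \<Rightarrow> 'a set" where
  "voronoi_cell idx Y y = {x. \<forall>z\<in>Y. dist x y < dist x z \<or> dist x y = dist x z \<and> idx y \<le> idx z}"

text \<open>Moving from \<open>x\<close> towards \<open>y\<close> shortens the distance to
  \<open>y\<close> by the full length of the move and the distance to any \<open>z\<close> by at
  most that, so both the comparison and the resolution of ties survive.\<close>

lemma voronoi_cell_star:
  fixes y :: "'a::euclidean_space"
  assumes "x \<in> voronoi_cell idx Y y" "0 < t" "t \<le> 1"
  shows "y + t *\<^sub>R (x - y) \<in> voronoi_cell idx Y y"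
  unfolding voronoi_cell_def
proof (intro CollectI ballI)
  fix z assume "z \<in> Y"
  let ?w = "y + t *\<^sub>R (x - y)"
  have 1: "dist ?w y = t * dist x y" using assms by (simp add: dist_norm)
  have "dist x ?w = (1 - t) * dist x y"
  proof -
    have "x - ?w = (1 - t) *\<^sub>R (x - y)" by (simp add: algebra_simps)
    then show ?thesis using assms by (simp add: dist_norm)
  qed
  then have 2: "dist x z \<le> (1 - t) * dist x y + dist ?w z" using dist_triangle[of x z ?w] by simp
  have "dist x y < dist x z \<or> dist x y = dist x z \<and> idx y \<le> idx z"
    using assms(1) \<open>z \<in> Y\<close> by (simp add: voronoi_cell_def)
  then show "dist ?w y < dist ?w z \<or> dist ?w y = dist ?w z \<and> idx y \<le> idx z"
    using 1 2 by (auto simp: left_diff_distrib)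
qed

lemma voronoi_cell_borel:
  fixes y :: "'a::euclidean_space"
  assumes "finite Y"
  shows "voronoi_cell idx Y y \<in> sets borel"
proof -
  have "voronoi_cell idx Y y = (\<Inter>z\<in>Y. {x. dist x y < dist x z} \<union> {x. dist x y = dist x z \<and> idx y \<le> idx z})"
    by (auto simp: voronoi_cell_def)
  moreover have "{x. dist x y = dist x z \<and> idx y \<le> idx z} \<in> sets borel" for z
    by (cases "idx y \<le> idx z") (auto intro!: borel_closed closed_Collect_eq continuous_intros)
  moreover have "{x. dist x y < dist x z} \<in> sets borel" for z
    by (intro borel_open open_Collect_less continuous_intros)
  ultimately show ?thesis
    using assms by (auto intro!: sets.countable_INT'' countable_finite)
qed

lemma voronoi_cell_disjoint:
  assumes "inj_on idx Y"
  shows "disjoint_family_on (voronoi_cell idx Y) Y"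
  unfolding disjoint_family_on_def
proof (intro ballI impI)
  fix y z assume yz: "y \<in> Y" "z \<in> Y" "y \<noteq> z"
  then have "idx y \<noteq> idx z" using assms by (auto dest: inj_onD)
  then show "voronoi_cell idx Y y \<inter> voronoi_cell idx Y z = {}"
    using yz by (force simp: voronoi_cell_def)
qed

lemma voronoi_cell_cover:
  assumes "finite Y" "Y \<noteq> {}"
  obtains y where "y \<in> Y" "x \<in> voronoi_cell idx Y y"
proof -
  \<comment> \<open>\<open>M\<close> is the set of nearest points; the one of least index has
    \<open>x\<close> in its cell.\<close>
  define M where "M = {y \<in> Y. \<forall>z\<in>Y. dist x y \<le> dist x z}"
  have "arg_min_on (dist x) Y \<in> M"
    using assms by (auto simp: M_def arg_min_if_finite(1) not_less[symmetric] dest: arg_min_if_finite(2))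
  then have M: "finite M" "M \<noteq> {}" using assms by (auto simp: M_def)
  define y where "y = arg_min_on idx M"
  have yM: "y \<in> M" using M by (simp add: y_def arg_min_if_finite(1))
  have "x \<in> voronoi_cell idx Y y"
    unfolding voronoi_cell_def
  proof (intro CollectI ballI)
    fix z assume z: "z \<in> Y"
    show "dist x y < dist x z \<or> dist x y = dist x z \<and> idx y \<le> idx z"
    proof (cases "z \<in> M")
      case True
      have "idx y \<le> idx z" using arg_min_least[OF M True, of idx] by (simp add: y_def)
      moreover have "dist x y = dist x z" using True yM by (intro antisym) (auto simp: M_def)
      ultimately show ?thesis by simp
    next
      case False
      then obtain w where "w \<in> Y" "dist x w < dist x z" using z by (auto simp: M_def not_le)
      moreover have "dist x y \<le> dist x w" using yM \<open>w \<in> Y\<close> by (auto simp: M_def)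
      ultimately show ?thesis by simp
    qed
  qed
  then show thesis using yM that by (auto simp: M_def)
qed

text \<open>The slack \<open>\<rho> > r\<close> turns nearest points at distance at most
  \<open>r\<close> into a cover of the support by open balls, from which compactness selects
  finitely many centres. Summing over the disjoint cells gives the inequality with
  \<open>\<rho>\<close>, which then decreases to \<open>r\<close>.\<close>

lemma poincare_inequality_inradius:
  fixes \<Omega> :: "'a::euclidean_space set"
  assumes \<Omega>: "open \<Omega>" "inradius \<Omega> = ennreal r" "0 \<le> r" and p: "real DIM('a) < p"
    and u: "u \<in> test_functions \<Omega>"
  shows "(\<integral>\<^sup>+x. ennreal (\<bar>u x\<bar> powr p) \<partial>lborel)
    \<le> ennreal (r powr p / ray_const (real DIM('a)) p) * (\<integral>\<^sup>+x. ennreal (norm (grad u x) powr p) \<partial>lborel)"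
proof -
  let ?c = "ray_const (real DIM('a)) p"
  let ?E = "\<integral>\<^sup>+x. ennreal (norm (grad u x) powr p) \<partial>lborel"
  have n1: "1 \<le> real DIM('a)" using DIM_positive[where 'a='a] by linarith
  have p1: "1 < p" using p n1 by linarith
  have c: "0 < ?c" using n1 p by (rule ray_const_pos)
  obtain L where L: "L-lipschitz_on UNIV u" using test_functions_gradient(4)[OF u] by blast
  have [measurable]: "u \<in> borel_measurable borel" "grad u \<in> borel_measurable borel"
    using test_functions_gradient(2,3)[OF u] by (auto intro: borel_measurable_continuous_onI)
  let ?S = "closure {x. u x \<noteq> 0}"
  have S: "compact ?S" "?S \<subseteq> \<Omega>" using u by (auto simp: test_functions_def)
  have bound: "(\<integral>\<^sup>+x. ennreal (\<bar>u x\<bar> powr p) \<partial>lborel) \<le> ennreal (\<rho> powr p / ?c) * ?E" if \<rho>: "r < \<rho>" for \<rho>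
  proof (cases "?S = {}")
    case True
    then have "u x = 0" for x using closure_subset[of "{x. u x \<noteq> 0}"] by auto
    then show ?thesis using p1 by simp
  next
    case False
    have "?S \<subseteq> (\<Union>y\<in>- \<Omega>. ball y \<rho>)"
    proof
      fix x assume "x \<in> ?S"
      then have "x \<in> \<Omega>" using S by blast
      then obtain y where "y \<notin> \<Omega>" "dist x y \<le> r" by (rule nearest_outside_le_inradius[OF \<Omega>])
      then show "x \<in> (\<Union>y\<in>- \<Omega>. ball y \<rho>)" using \<rho> by (intro UN_I[of y]) (auto simp: dist_commute)
    qed
    then obtain Y where Y: "Y \<subseteq> - \<Omega>" "finite Y" "?S \<subseteq> (\<Union>y\<in>Y. ball y \<rho>)"
      using compactE_image[OF S(1), of "- \<Omega>" "\<lambda>y. ball y \<rho>"] by (metis open_ball)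
    have Yne: "Y \<noteq> {}" using Y(3) False by auto
    obtain idx :: "'a \<Rightarrow> nat" where idx: "inj_on idx Y" using finite_imp_inj_to_nat_seg[OF Y(2)] by blast
    define K where "K y = voronoi_cell idx Y y \<inter> ball y \<rho>" for y
    have KB: "K y \<in> sets borel" for y unfolding K_def using voronoi_cell_borel[OF Y(2)] by auto
    note [measurable] = KB
    have disj: "disjoint_family_on K Y"
      using voronoi_cell_disjoint[OF idx] unfolding disjoint_family_on_def K_def by blast
    have cover: "x \<in> (\<Union>y\<in>Y. K y)" if "u x \<noteq> 0" for x
    proof -
      have "x \<in> ?S" using that by (intro subsetD[OF closure_subset]) simp
      then obtain z where z: "z \<in> Y" "dist z x < \<rho>" using Y(3) by auto
      obtain y where y: "y \<in> Y" "x \<in> voronoi_cell idx Y y" by (rule voronoi_cell_cover[OF Y(2) Yne])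
      \<comment> \<open>The centre of the cell is at least as close as \<open>z\<close>, so cutting
        cells at radius \<open>\<rho>\<close> loses no point of the support.\<close>
      have "dist x y \<le> dist x z" using y(2) z(1) by (auto simp: voronoi_cell_def)
      then have "x \<in> K y" using z(2) y(2) by (simp add: K_def dist_commute)
      then show ?thesis using y(1) by blast
    qed
    have cell: "(\<integral>\<^sup>+x. ennreal (\<bar>u x\<bar> powr p) * indicator (K y) x \<partial>lborel)
        \<le> ennreal (\<rho> powr p / ?c) * (\<integral>\<^sup>+x. ennreal (norm (grad u x) powr p) * indicator (K y) x \<partial>lborel)" if y: "y \<in> Y" for y
    proof -
      have "u y = 0" using y Y(1) S(2) closure_subset[of "{x. u x \<noteq> 0}"] by auto
      moreover have "(\<integral>\<^sup>+x. ennreal (\<bar>u x - u y\<bar> powr p) * indicator (K y) x \<partial>lborel)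
        \<le> ennreal (\<rho> powr p / ?c) * (\<integral>\<^sup>+x. ennreal (norm (grad u x) powr p) * indicator (K y) x \<partial>lborel)"
      proof (rule star_shaped_poincare[OF L KB _ _ _ p])
        fix x and t :: real assume x: "x \<in> K y" and t: "0 < t" "t \<le> 1"
        have "dist y (y + t *\<^sub>R (x - y)) = t * dist y x" using t by (simp add: dist_norm norm_minus_commute)
        then have "dist y (y + t *\<^sub>R (x - y)) < \<rho>"
          using x t mult_left_le_one_le[of "dist y x" t] by (simp add: K_def)
        then show "y + t *\<^sub>R (x - y) \<in> K y" using voronoi_cell_star[of x idx Y y t] x t by (simp add: K_def)
      qed (use \<rho> \<Omega>(3) in \<open>auto simp: K_def\<close>)
      ultimately show ?thesis by simp
    qed
    have ind: "(\<Sum>y\<in>Y. indicator (K y) x) = (indicator (\<Union>y\<in>Y. K y) x :: ennreal)" for x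
      using disj Y(2) by (simp add: indicator_UN_disjoint)
    have "(\<integral>\<^sup>+x. ennreal (\<bar>u x\<bar> powr p) \<partial>lborel) = (\<integral>\<^sup>+x. (\<Sum>y\<in>Y. ennreal (\<bar>u x\<bar> powr p) * indicator (K y) x) \<partial>lborel)"
      using cover p1 by (intro nn_integral_cong) (auto simp: sum_distrib_left[symmetric] ind split: split_indicator)
    also have "\<dots> = (\<Sum>y\<in>Y. \<integral>\<^sup>+x. ennreal (\<bar>u x\<bar> powr p) * indicator (K y) x \<partial>lborel)"
      by (rule nn_integral_sum) measurable
    also have "\<dots> \<le> (\<Sum>y\<in>Y. ennreal (\<rho> powr p / ?c) * (\<integral>\<^sup>+x. ennreal (norm (grad u x) powr p) * indicator (K y) x \<partial>lborel))"
      by (intro sum_mono cell)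
    also have "\<dots> = ennreal (\<rho> powr p / ?c) * (\<Sum>y\<in>Y. \<integral>\<^sup>+x. ennreal (norm (grad u x) powr p) * indicator (K y) x \<partial>lborel)"
      by (rule sum_distrib_left[symmetric])
    also have "(\<Sum>y\<in>Y. \<integral>\<^sup>+x. ennreal (norm (grad u x) powr p) * indicator (K y) x \<partial>lborel)
        = (\<integral>\<^sup>+x. (\<Sum>y\<in>Y. ennreal (norm (grad u x) powr p) * indicator (K y) x) \<partial>lborel)"
      by (rule nn_integral_sum[symmetric]) measurable
    also have "(\<integral>\<^sup>+x. (\<Sum>y\<in>Y. ennreal (norm (grad u x) powr p) * indicator (K y) x) \<partial>lborel) \<le> ?E"
      by (intro nn_integral_mono) (auto simp: sum_distrib_left[symmetric] ind split: split_indicator)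
    finally show ?thesis by (simp add: mult_left_mono)
  qed
  show ?thesis
  proof (cases "?E = top")
    case True
    show ?thesis
    proof (cases "r = 0")
      case False
      then show ?thesis using True \<Omega>(3) c by (simp add: ennreal_mult_top)
    next
      \<comment> \<open>Here the right-hand side is \<open>0 * top = 0\<close>, so the left-hand
        side must vanish: inradius 0 forces \<open>\<Omega>\<close> to be empty.\<close>
      case r: True
      have "\<Omega> = {}" using nearest_outside_le_inradius[OF \<Omega>] r by force
      then have "u x = 0" for x using S(2) closure_subset[of "{x. u x \<noteq> 0}"] by auto
      then show ?thesis using p1 by simp
    qed
  next
    case False
    then obtain E where E: "?E = ennreal E" "0 \<le> E" by (cases ?E) auto
    have "(\<integral>\<^sup>+x. ennreal (\<bar>u x\<bar> powr p) \<partial>lborel) \<noteq> top"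
      using bound[of "r + 1"] unfolding E(1) by (auto simp: ennreal_mult_eq_top_iff top_unique)
    then obtain I where I: "(\<integral>\<^sup>+x. ennreal (\<bar>u x\<bar> powr p) \<partial>lborel) = ennreal I" "0 \<le> I"
      by (cases "\<integral>\<^sup>+x. ennreal (\<bar>u x\<bar> powr p) \<partial>lborel") auto
    have "I \<le> \<rho> powr p / ?c * E" if "r < \<rho>" for \<rho>
      using bound[OF that] E(2) c unfolding E(1) I(1) by (simp add: ennreal_mult[symmetric])
    then have "\<forall>\<^sub>F \<rho> in at_right r. I \<le> \<rho> powr p / ?c * E"
      by (simp add: eventually_at_right_less eventually_mono[OF eventually_at_right_less])
    moreover have "((\<lambda>\<rho>. \<rho> powr p / ?c * E) \<longlongrightarrow> r powr p / ?c * E) (at_right r)"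
      using c p1 \<Omega>(3) by (intro tendsto_intros tendsto_powr') (auto simp: eventually_at_right_less eventually_mono[OF eventually_at_right_less])
    ultimately have "I \<le> r powr p / ?c * E" by (intro tendsto_lowerbound) auto
    then show ?thesis unfolding E(1) I(1) using E(2) c by (simp add: ennreal_mult[symmetric] ennreal_leI)
  qed
qed

section \<open>Constants of open sets and their asymptotics\<close>

lemma le_divide_ennreal:
  fixes a b c :: ennreal
  assumes "a * b \<le> c" "b \<noteq> 0" "b \<noteq> top"
  shows "a \<le> c / b"
proof -
  have "a = a * b / b" using assms by (simp add: ennreal_mult_divide_eq)
  also have "\<dots> \<le> c / b" by (rule divide_right_mono_ennreal) fact
  finally show ?thesis .
qed

lemma test_functions_outside:
  fixes u :: "'a::euclidean_space \<Rightarrow> real"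
  assumes u: "u \<in> test_functions \<Omega>" and x: "x \<notin> \<Omega>"
  shows "u x = 0" "grad u x = 0"
proof -
  let ?S = "closure {x. u x \<noteq> 0}"
  have xS: "x \<notin> ?S" using u x by (auto simp: test_functions_def)
  then show "u x = 0" using closure_subset[of "{x. u x \<noteq> 0}"] by auto
  show "grad u x = 0" by (rule grad_eq[OF GDERIV_outside_support[OF xS]])
qed

lemma test_functions_attains_max:
  fixes u :: "'a::euclidean_space \<Rightarrow> real"
  assumes u: "u \<in> test_functions \<Omega>" and nz: "u \<noteq> (\<lambda>x. 0)"
  obtains x where "x \<in> \<Omega>" "0 < \<bar>u x\<bar>" "\<And>y. \<bar>u y\<bar> \<le> \<bar>u x\<bar>"
proof -
  let ?S = "closure {x. u x \<noteq> 0}"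
  obtain z where z: "u z \<noteq> 0" using nz by auto
  have zS: "z \<in> ?S" using z by (intro subsetD[OF closure_subset]) simp
  have "continuous_on ?S (\<lambda>x. \<bar>u x\<bar>)"
    by (intro continuous_intros continuous_on_subset[OF test_functions_gradient(2)[OF u]]) auto
  moreover have S: "compact ?S" "?S \<subseteq> \<Omega>" using u by (auto simp: test_functions_def)
  ultimately obtain x where x: "x \<in> ?S" "\<And>y. y \<in> ?S \<Longrightarrow> \<bar>u y\<bar> \<le> \<bar>u x\<bar>"
    using continuous_attains_sup[of ?S "\<lambda>x. \<bar>u x\<bar>"] zS by (metis empty_iff)
  have "\<bar>u y\<bar> \<le> \<bar>u x\<bar>" for y
  proof (cases "u y = 0")
    case False
    then show ?thesis by (intro x(2) subsetD[OF closure_subset]) simp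
  qed simp
  moreover have "0 < \<bar>u x\<bar>" using x(2)[OF zS] z by linarith
  ultimately show thesis using x(1) S(2) that by blast
qed

lemma poincare_const_lower:
  fixes \<Omega> :: "'a::euclidean_space set"
  assumes \<Omega>: "open \<Omega>" "inradius \<Omega> < top" and p: "real DIM('a) < p"
  shows "ennreal (ray_const (real DIM('a)) p) / ennpowr (inradius \<Omega>) p \<le> poincare_const p (ennreal p) \<Omega>"
  unfolding poincare_const_def
proof (rule INF_greatest)
  fix u assume "u \<in> test_functions \<Omega> - {\<lambda>x. 0}"
  then have u: "u \<in> test_functions \<Omega>" and nz: "u \<noteq> (\<lambda>x. 0)" by auto
  let ?c = "ray_const (real DIM('a)) p"
  have n1: "1 \<le> real DIM('a)" using DIM_positive[where 'a='a] by linarith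
  have p1: "1 < p" using p n1 by linarith
  have c: "0 < ?c" using n1 p by (rule ray_const_pos)
  have \<Omega>B: "\<Omega> \<in> sets borel" using \<Omega>(1) by simp
  obtain r where r: "inradius \<Omega> = ennreal r" "0 \<le> r" using \<Omega>(2) by (cases "inradius \<Omega>") auto
  obtain x where x: "x \<in> \<Omega>" "0 < \<bar>u x\<bar>" "\<And>y. \<bar>u y\<bar> \<le> \<bar>u x\<bar>" by (rule test_functions_attains_max[OF u nz]) blast
  obtain y where "y \<notin> \<Omega>" "0 < dist x y" "dist x y \<le> r" by (rule nearest_outside_le_inradius[OF \<Omega>(1) r x(1)])
  then have r0: "0 < r" by linarith
  have cu: "continuous_on UNIV u" using test_functions_gradient(2)[OF u] .
  have [measurable]: "u \<in> borel_measurable borel" using cu by (rule borel_measurable_continuous_onI)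
  let ?I = "\<integral>\<^sup>+x. ennreal (\<bar>u x\<bar> powr p) \<partial>lborel" and ?E = "\<integral>\<^sup>+x. ennreal (norm (grad u x) powr p) \<partial>lborel"
  have I: "ennpowr (Lnorm (ennreal p) \<Omega> u) p = ?I"
    using p1 test_functions_outside(1)[OF u]
    by (subst ennpowr_Lnorm) (auto simp: nn_integral_lebesgue_on_borel[OF \<Omega>B] intro!: nn_integral_cong split: split_indicator)
  have E: "ennpowr (Lnorm (ennreal p) \<Omega> (grad u)) p = ?E"
    using p1 test_functions_outside(2)[OF u]
    by (subst ennpowr_Lnorm) (auto simp: nn_integral_lebesgue_on_borel[OF \<Omega>B] intro!: nn_integral_cong split: split_indicator)
  \<comment> \<open>\<open>le_divide_ennreal\<close> turns a product bound into a bound on the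
    quotient only for a denominator that is neither 0 nor infinite.\<close>
  have "?I \<noteq> 0"
  proof
    assume "?I = 0"
    then have ae: "AE x in lborel. u x = 0" using p1 by (subst (asm) nn_integral_0_iff_AE) (auto simp: ennreal_eq_0_iff elim!: eventually_mono)
    have op: "open {x. u x \<noteq> 0}" using cu by (intro open_Collect_neq continuous_intros)
    have "{x. u x \<noteq> 0} \<in> null_sets lborel"
      using ae op by (subst (asm) AE_iff_null) auto
    then have "negligible {x. u x \<noteq> 0}" by (simp add: negligible_iff_null_sets null_sets_completionI)
    then show False using open_not_negligible[OF op] x(2) by auto
  qed
  moreover have "?I \<noteq> top"
  proof -
    let ?S = "closure {x. u x \<noteq> 0}"
    have S: "compact ?S" using u by (simp add: test_functions_def)
    have "?I \<le> (\<integral>\<^sup>+y. ennreal (\<bar>u x\<bar> powr p) * indicator ?S y \<partial>lborel)"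
    proof (rule nn_integral_mono)
      fix y
      show "ennreal (\<bar>u y\<bar> powr p) \<le> ennreal (\<bar>u x\<bar> powr p) * indicator ?S y"
      proof (cases "u y = 0")
        case False
        then have "y \<in> ?S" by (intro subsetD[OF closure_subset]) simp
        then show ?thesis using x(3)[of y] p1 by (auto intro!: ennreal_leI powr_mono2)
      qed (use p1 in auto)
    qed
    also have "\<dots> = ennreal (\<bar>u x\<bar> powr p) * emeasure lborel ?S"
      by (rule nn_integral_cmult_indicator) auto
    also have "\<dots> < top" using emeasure_compact_finite[OF S] by (simp add: ennreal_mult_less_top)
    finally show ?thesis by simp
  qed
  moreover have "(ennreal ?c / ennpowr (inradius \<Omega>) p) * ?I \<le> ?E"
  proof -
    have "(ennreal ?c / ennpowr (inradius \<Omega>) p) * ?I = ennreal (?c / r powr p) * ?I"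
      using r r0 c by (simp add: ennpowr_ennreal divide_ennreal)
    also have "\<dots> \<le> ennreal (?c / r powr p) * (ennreal (r powr p / ?c) * ?E)"
      by (intro mult_left_mono poincare_inequality_inradius[OF \<Omega>(1) r p u]) auto
    also have "\<dots> = ?E" using r0 c by (simp add: mult.assoc[symmetric] ennreal_mult[symmetric])
    finally show ?thesis .
  qed
  ultimately show "ennreal ?c / ennpowr (inradius \<Omega>) p \<le> ennpowr (Lnorm (ennreal p) \<Omega> (grad u)) p / ennpowr (Lnorm (ennreal p) \<Omega> u) p"
    unfolding I E by (intro le_divide_ennreal)
qed

text \<open>With \<open>y\<close> a point outside \<open>\<Omega>\<close> nearest to the maximum
  point \<open>x\<close> and \<open>d = dist x y\<close>, the map from \<open>z\<close> to
  \<open>y + d z\<close> takes 0 to a zero of \<open>u\<close> and a unit vector to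
  \<open>x\<close>. So \<open>v\<close> has the same supremum as \<open>u\<close>, even though the
  ball around \<open>y\<close> leaves \<open>\<Omega>\<close>, and its energy is at most
  \<open>d^(p-N)\<close> times that of \<open>u\<close>, where \<open>d \<le> r\<close>.\<close>

lemma poincare_const_top_lower:
  fixes \<Omega> :: "'a::euclidean_space set"
  assumes \<Omega>: "open \<Omega>" "inradius \<Omega> < top" and p: "real DIM('a) < p"
  shows "punctured_const p top (ball (0::'a) 1) 0 / ennpowr (inradius \<Omega>) (p - real DIM('a)) \<le> poincare_const p top \<Omega>"
  unfolding poincare_const_def
proof (rule INF_greatest)
  fix u assume "u \<in> test_functions \<Omega> - {\<lambda>x. 0}"
  then have u: "u \<in> test_functions \<Omega>" and nz: "u \<noteq> (\<lambda>x. 0)" by auto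
  let ?n = "DIM('a)" and ?\<Lambda> = "punctured_const p top (ball (0::'a) 1) 0"
  have n1: "1 \<le> real ?n" using DIM_positive[where 'a='a] by linarith
  have p1: "1 < p" using p n1 by linarith
  have \<Omega>B: "\<Omega> \<in> sets borel" using \<Omega>(1) by simp
  obtain r where r: "inradius \<Omega> = ennreal r" "0 \<le> r" using \<Omega>(2) by (cases "inradius \<Omega>") auto
  obtain x where x: "x \<in> \<Omega>" "0 < \<bar>u x\<bar>" "\<And>y. \<bar>u y\<bar> \<le> \<bar>u x\<bar>" by (rule test_functions_attains_max[OF u nz]) blast
  obtain y where y: "y \<notin> \<Omega>" "0 < dist x y" "dist x y \<le> r" by (rule nearest_outside_le_inradius[OF \<Omega>(1) r x(1)])
  define d M where "d = dist x y" and "M = \<bar>u x\<bar>"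
  have d: "0 < d" "d \<le> r" and M: "0 < M" using x y by (auto simp: d_def M_def)
  have cu: "continuous_on A u" for A using test_functions_gradient(2)[OF u] continuous_on_subset by blast
  have [measurable]: "grad u \<in> borel_measurable borel"
    using test_functions_gradient(3)[OF u] by (rule borel_measurable_continuous_onI)
  let ?E = "\<integral>\<^sup>+x. ennreal (norm (grad u x) powr p) \<partial>lborel"
  define v where "v z = u (y + d *\<^sub>R z)" for z
  obtain L where L: "L-lipschitz_on UNIV u" using test_functions_gradient(4)[OF u] by blast
  have vL: "(L * d)-lipschitz_on (closure (ball 0 1)) v"
  proof (rule lipschitz_onI)
    fix a b
    have "dist (v a) (v b) \<le> L * dist (y + d *\<^sub>R a) (y + d *\<^sub>R b)"
      unfolding v_def by (rule lipschitz_onD[OF L]) auto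
    also have "dist (y + d *\<^sub>R a) (y + d *\<^sub>R b) = d * dist a b"
      using d(1) by (simp add: dist_norm scaleR_diff_right[symmetric])
    finally show "dist (v a) (v b) \<le> L * d * dist a b" by simp
  qed (use lipschitz_on_nonneg[OF L] d in auto)
  have vG: "GDERIV v z :> d *\<^sub>R grad u (y + d *\<^sub>R z)" for z
  proof -
    have "((\<lambda>z. u (y + d *\<^sub>R z)) has_derivative (\<lambda>h. (d *\<^sub>R h) \<bullet> grad u (y + d *\<^sub>R z))) (at z)"
    proof (rule has_derivative_compose[of "\<lambda>z. y + d *\<^sub>R z" _ _ _ u, simplified])
      show "((\<lambda>z. y + d *\<^sub>R z) has_derivative (\<lambda>h. d *\<^sub>R h)) (at z)" by (auto intro!: derivative_eq_intros)
      show "(u has_derivative (\<lambda>h. h \<bullet> grad u (y + d *\<^sub>R z))) (at (y + d *\<^sub>R z))"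
        using test_functions_gradient(1)[OF u] by (simp add: gderiv_def)
    qed
    then show ?thesis by (simp add: gderiv_def v_def[abs_def])
  qed
  have Lv: "Lnorm top (ball 0 1) v = ennreal M"
  proof (rule antisym)
    show "Lnorm top (ball 0 1) v \<le> ennreal M"
      using lipschitz_on_continuous_on[OF vL] x(3)
      by (intro Lnorm_top_le continuous_imp_measurable_on_sets_lebesgue)
         (auto simp: v_def M_def intro: continuous_on_subset)
    let ?z = "(1 / d) *\<^sub>R (x - y)"
    have "v ?z = u x" using d by (simp add: v_def)
    moreover have "?z \<in> closure (ball 0 1)" using d by (simp add: d_def dist_norm)
    ultimately show "ennreal M \<le> Lnorm top (ball 0 1) v"
      using norm_le_Lnorm_top[OF open_ball lipschitz_on_continuous_on[OF vL], of ?z] by (simp add: M_def)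
  qed
  have Lu: "Lnorm top \<Omega> u = ennreal M"
  proof (rule antisym)
    show "Lnorm top \<Omega> u \<le> ennreal M"
      using x(3) \<Omega>B by (intro Lnorm_top_le continuous_imp_measurable_on_sets_lebesgue cu) (auto simp: M_def)
    show "ennreal M \<le> Lnorm top \<Omega> u"
      using norm_le_Lnorm_top[OF \<Omega>(1) cu, of x] x(1) closure_subset[of \<Omega>] by (auto simp: M_def)
  qed
  have E: "ennpowr (Lnorm (ennreal p) \<Omega> (grad u)) p = ?E"
    using p1 test_functions_outside(2)[OF u]
    by (subst ennpowr_Lnorm) (auto simp: nn_integral_lebesgue_on_borel[OF \<Omega>B] intro!: nn_integral_cong split: split_indicator)
  have "?\<Lambda> * ennreal (M powr p) \<le> (\<integral>\<^sup>+z. ennreal (norm (grad v z) powr p) * indicator (ball 0 1) z \<partial>lborel)"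
    using vG Lv M test_functions_outside(1)[OF u y(1)]
    by (intro punctured_const_mult_le[OF vL]) (auto simp: v_def)
  also have "\<dots> \<le> (\<integral>\<^sup>+z. ennreal (d powr p) * ennreal (norm (grad u (y + d *\<^sub>R z)) powr p) \<partial>lborel)"
    using d(1) by (intro nn_integral_mono)
      (auto simp: grad_eq[OF vG] powr_mult ennreal_mult[symmetric] split: split_indicator)
  also have "\<dots> = ennreal (d powr p) * (\<integral>\<^sup>+z. ennreal (norm (grad u (y + d *\<^sub>R z)) powr p) \<partial>lborel)"
    by (rule nn_integral_cmult) measurable
  also have "\<dots> = ennreal (d powr (p - real ?n)) * (ennreal (d ^ ?n) * (\<integral>\<^sup>+z. ennreal (norm (grad u (y + d *\<^sub>R z)) powr p) \<partial>lborel))"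
  proof -
    have "d powr p = d powr (p - real ?n) * d ^ ?n"
      using d(1) by (simp add: powr_realpow[symmetric] powr_add[symmetric])
    then have "ennreal (d powr p) = ennreal (d powr (p - real ?n)) * ennreal (d ^ ?n)"
      using d(1) by (simp add: ennreal_mult)
    then show ?thesis by (simp only: mult.assoc)
  qed
  also have "ennreal (d ^ ?n) * (\<integral>\<^sup>+z. ennreal (norm (grad u (y + d *\<^sub>R z)) powr p) \<partial>lborel) = ?E"
    by (rule nn_integral_lborel_scale[symmetric]) (use d in measurable)
  also have "ennreal (d powr (p - real ?n)) * ?E \<le> ennreal (r powr (p - real ?n)) * ?E"
    using d p by (intro mult_right_mono ennreal_leI powr_mono2) auto
  finally have main: "?\<Lambda> * ennreal (M powr p) \<le> ennreal (r powr (p - real ?n)) * ?E" .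
  have r0: "0 < r powr (p - real ?n)" using d by simp
  have "ennreal (1 / r powr (p - real ?n)) * (?\<Lambda> * ennreal (M powr p)) \<le> ennreal (1 / r powr (p - real ?n)) * (ennreal (r powr (p - real ?n)) * ?E)"
    using main by (rule mult_left_mono) auto
  also have "\<dots> = ?E" using r0 by (simp add: mult.assoc[symmetric] ennreal_mult[symmetric])
  finally have "(?\<Lambda> / ennpowr (inradius \<Omega>) (p - real ?n)) * ennreal (M powr p) \<le> ?E"
    using r r0 by (simp add: ennpowr_ennreal divide_ennreal_def inverse_ennreal inverse_eq_divide mult_ac)
  then show "?\<Lambda> / ennpowr (inradius \<Omega>) (p - real ?n) \<le> ennpowr (Lnorm (ennreal p) \<Omega> (grad u)) p / ennpowr (Lnorm top \<Omega> u) p"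
    unfolding E Lu using M by (intro le_divide_ennreal) (auto simp: ennpowr_ennreal)
qed

section \<open>Comparison of the constants with \<open>ray_const\<close>, and the
  asymptotics\<close>

lemma power_le_ray_const:
  fixes n p :: real
  assumes "1 \<le> n" "n < p"
  shows "((p - n) / p) powr p \<le> ray_const n p"
proof -
  have "((p - n) / p) powr p \<le> ((p - n) / p) powr (p - 1)" using assms by (intro powr_mono') auto
  also have "\<dots> \<le> ((p - n) / (p - 1)) powr (p - 1)"
    using assms by (intro powr_mono2 divide_left_mono) auto
  also have "\<dots> \<le> ray_const n p" using assms by (simp add: ray_const_def mult_le_cancel_right1)
  finally show ?thesis .
qed

lemma beta_const_bounds:
  assumes p: "real DIM('a::euclidean_space) < p"
  shows "beta_const TYPE('a) p \<le> ennreal (ray_const (real DIM('a)) p)"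
    and "ennreal (1 / (sqrt (real DIM('a)) + 1) powr p * ray_const (real DIM('a)) p) \<le> beta_const TYPE('a) p"
    and "ennreal (((p - real DIM('a)) / p) powr p) \<le> beta_const TYPE('a) p"
proof -
  let ?n = "real DIM('a)" and ?\<Lambda> = "punctured_const p (ennreal p) (ball (0::'a) 1) 0"
  have n1: "1 \<le> ?n" using DIM_positive[where 'a='a] by linarith
  have p1: "1 < p" using p n1 by linarith
  let ?c = "ray_const ?n p" and ?s = "(sqrt ?n + 1) powr p"
  have c: "0 < ?c" using n1 p by (rule ray_const_pos)
  have s: "2 \<le> ?s"
  proof -
    have "2 = 2 powr (1::real)" by simp
    also have "\<dots> \<le> 2 powr p" using p1 by (intro powr_mono) auto
    also have "\<dots> \<le> ?s" using n1 p1 by (intro powr_mono2) auto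
    finally show ?thesis .
  qed
  have "?\<Lambda> / ennreal ?s \<le> ennreal (2 * ?c) / ennreal ?s"
    by (rule divide_right_mono_ennreal[OF punctured_const_le_ray_const[OF p]])
  also have "\<dots> = ennreal (2 * ?c / ?s)" using s c by (intro divide_ennreal) auto
  also have "\<dots> \<le> ennreal ?c" using mult_left_mono[OF s, of ?c] s c
    by (intro ennreal_leI) (subst pos_divide_le_eq, auto simp: mult.commute)
  finally show "beta_const TYPE('a) p \<le> ennreal ?c"
    using power_le_ray_const[OF n1 p] by (auto simp: beta_const_def intro: ennreal_leI)
  have "ennreal (1 / ?s * ?c) = ennreal ?c / ennreal ?s" using s c by (subst divide_ennreal) auto
  also have "\<dots> \<le> ?\<Lambda> / ennreal ?s" by (rule divide_right_mono_ennreal[OF ray_const_le_punctured_const[OF p]])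
  finally show "ennreal (1 / ?s * ?c) \<le> beta_const TYPE('a) p" by (auto simp: beta_const_def le_max_iff_disj)
  show "ennreal (((p - ?n) / p) powr p) \<le> beta_const TYPE('a) p" by (simp add: beta_const_def)
qed

text \<open>With \<open>x = p - 1\<close> the quotient is \<open>p / x powr x\<close>, and
  \<open>x powr x\<close> lies between \<open>exp (- 1)\<close> and \<open>n powr n\<close> on
  \<open>(0, n)\<close>. The lower bound comes from \<open>ln x \<ge> 1 - 1 / x\<close> and remains
  uniform when \<open>n = 1\<close>, where \<open>x\<close> tends to 0.\<close>

lemma ray_const_ratio_bounds:
  fixes n p :: real
  assumes n: "1 \<le> n" and p: "n < p" "p < n + 1"
  shows "1 / n powr n \<le> ray_const n p / (p - n) powr (p - 1)"
    and "ray_const n p / (p - n) powr (p - 1) \<le> (n + 1) * exp 1"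
proof -
  define x where "x = p - 1"
  have x: "0 < x" "x < n" using n p by (auto simp: x_def)
  have eq: "ray_const n p / (p - n) powr (p - 1) = p / x powr x"
    using n p by (simp add: ray_const_def x_def powr_divide)
  have "x powr x \<le> n powr x" using x by (intro powr_mono2) auto
  also have "\<dots> \<le> n powr n" using x n by (intro powr_mono) auto
  finally have up: "x powr x \<le> n powr n" .
  have "1 - 1 / x \<le> ln x" using ln_le_minus_one[of "1 / x"] x by (simp add: ln_div)
  then have "x * (1 - 1 / x) \<le> x * ln x" using x by (intro mult_left_mono) auto
  then have "- 1 \<le> x * ln x" using x by (simp add: right_diff_distrib)
  then have "exp (- 1) \<le> x powr x" using x by (simp add: powr_def)
  moreover have pos: "0 < x powr x" using x by simp
  ultimately have lo: "1 \<le> x powr x * exp 1" by (simp add: exp_minus field_simps)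
  have "1 / n powr n \<le> 1 / x powr x" using up x by (intro divide_left_mono) auto
  also have "\<dots> \<le> p / x powr x" using n p by (intro divide_right_mono) auto
  finally show "1 / n powr n \<le> ray_const n p / (p - n) powr (p - 1)" unfolding eq .
  have "p \<le> (n + 1) * 1" using p by simp
  also have "\<dots> \<le> (n + 1) * (x powr x * exp 1)" using lo n by (intro mult_left_mono) auto
  finally show "ray_const n p / (p - n) powr (p - 1) \<le> (n + 1) * exp 1"
    unfolding eq using pos by (simp add: pos_divide_le_eq mult_ac)
qed

text \<open>Both constants of the theorem enter only through comparison with
  \<open>ray_const\<close>, with \<open>k\<close> and \<open>K\<close> independent of
  \<open>p\<close>.\<close>

lemma asymptotics_at_right:
  fixes n :: real and f :: "real \<Rightarrow> ennreal"
  assumes n: "1 \<le> n" and k: "0 < k" "0 \<le> K"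
    and lo: "\<And>p. n < p \<Longrightarrow> p < n + 1 \<Longrightarrow> ennreal (k * ray_const n p) \<le> f p"
    and up: "\<And>p. n < p \<Longrightarrow> p < n + 1 \<Longrightarrow> f p \<le> ennreal (K * ray_const n p)"
  shows "0 < Liminf (at_right n) (\<lambda>p. f p / ennreal ((p - n) powr (p - 1))) \<and>
      Liminf (at_right n) (\<lambda>p. f p / ennreal ((p - n) powr (p - 1)))
        \<le> Limsup (at_right n) (\<lambda>p. f p / ennreal ((p - n) powr (p - 1))) \<and>
      Limsup (at_right n) (\<lambda>p. f p / ennreal ((p - n) powr (p - 1))) < top"
proof (intro conjI)
  let ?g = "\<lambda>p. f p / ennreal ((p - n) powr (p - 1))"
  have ev: "\<forall>\<^sub>F p in at_right n. p \<in> {n<..<n + 1}" by (rule eventually_at_right_real) simp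
  have "ennreal (k * (1 / n powr n)) \<le> Liminf (at_right n) ?g"
  proof (rule Liminf_bounded, rule eventually_mono[OF ev])
    fix p assume "p \<in> {n<..<n + 1}"
    then have p: "n < p" "p < n + 1" by auto
    have "k * (1 / n powr n) \<le> k * (ray_const n p / (p - n) powr (p - 1))"
      using k ray_const_ratio_bounds(1)[OF n p] by (intro mult_left_mono) auto
    then have "ennreal (k * (1 / n powr n)) \<le> ennreal (k * ray_const n p / (p - n) powr (p - 1))"
      by (intro ennreal_leI) simp
    also have "\<dots> = ennreal (k * ray_const n p) / ennreal ((p - n) powr (p - 1))"
      using k p ray_const_pos[OF n p(1)] by (intro divide_ennreal[symmetric]) auto
    also have "\<dots> \<le> ?g p" by (rule divide_right_mono_ennreal[OF lo[OF p]])
    finally show "ennreal (k * (1 / n powr n)) \<le> ?g p" .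
  qed
  moreover have "0 < ennreal (k * (1 / n powr n))" using k n by simp
  ultimately show "0 < Liminf (at_right n) ?g" by (rule less_le_trans[rotated])
  show "Liminf (at_right n) ?g \<le> Limsup (at_right n) ?g" by (rule Liminf_le_Limsup) simp
  have "Limsup (at_right n) ?g \<le> ennreal (K * ((n + 1) * exp 1))"
  proof (rule Limsup_bounded, rule eventually_mono[OF ev])
    fix p assume "p \<in> {n<..<n + 1}"
    then have p: "n < p" "p < n + 1" by auto
    have "?g p \<le> ennreal (K * ray_const n p) / ennreal ((p - n) powr (p - 1))"
      by (rule divide_right_mono_ennreal[OF up[OF p]])
    also have "\<dots> = ennreal (K * (ray_const n p / (p - n) powr (p - 1)))"
      using k p ray_const_pos[OF n p(1)] by (subst divide_ennreal) auto
    also have "\<dots> \<le> ennreal (K * ((n + 1) * exp 1))"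
      using k ray_const_ratio_bounds(2)[OF n p] by (intro ennreal_leI mult_left_mono) auto
    finally show "?g p \<le> ennreal (K * ((n + 1) * exp 1))" .
  qed
  then show "Limsup (at_right n) ?g < top" by (rule le_less_trans) simp
qed

lemma ennpowr_mono: "0 < a \<Longrightarrow> x \<le> y \<Longrightarrow> ennpowr x a \<le> ennpowr y a"
  by (auto simp: ennpowr_def top_unique less_top[symmetric] intro!: ennreal_leI powr_mono2 enn2real_mono)

lemma beta_const_root_tendsto:
  "((\<lambda>p. ennpowr (beta_const TYPE('a::euclidean_space) p) (1 / p)) \<longlongrightarrow> 1) at_top"
proof (rule tendsto_sandwich)
  let ?n = "real DIM('a)"
  have n1: "1 \<le> ?n" using DIM_positive[where 'a='a] by linarith
  have ev: "\<forall>\<^sub>F p in at_top. ?n < p" by (rule eventually_gt_at_top)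
  show "\<forall>\<^sub>F p in at_top. ennreal ((p - ?n) / p) \<le> ennpowr (beta_const TYPE('a) p) (1 / p)"
    using ev
  proof (rule eventually_mono)
    fix p :: real assume p: "?n < p"
    have "ennreal ((p - ?n) / p) = ennpowr (ennreal (((p - ?n) / p) powr p)) (1 / p)"
      using p n1 by (simp add: ennpowr_ennreal powr_powr)
    also have "\<dots> \<le> ennpowr (beta_const TYPE('a) p) (1 / p)"
      using p n1 by (intro ennpowr_mono beta_const_bounds(3)) auto
    finally show "ennreal ((p - ?n) / p) \<le> ennpowr (beta_const TYPE('a) p) (1 / p)" .
  qed
  show "\<forall>\<^sub>F p in at_top. ennpowr (beta_const TYPE('a) p) (1 / p) \<le> ennreal (ray_const ?n p powr (1 / p))"
    using ev
  proof (rule eventually_mono)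
    fix p :: real assume p: "?n < p"
    have "ennpowr (beta_const TYPE('a) p) (1 / p) \<le> ennpowr (ennreal (ray_const ?n p)) (1 / p)"
      using p n1 by (intro ennpowr_mono beta_const_bounds(1)) auto
    then show "ennpowr (beta_const TYPE('a) p) (1 / p) \<le> ennreal (ray_const ?n p powr (1 / p))"
      using ray_const_pos[OF n1 p] by (simp add: ennpowr_ennreal)
  qed
  have "((\<lambda>p::real. (p - ?n) / p) \<longlongrightarrow> 1) at_top" by real_asymp
  then show "((\<lambda>p. ennreal ((p - ?n) / p)) \<longlongrightarrow> 1) at_top"
    by (metis (no_types) ennreal_1 tendsto_ennrealI)
  have "((\<lambda>p. ray_const ?n p powr (1 / p)) \<longlongrightarrow> 1) at_top" unfolding ray_const_def by real_asymp
  then show "((\<lambda>p. ennreal (ray_const ?n p powr (1 / p))) \<longlongrightarrow> 1) at_top"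
    by (metis (no_types) ennreal_1 tendsto_ennrealI)
qed

text \<open>In the lower half \<open>\<epsilon>\<close> is fixed before \<open>p\<close> tends to
  infinity: the volume of the small ball and \<open>ray_const\<close> have p-th roots tending to 1,
  and only \<open>1 / (1 + \<epsilon>)\<close> remains.\<close>

lemma punctured_const_top_root_tendsto:
  "((\<lambda>p. ennpowr (punctured_const p top (ball (0::'a::euclidean_space) 1) 0) (1 / p)) \<longlongrightarrow> 1) at_top"
proof (rule order_tendstoI)
  let ?n = "real DIM('a)" and ?\<Lambda> = "\<lambda>p. punctured_const p top (ball (0::'a) 1) 0"
  have n1: "1 \<le> ?n" using DIM_positive[where 'a='a] by linarith
  have ev: "\<forall>\<^sub>F p in at_top. ?n < p" by (rule eventually_gt_at_top)
  {
    fix a :: ennreal assume "a < 1"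
    then obtain b where b: "a = ennreal b" "0 \<le> b" "b < 1" by (cases a) (auto simp: ennreal_less_one_iff)
    obtain \<epsilon> where \<epsilon>: "0 < \<epsilon>" "\<epsilon> \<le> 1" "b < 1 / (1 + \<epsilon>)"
    proof -
      define e where "e = (1 - b) / 2"
      have e: "0 < e" "e \<le> 1" using b by (auto simp: e_def)
      have "b * e \<le> 1 * e" using b e by (intro mult_right_mono) auto
      moreover have "b + e < 1" using b(3) by (simp add: e_def field_simps)
      ultimately have "b * (1 + e) < 1" by (simp add: distrib_left)
      then have "b < 1 / (1 + e)" using e by (simp add: pos_less_divide_eq)
      then show thesis using e that by blast
    qed
    define V where "V = measure lborel (ball (0::'a) (\<epsilon> / 2))"
    have V: "0 < V" using \<epsilon> by (simp add: V_def content_ball_pos)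
    have "((\<lambda>p. (V * ray_const ?n p / (1 + \<epsilon>) powr p) powr (1 / p)) \<longlongrightarrow> exp (- ln (1 + \<epsilon>))) at_top"
      unfolding ray_const_def using V \<epsilon> by real_asymp
    also have "exp (- ln (1 + \<epsilon>)) = 1 / (1 + \<epsilon>)" using \<epsilon> by (simp add: exp_minus inverse_eq_divide)
    finally have "\<forall>\<^sub>F p in at_top. b < (V * ray_const ?n p / (1 + \<epsilon>) powr p) powr (1 / p)"
      using \<epsilon>(3) by (rule order_tendstoD)
    with ev show "\<forall>\<^sub>F p in at_top. a < ennpowr (?\<Lambda> p) (1 / p)"
    proof eventually_elim
      case (elim p)
      have "a < ennreal ((V * ray_const ?n p / (1 + \<epsilon>) powr p) powr (1 / p))"
        unfolding b(1) using elim(2) b(2) by (simp add: ennreal_less_iff)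
      also have "\<dots> = ennpowr (ennreal (V * ray_const ?n p / (1 + \<epsilon>) powr p)) (1 / p)"
        using V ray_const_pos[OF n1 elim(1)] by (simp add: ennpowr_ennreal)
      also have "\<dots> \<le> ennpowr (?\<Lambda> p) (1 / p)"
        using punctured_const_top_lower[OF elim(1) \<epsilon>(1,2)] elim(1) n1 unfolding V_def by (intro ennpowr_mono) auto
      finally show ?case .
    qed
  next
    fix a :: ennreal assume "1 < a"
    define c where "c = ?n * measure lborel (ball (0::'a) 1)"
    have c: "0 < c" using n1 by (simp add: c_def content_ball_pos)
    have "((\<lambda>p. (c * ((p - ?n) / (p - 1)) powr (p - 1)) powr (1 / p)) \<longlongrightarrow> 1) at_top"
      using c by real_asymp
    then have "((\<lambda>p. ennreal ((c * ((p - ?n) / (p - 1)) powr (p - 1)) powr (1 / p))) \<longlongrightarrow> 1) at_top"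
      by (metis (no_types) ennreal_1 tendsto_ennrealI)
    then have "\<forall>\<^sub>F p in at_top. ennreal ((c * ((p - ?n) / (p - 1)) powr (p - 1)) powr (1 / p)) < a"
      using \<open>1 < a\<close> by (rule order_tendstoD)
    with ev show "\<forall>\<^sub>F p in at_top. ennpowr (?\<Lambda> p) (1 / p) < a"
    proof eventually_elim
      case (elim p)
      have "ennpowr (?\<Lambda> p) (1 / p) \<le> ennpowr (ennreal (c * ((p - ?n) / (p - 1)) powr (p - 1))) (1 / p)"
        using punctured_const_top_upper[OF elim(1)] elim(1) n1 unfolding c_def by (intro ennpowr_mono) auto
      also have "\<dots> = ennreal ((c * ((p - ?n) / (p - 1)) powr (p - 1)) powr (1 / p))"
        using c by (simp add: ennpowr_ennreal)
      also have "\<dots> < a" by fact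
      finally show ?case .
    qed
  }
qed

theorem theorem4p5:
  fixes N :: real and \<beta> \<Lambda> :: "real \<Rightarrow> ennreal"
  assumes "N = real DIM('a::euclidean_space)"
    and "\<beta> = beta_const TYPE('a)"
    and "\<Lambda> = (\<lambda>p. punctured_const p top (ball (0::'a) 1) 0)"
  shows
    "(\<forall>p>N. \<beta> p > 0 \<and>
        (\<forall>\<Omega>::'a set. open \<Omega> \<and> inradius \<Omega> < top \<longrightarrow>
           poincare_const p (ennreal p) \<Omega> \<ge> \<beta> p / ennpowr (inradius \<Omega>) p \<and>
           poincare_const p top \<Omega> \<ge> \<Lambda> p / ennpowr (inradius \<Omega>) (p - N))) \<and>
     (0 < Liminf (at_right N) (\<lambda>p. \<beta> p / ennreal ((p - N) powr (p - 1))) \<and>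
      Liminf (at_right N) (\<lambda>p. \<beta> p / ennreal ((p - N) powr (p - 1)))
        \<le> Limsup (at_right N) (\<lambda>p. \<beta> p / ennreal ((p - N) powr (p - 1))) \<and>
      Limsup (at_right N) (\<lambda>p. \<beta> p / ennreal ((p - N) powr (p - 1))) < top) \<and>
     (0 < Liminf (at_right N) (\<lambda>p. \<Lambda> p / ennreal ((p - N) powr (p - 1))) \<and>
      Liminf (at_right N) (\<lambda>p. \<Lambda> p / ennreal ((p - N) powr (p - 1)))
        \<le> Limsup (at_right N) (\<lambda>p. \<Lambda> p / ennreal ((p - N) powr (p - 1))) \<and>
      Limsup (at_right N) (\<lambda>p. \<Lambda> p / ennreal ((p - N) powr (p - 1))) < top) \<and>
     ((\<lambda>p. ennpowr (\<beta> p) (1 / p)) \<longlongrightarrow> 1) at_top \<and>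
     ((\<lambda>p. ennpowr (\<Lambda> p) (1 / p)) \<longlongrightarrow> 1) at_top"
proof -
  note N = assms(1) and \<beta> = assms(2) and \<Lambda> = assms(3)
  have n1: "1 \<le> N" unfolding N using DIM_positive[where 'a='a] by linarith
  define \<omega> where "\<omega> = measure lborel (ball (0::'a) 1)"
  have "\<beta> p > 0 \<and>
        (\<forall>\<Omega>::'a set. open \<Omega> \<and> inradius \<Omega> < top \<longrightarrow>
           poincare_const p (ennreal p) \<Omega> \<ge> \<beta> p / ennpowr (inradius \<Omega>) p \<and>
           poincare_const p top \<Omega> \<ge> \<Lambda> p / ennpowr (inradius \<Omega>) (p - N))" if "N < p" for p
  proof (intro conjI allI impI)
    have p: "real DIM('a) < p" using that N by simp
    have "0 < ennreal (((p - N) / p) powr p)" using that n1 by simp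
    also have "\<dots> \<le> \<beta> p" unfolding \<beta> N by (rule beta_const_bounds(3)[OF p])
    finally show "\<beta> p > 0" .
    fix \<Omega> :: "'a set" assume \<Omega>: "open \<Omega> \<and> inradius \<Omega> < top"
    have "\<beta> p / ennpowr (inradius \<Omega>) p \<le> ennreal (ray_const N p) / ennpowr (inradius \<Omega>) p"
      unfolding \<beta> N by (rule divide_right_mono_ennreal[OF beta_const_bounds(1)[OF p]])
    also have "\<dots> \<le> poincare_const p (ennreal p) \<Omega>" unfolding N using \<Omega> p by (intro poincare_const_lower) auto
    finally show "poincare_const p (ennreal p) \<Omega> \<ge> \<beta> p / ennpowr (inradius \<Omega>) p" .
    show "poincare_const p top \<Omega> \<ge> \<Lambda> p / ennpowr (inradius \<Omega>) (p - N)"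
      unfolding \<Lambda> N using \<Omega> p by (intro poincare_const_top_lower) auto
  qed
  moreover have "0 < Liminf (at_right N) (\<lambda>p. \<beta> p / ennreal ((p - N) powr (p - 1))) \<and>
      Liminf (at_right N) (\<lambda>p. \<beta> p / ennreal ((p - N) powr (p - 1)))
        \<le> Limsup (at_right N) (\<lambda>p. \<beta> p / ennreal ((p - N) powr (p - 1))) \<and>
      Limsup (at_right N) (\<lambda>p. \<beta> p / ennreal ((p - N) powr (p - 1))) < top"
  proof (rule asymptotics_at_right[OF n1])
    have s0: "1 \<le> sqrt N + 1" using n1 by simp
    then have sp: "0 < (sqrt N + 1) powr q" for q unfolding powr_gt_zero by linarith
    \<comment> \<open>On \<open>(N, N + 1)\<close> the exponent \<open>p\<close> is replaced by its
      bound \<open>N + 1\<close>, which makes the factor independent of \<open>p\<close>.\<close>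
    then show "0 < 1 / (sqrt N + 1) powr (N + 1)" by simp
    fix p assume p: "N < p" "p < N + 1"
    then have pD: "real DIM('a) < p" using N by simp
    show "\<beta> p \<le> ennreal (1 * ray_const N p)" unfolding \<beta> N using beta_const_bounds(1)[OF pD] by simp
    have "1 / (sqrt N + 1) powr (N + 1) * ray_const N p \<le> 1 / (sqrt N + 1) powr p * ray_const N p"
      using s0 p ray_const_pos[OF n1 p(1)]
      by (intro mult_right_mono divide_left_mono powr_mono mult_pos_pos sp) auto
    then have "ennreal (1 / (sqrt N + 1) powr (N + 1) * ray_const N p) \<le> ennreal (1 / (sqrt N + 1) powr p * ray_const N p)"
      by (rule ennreal_leI)
    also have "\<dots> \<le> \<beta> p" unfolding \<beta> N by (rule beta_const_bounds(2)[OF pD])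
    finally show "ennreal (1 / (sqrt N + 1) powr (N + 1) * ray_const N p) \<le> \<beta> p" .
  qed simp
  moreover have "0 < Liminf (at_right N) (\<lambda>p. \<Lambda> p / ennreal ((p - N) powr (p - 1))) \<and>
      Liminf (at_right N) (\<lambda>p. \<Lambda> p / ennreal ((p - N) powr (p - 1)))
        \<le> Limsup (at_right N) (\<lambda>p. \<Lambda> p / ennreal ((p - N) powr (p - 1))) \<and>
      Limsup (at_right N) (\<lambda>p. \<Lambda> p / ennreal ((p - N) powr (p - 1))) < top"
  proof (rule asymptotics_at_right[OF n1])
    \<comment> \<open>The lower bound is taken at \<open>\<epsilon> = 1\<close>, hence radius
      \<open>1 / 2\<close> and base 2: near \<open>N\<close> only positivity of the factor
      counts.\<close>
    define V where "V = measure lborel (ball (0::'a) (1 / 2))"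
    have V: "0 < V" by (simp add: V_def content_ball_pos)
    then show "0 < V / 2 powr (N + 1)" by simp
    show "0 \<le> N * \<omega>" using n1 by (simp add: \<omega>_def)
    fix p assume p: "N < p" "p < N + 1"
    then have pD: "real DIM('a) < p" using N by simp
    have "V / 2 powr (N + 1) * ray_const N p \<le> V * ray_const N p / 2 powr p"
      using V p ray_const_pos[OF n1 p(1)] by (simp add: divide_left_mono)
    then have "ennreal (V / 2 powr (N + 1) * ray_const N p) \<le> ennreal (V * ray_const N p / (1 + 1) powr p)"
      by (intro ennreal_leI) simp
    also have "\<dots> \<le> \<Lambda> p" unfolding \<Lambda> N V_def by (rule punctured_const_top_lower[OF pD]) auto
    finally show "ennreal (V / 2 powr (N + 1) * ray_const N p) \<le> \<Lambda> p" .
    have "\<Lambda> p \<le> ennreal (N * \<omega> * ((p - N) / (p - 1)) powr (p - 1))"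
      unfolding \<Lambda> N \<omega>_def by (rule punctured_const_top_upper[OF pD])
    \<comment> \<open>\<open>ray_const\<close> carries an additional factor \<open>p\<close>, which
      is at least 1.\<close>
    also have "\<dots> \<le> ennreal (N * \<omega> * ray_const N p)"
      using n1 p unfolding ray_const_def
      by (intro ennreal_leI mult_left_mono) (auto simp: \<omega>_def mult_le_cancel_right1)
    finally show "\<Lambda> p \<le> ennreal (N * \<omega> * ray_const N p)" .
  qed
  ultimately show ?thesis
    using beta_const_root_tendsto[where 'a='a] punctured_const_top_root_tendsto[where 'a='a]
    unfolding \<beta> \<Lambda> by blast
qed

end
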